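(* Let $G\subseteq S_n$ be a permutation group containing the cycle $(1\,2\,\dots\,n)$, acting on $\mathbb Q^n$ by permuting coordinates. Let $\vec\delta\in\mathbb Q^n$, and let $V_\delta$ be the minimal $G$-invariant subspace of $\mathbb Q^n$ containing $\vec\delta$. Then $$V_\delta=\bigoplus_{d} U_d,$$ where $d$ runs over those $d\in D(G)$ for which there exists $r\in\Psi_d$ with $(\vec\delta,\vec w_r)\neq0$.
   Context: For a divisor $d$ of $n$, $V_d\subset\mathbb Q^n$ is the subspace of $d$-periodic vectors $(v_1,\dots,v_d,v_1,\dots,v_d,\dots,v_1,\dots,v_d)$. $D(G)$ is the set of divisors $d$ of $n$ such that $V_d$ is $G$-invariant; equivalently, the residue classes mod $d$ form a block system of $G$. For $d,\tilde d\in D(G)$, $d$ covers $\tilde d$ if $\tilde d\mid d$, $\tilde d<d$, and there is no $l\in D(G)$ with $\tilde d<l<d$, $\tilde d\mid l$, $l\mid d$. For $d\in D(G)$ let $U_d=V_d\cap V_{d_1}^\perp\cap\dots\cap V_{d_\ell}^\perp$, where $d_1,\dots,d_\ell$ are all elements of $D(G)$ covered by $d$ and $\perp$ is taken with respect to the standard scalar product. Let $\varepsilon_n=e^{2\pi i/n}$ and $\vec w_k=(1,\varepsilon_n^k,\varepsilon_n^{2k},\dots,\varepsilon_n^{(n-1)k})$ for $1\le k\le n$. The pairing $(\cdot,\cdot)$ is the standard Hermitian product on $\mathbb C^n$. For $d\in D(G)$, $\Psi_d$ is the set of $r\in\{1,\dots,n\}$ such that $n/d$ divides $r$ but $n/\tilde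 d$ does not divide $r$ for every $\tilde d\in D(G)$ covered by $d$. *)

theory Defs
  imports Complex_Main "HOL-Algebra.Sym_Groups"
begin

definition Qvec :: "nat \<Rightarrow> (nat \<Rightarrow> rat) set" where
  "Qvec n = {v. \<forall>i. i \<notin> {1..n} \<longrightarrow> v i = 0}"

definition qsubspace :: "nat \<Rightarrow> (nat \<Rightarrow> rat) set \<Rightarrow> bool" where
  "qsubspace n W \<longleftrightarrow> W \<subseteq> Qvec n \<and> (\<lambda>i. 0) \<in> W
     \<and> (\<forall>v\<in>W. \<forall>w\<in>W. (\<lambda>i. v i + w i) \<in> W)
     \<and> (\<forall>c. \<forall>v\<in>W. (\<lambda>i. c * v i) \<in> W)"

definition perm_act :: "(nat \<Rightarrow> nat) \<Rightarrow> (nat \<Rightarrow> rat) \<Rightarrow> (nat \<Rightarrow> rat)" where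
  "perm_act \<sigma> v = (\<lambda>i. v (inv_into UNIV \<sigma> i))"

definition G_invariant :: "(nat \<Rightarrow> nat) set \<Rightarrow> (nat \<Rightarrow> rat) set \<Rightarrow> bool" where
  "G_invariant G W \<longleftrightarrow> (\<forall>\<sigma>\<in>G. \<forall>v\<in>W. perm_act \<sigma> v \<in> W)"

definition ncycle :: "nat \<Rightarrow> nat \<Rightarrow> nat" where
  "ncycle n i = (if 1 \<le> i \<and> i < n then i + 1 else if i = n then 1 else i)"

definition V_delta :: "nat \<Rightarrow> (nat \<Rightarrow> nat) set \<Rightarrow> (nat \<Rightarrow> rat) \<Rightarrow> (nat \<Rightarrow> rat) set" where
  "V_delta n G \<delta> = \<Inter> {W. qsubspace n W \<and> G_invariant G W \<and> \<delta> \<in> W}"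

definition Vper :: "nat \<Rightarrow> nat \<Rightarrow> (nat \<Rightarrow> rat) set" where
  "Vper n d = {v \<in> Qvec n. \<forall>i\<in>{1..n}. v i = v (((i - 1) mod d) + 1)}"

definition DG :: "nat \<Rightarrow> (nat \<Rightarrow> nat) set \<Rightarrow> nat set" where
  "DG n G = {d. d dvd n \<and> G_invariant G (Vper n d)}"

definition covers :: "nat \<Rightarrow> (nat \<Rightarrow> nat) set \<Rightarrow> nat \<Rightarrow> nat \<Rightarrow> bool" where
  "covers n G d d' \<longleftrightarrow> d' dvd d \<and> d' < d \<and>
     \<not> (\<exists>l\<in>DG n G. d' < l \<and> l < d \<and> d' dvd l \<and> l dvd d)"

definition qinner :: "nat \<Rightarrow> (nat \<Rightarrow> rat) \<Rightarrow> (nat \<Rightarrow> rat) \<Rightarrow> rat" where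
  "qinner n v w = (\<Sum>i=1..n. v i * w i)"

definition Ud :: "nat \<Rightarrow> (nat \<Rightarrow> nat) set \<Rightarrow> nat \<Rightarrow> (nat \<Rightarrow> rat) set" where
  "Ud n G d = {v \<in> Vper n d. \<forall>d'\<in>DG n G. covers n G d d' \<longrightarrow>
                 (\<forall>w\<in>Vper n d'. qinner n v w = 0)}"

definition eps :: "nat \<Rightarrow> complex" where
  "eps n = cis (2 * pi / real n)"

definition wvec :: "nat \<Rightarrow> nat \<Rightarrow> nat \<Rightarrow> complex" where
  "wvec n k i = eps n ^ ((i - 1) * k)"

definition herm :: "nat \<Rightarrow> (nat \<Rightarrow> rat) \<Rightarrow> (nat \<Rightarrow> complex) \<Rightarrow> complex" where
  "herm n v w = (\<Sum>i=1..n. of_rat (v i) * cnj (w i))"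

definition Psi :: "nat \<Rightarrow> (nat \<Rightarrow> nat) set \<Rightarrow> nat \<Rightarrow> nat set" where
  "Psi n G d = {r \<in> {1..n}. (n div d) dvd r \<and>
      (\<forall>d'\<in>DG n G. covers n G d d' \<longrightarrow> \<not> (n div d') dvd r)}"

end

theory Submission
  imports Defs "HOL-Computational_Algebra.Computational_Algebra"
begin

text \<open>
  Functions on the integers modulo \<open>n\<close> that depend only on \<open>gcd x n\<close> and whose kernel
  \<open>f (i - j)\<close> is \<open>G\<close>-invariant form a space closed under pointwise products and convolution,
  a rational S-ring. Muzychuk's theorem says that such a space is spanned by the indicator
  functions of the subgroups \<open>d\<int>\<close> it contains, and these are exactly those with \<open>d \<in> D(G)\<close>.
  Since \<open>G\<close> contains the full cycle, the orthogonal projection onto \<open>V_\<delta>\<close> is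
  convolution with a rational idempotent \<open>e\<close>. Reading \<open>e ^ p = e\<close> modulo large primes \<open>p\<close>
  gives \<open>e (p x) = e x\<close>, so \<open>e x\<close> depends only on \<open>gcd x n\<close> and \<open>e\<close> lies in the S-ring. Its Fourier
  transform is therefore constant on each \<open>\<Psi>_d\<close>; as it only takes the values 0 and 1,
  \<open>V_\<delta>\<close> contains \<open>U_d\<close> as soon as \<open>\<delta>\<close> has a nonzero Fourier coefficient in \<open>\<Psi>_d\<close>.
\<close>

section \<open>Convolution of periodic functions\<close>

text \<open>What has to be shown is an irreducibility: one nonzero Fourier coefficient in
  \<open>Psi n G d\<close> must force all of \<open>Ud n G d\<close> into \<open>V_\<delta>\<close>,
  while invariance under the cycle alone only yields the smaller pieces of frequencies r with a
  fixed \<open>gcd r n\<close>. Muzychuk's theorem glues these pieces. The Fourier sum of the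
  indicator of \<open>{x. h dvd x}\<close> at r vanishes unless \<open>n dvd r * h\<close>, and for
  \<open>r \<in> Psi n G d\<close> and \<open>h \<in> DG n G\<close> this condition reads
  \<open>d dvd h\<close>; so no combination of such indicators can tell two frequencies of
  \<open>Psi n G d\<close> apart. Rationality is decisive, since over the complex numbers every
  single frequency spans a line invariant under the cycle. It enters through the prime argument for
  \<open>e\<close>, where clearing denominators gives integers that can be reduced modulo p. Residue
  classes are represented by periodic functions on all integers, so differences of the positions 1
  to n need no reduction.\<close>

definition periodic :: "int \<Rightarrow> (int \<Rightarrow> 'a) \<Rightarrow> bool" where
  "periodic n f \<longleftrightarrow> (\<forall>x. f (x mod n) = f x)"

lemma periodicD: "periodic n f \<Longrightarrow> n dvd x - y \<Longrightarrow> f x = f y"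
  unfolding periodic_def by (metis mod_eq_dvd_iff)

lemma periodicI: "(\<And>x y. n dvd x - y \<Longrightarrow> f x = f y) \<Longrightarrow> periodic n f"
  unfolding periodic_def by (metis mod_eq_dvd_iff mod_mod_trivial)

text \<open>By counting, n pairwise incongruent values form a complete residue system. Later
  substitutions in sums over residues rest on this.\<close>

lemma sum_periodic_reindex:
  fixes n :: int
  assumes n: "0 < n" and per: "periodic n h" and fin: "finite A" and card: "card A = nat n"
    and inj: "\<And>a b. a \<in> A \<Longrightarrow> b \<in> A \<Longrightarrow> n dvd \<phi> a - \<phi> b \<Longrightarrow> a = b"
  shows "(\<Sum>a\<in>A. h (\<phi> a)) = (\<Sum>y\<in>{0..<n}. h y)"
proof -
  have inj': "inj_on (\<lambda>a. \<phi> a mod n) A"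
    by (rule inj_onI) (metis inj mod_eq_dvd_iff)
  have "(\<lambda>a. \<phi> a mod n) ` A = {0..<n}"
    by (rule card_subset_eq) (use n card inj' in \<open>auto simp: card_image\<close>)
  with inj' have bij: "bij_betw (\<lambda>a. \<phi> a mod n) A {0..<n}" by (simp add: bij_betw_def)
  have "(\<Sum>a\<in>A. h (\<phi> a)) = (\<Sum>a\<in>A. h (\<phi> a mod n))"
    using per by (simp add: periodic_def)
  also have "\<dots> = (\<Sum>y\<in>{0..<n}. h y)"
    by (rule sum.reindex_bij_betw[OF bij])
  finally show ?thesis .
qed

lemma eq_if_dvd_diff_atLeastLessThan:
  fixes n :: int
  shows "a \<in> {0..<n} \<Longrightarrow> b \<in> {0..<n} \<Longrightarrow> n dvd a - b \<Longrightarrow> a = b"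
  by (metis atLeastLessThan_iff mod_eq_dvd_iff mod_pos_pos_trivial)

lemma sum_periodic_affine:
  fixes n :: int
  assumes n: "0 < n" and per: "periodic n h" and u: "coprime u n"
  shows "(\<Sum>y\<in>{0..<n}. h (u * y + c)) = (\<Sum>y\<in>{0..<n}. h y)"
proof (rule sum_periodic_reindex[OF n per])
  fix a b assume ab: "a \<in> {0..<n}" "b \<in> {0..<n}" "n dvd (u * a + c) - (u * b + c)"
  then have "n dvd u * (a - b)" by (simp add: algebra_simps)
  then have "n dvd a - b" using u by (simp add: coprime_commute coprime_dvd_mult_right_iff)
  then show "a = b" using ab eq_if_dvd_diff_atLeastLessThan by blast
qed (use n in auto)

definition conv :: "int \<Rightarrow> (int \<Rightarrow> 'a) \<Rightarrow> (int \<Rightarrow> 'a) \<Rightarrow> int \<Rightarrow> 'a :: comm_ring_1" where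
  "conv n f g x = (\<Sum>y\<in>{0..<n}. f y * g (x - y))"

definition delta :: "int \<Rightarrow> int \<Rightarrow> 'a :: comm_ring_1" where
  "delta n x = of_bool (n dvd x)"

fun convpow :: "int \<Rightarrow> (int \<Rightarrow> 'a) \<Rightarrow> nat \<Rightarrow> int \<Rightarrow> 'a :: comm_ring_1" where
  "convpow n f 0 = delta n"
| "convpow n f (Suc k) = conv n f (convpow n f k)"

lemma periodic_delta: "periodic n (delta n)"
proof (rule periodicI)
  fix x y assume "n dvd x - y"
  then have "n dvd x \<longleftrightarrow> n dvd y" by (metis diff_add_cancel dvd_add_right_iff)
  then show "delta n x = delta n y" by (simp add: delta_def)
qed

lemma periodic_conv:
  assumes g: "periodic n g" shows "periodic n (conv n f g)"
proof (rule periodicI)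
  fix a b assume "n dvd a - b"
  then have "g (a - y) = g (b - y)" for y by (intro periodicD[OF g]) simp
  then show "conv n f g a = conv n f g b" by (simp add: conv_def)
qed

lemma conv_delta_left: "0 < n \<Longrightarrow> conv n (\<lambda>z. a * delta n z) g x = a * g x"
proof -
  assume n: "0 < n"
  have "conv n (\<lambda>z. a * delta n z) g x = (\<Sum>y\<in>{0..<n}. if y = 0 then a * g x else 0)"
    unfolding conv_def by (rule sum.cong) (auto simp: delta_def zdvd_not_zless)
  then show ?thesis using n by simp
qed

lemma conv_shift_left:
  assumes n: "0 < n" and f: "periodic n f" and g: "periodic n g"
  shows "conv n (\<lambda>z. f (z - 1)) g x = conv n f g (x - 1)"
proof -
  have per: "periodic n (\<lambda>y. f (y - 1) * g (x - y))"
  proof (rule periodicI)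
    fix a b assume ab: "n dvd a - b"
    have "f (a - 1) = f (b - 1)" by (rule periodicD[OF f]) (use ab in simp)
    moreover have "g (x - a) = g (x - b)"
      by (rule periodicD[OF g]) (use ab in \<open>simp add: dvd_diff_commute\<close>)
    ultimately show "f (a - 1) * g (x - a) = f (b - 1) * g (x - b)" by simp
  qed
  have "conv n f g (x - 1) = (\<Sum>y\<in>{0..<n}. f ((1 * y + 1) - 1) * g (x - (1 * y + 1)))"
    unfolding conv_def by (intro sum.cong) (auto simp: algebra_simps)
  also have "\<dots> = conv n (\<lambda>z. f (z - 1)) g x"
    unfolding conv_def by (rule sum_periodic_affine[OF n per, of 1 1]) simp
  finally show ?thesis ..
qed

text \<open>The image of a polynomial in the group ring of the integers modulo \<open>n\<close>,
  i.e. its class modulo \<open>X ^ n - 1\<close>.\<close>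

definition wrap :: "int \<Rightarrow> 'a poly \<Rightarrow> int \<Rightarrow> 'a :: comm_ring_1" where
  "wrap n P z = (\<Sum>k\<le>degree P. coeff P k * delta n (int k - z))"

lemma wrap_bound:
  assumes "degree P \<le> N"
  shows "wrap n P z = (\<Sum>k\<le>N. coeff P k * delta n (int k - z))"
  unfolding wrap_def using assms
  by (intro sum.mono_neutral_left) (auto simp: coeff_eq_0)

lemma wrap_add: "wrap n (P + Q) z = wrap n P z + wrap n Q z"
proof -
  let ?N = "max (degree P) (degree Q)"
  have "degree (P + Q) \<le> ?N" by (simp add: degree_add_le_max)
  then show ?thesis
    by (simp add: wrap_bound[of _ ?N] algebra_simps sum.distrib)
qed

lemma wrap_smult: "wrap n (smult a P) z = a * wrap n P z"
  by (simp add: wrap_bound[of _ "degree P"] degree_smult_le sum_distrib_left mult.assoc)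

lemma wrap_pCons: "wrap n (pCons a P) z = a * delta n z + wrap n P (z - 1)"
proof -
  have "degree (pCons a P) \<le> Suc (degree P)" by (simp add: degree_pCons_le)
  then have "wrap n (pCons a P) z = (\<Sum>k\<le>Suc (degree P). coeff (pCons a P) k * delta n (int k - z))"
    by (rule wrap_bound)
  also have "\<dots> = a * delta n (- z) + (\<Sum>k\<le>degree P. coeff P k * delta n (int k - (z - 1)))"
    by (subst sum.atMost_Suc_shift) (simp add: algebra_simps)
  finally show ?thesis by (simp add: wrap_def delta_def)
qed

lemma wrap_0: "wrap n 0 z = 0"
  by (simp add: wrap_def)

lemma periodic_wrap: "periodic n (wrap n P)"
proof (rule periodicI)
  fix x y assume "n dvd x - y"
  then have "delta n (int k - x) = (delta n (int k - y) :: 'a)" for k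
    by (intro periodicD[OF periodic_delta]) (simp add: dvd_diff_commute)
  then show "wrap n P x = wrap n P y" by (simp add: wrap_def)
qed

text \<open>Horner recursion: prepending a coefficient adds a multiple of the unit
  \<open>delta n\<close> and shifts by one, and convolution respects both operations.\<close>

lemma wrap_mult: "0 < n \<Longrightarrow> wrap n (P * Q) z = conv n (wrap n P) (wrap n Q) z"
proof (induction P arbitrary: z)
  case 0
  then show ?case by (simp add: wrap_0 conv_def)
next
  case (pCons a P)
  have "wrap n (pCons a P * Q) z = a * wrap n Q z + conv n (wrap n P) (wrap n Q) (z - 1)"
    using pCons by (simp add: mult_pCons_left wrap_add wrap_smult wrap_pCons)
  also have "\<dots> = conv n (\<lambda>z. a * delta n z) (wrap n Q) z + conv n (\<lambda>z. wrap n P (z - 1)) (wrap n Q) z"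
    using pCons by (simp add: conv_delta_left conv_shift_left periodic_wrap)
  also have "\<dots> = conv n (wrap n (pCons a P)) (wrap n Q) z"
    by (simp add: conv_def wrap_pCons distrib_right sum.distrib)
  finally show ?case .
qed

lemma wrap_power: "0 < n \<Longrightarrow> wrap n (P ^ k) = convpow n (wrap n P) k"
proof (induction k)
  case 0
  then show ?case by (simp add: wrap_def fun_eq_iff delta_def)
next
  case (Suc k)
  then have "wrap n (P ^ k) = convpow n (wrap n P) k" by simp
  then show ?case using Suc.prems by (simp add: wrap_mult ext)
qed

lemma wrap_sum: "wrap n (sum F A) z = (\<Sum>a\<in>A. wrap n (F a) z)"
  by (induction A rule: infinite_finite_induct) (auto simp: wrap_0 wrap_add)

lemma wrap_monom: "wrap n (monom a k) z = a * delta n (int k - z)"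
  by (subst wrap_bound[of _ k]) (auto simp: degree_monom_le if_distrib[of "\<lambda>x. x * _"] cong: if_cong)

lemma sum_delta_periodic:
  fixes f :: "int \<Rightarrow> 'a :: comm_ring_1"
  assumes n: "0 < n" and f: "periodic n f"
  shows "(\<Sum>y\<in>{0..<n}. f y * delta n (y - z)) = f z"
proof -
  have "(\<Sum>y\<in>{0..<n}. f y * delta n (y - z)) = (\<Sum>y\<in>{0..<n}. if y = z mod n then f y else 0)"
  proof (rule sum.cong)
    fix y assume "y \<in> {0..<n}"
    then have "y = z mod n \<longleftrightarrow> n dvd y - z" by (metis atLeastLessThan_iff mod_eq_dvd_iff mod_pos_pos_trivial)
    then show "f y * delta n (y - z) = (if y = z mod n then f y else 0)" by (simp add: delta_def)
  qed simp
  also have "\<dots> = f z" using n f by (simp add: periodic_def)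
  finally show ?thesis .
qed

section \<open>Frobenius congruences\<close>

lemma prime_dvd_binomial_power:
  fixes a b :: "'a :: comm_ring_1"
  assumes p: "prime p"
  shows "of_nat p dvd (a + b) ^ p - (a ^ p + b ^ p)"
proof -
  have p0: "0 < p" using p by (simp add: prime_gt_0_nat)
  have "(a + b) ^ p = (\<Sum>k\<le>p. of_nat (p choose k) * a ^ k * b ^ (p - k))"
    by (rule binomial_ring)
  also have "{..p} = insert 0 (insert p {1..<p})" using p0 by auto
  also have "(\<Sum>k\<in>insert 0 (insert p {1..<p}). of_nat (p choose k) * a ^ k * b ^ (p - k))
      = b ^ p + (a ^ p + (\<Sum>k\<in>{1..<p}. of_nat (p choose k) * a ^ k * b ^ (p - k)))"
    using p0 by (subst sum.insert) (auto simp: sum.insert)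
  finally have "(a + b) ^ p - (a ^ p + b ^ p) = (\<Sum>k\<in>{1..<p}. of_nat (p choose k) * a ^ k * b ^ (p - k))"
    by (simp add: algebra_simps)
  also have "of_nat p dvd \<dots>"
  proof (rule dvd_sum)
    fix k assume "k \<in> {1..<p}"
    then have "p dvd p choose k" using p by (intro dvd_choose_prime) auto
    then have "(of_nat p :: 'a) dvd of_nat (p choose k)" by (metis dvd_def of_nat_mult)
    then show "of_nat p dvd of_nat (p choose k) * a ^ k * b ^ (p - k)" by (simp add: mult.assoc)
  qed
  finally show ?thesis .
qed

text \<open>The generality in the ring pays off: it is applied to integer polynomials in
  \<open>convpow_prime_cong\<close> and to a sum of ones in \<open>fermat_int\<close>.\<close>

lemma prime_dvd_sum_power:
  fixes F :: "'b \<Rightarrow> 'a :: comm_ring_1"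
  assumes p: "prime p"
  shows "of_nat p dvd (sum F A) ^ p - (\<Sum>a\<in>A. F a ^ p)"
proof (induction A rule: infinite_finite_induct)
  case (insert a A)
  have "(sum F (insert a A)) ^ p - (\<Sum>a\<in>insert a A. F a ^ p)
     = ((F a + sum F A) ^ p - (F a ^ p + sum F A ^ p)) + (sum F A ^ p - (\<Sum>a\<in>A. F a ^ p))"
    using insert by simp
  then show ?case using insert.IH prime_dvd_binomial_power[OF p, of "F a" "sum F A"]
    by (metis dvd_add)
qed (use p in \<open>auto simp: power_0_left\<close>)

text \<open>Frobenius in the group ring: this is the source of both Schur's theorem on prime powers
  and the invariance of rational idempotents under multiplication by units.\<close>

lemma convpow_prime_cong:
  fixes f :: "int \<Rightarrow> int"
  assumes n: "0 < n" and f: "periodic n f" and p: "prime p"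
  shows "int p dvd convpow n f p z - (\<Sum>y\<in>{0..<n}. f y ^ p * delta n (int p * y - z))"
proof -
  \<comment> \<open>Lifting f to a polynomial makes the congruence a divisibility among integer
    polynomials, which \<open>wrap\<close> carries over to convolution powers.\<close>
  define P where "P = (\<Sum>y\<in>{0..<n}. monom (f y) (nat y))"
  have wP: "wrap n P = f"
    by (rule ext) (use n f in \<open>simp add: P_def wrap_sum wrap_monom sum_delta_periodic\<close>)
  have "of_nat p dvd P ^ p - (\<Sum>y\<in>{0..<n}. monom (f y) (nat y) ^ p)"
    unfolding P_def by (rule prime_dvd_sum_power[OF p])
  then obtain R where R: "P ^ p - (\<Sum>y\<in>{0..<n}. monom (f y) (nat y) ^ p) = of_nat p * R" by blast
  then have "P ^ p = (\<Sum>y\<in>{0..<n}. monom (f y ^ p) (nat y * p)) + smult (int p) R"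
    by (simp add: monom_power algebra_simps of_nat_poly)
  then have "wrap n (P ^ p) z = (\<Sum>y\<in>{0..<n}. f y ^ p * delta n (int (nat y * p) - z)) + int p * wrap n R z"
    by (simp add: wrap_add wrap_sum wrap_monom wrap_smult)
  also have "(\<Sum>y\<in>{0..<n}. f y ^ p * delta n (int (nat y * p) - z)) = (\<Sum>y\<in>{0..<n}. f y ^ p * delta n (int p * y - z))"
    by (rule sum.cong) (auto simp: mult.commute)
  finally show ?thesis using n by (simp add: wrap_power wP)
qed

section \<open>Gcd classes, units and subgroups modulo n\<close>

lemma gcd_eq_if_dvd_diff: "n dvd x - y \<Longrightarrow> gcd x n = gcd y n" for n x y :: int
  by (metis gcd.commute gcd_red_int mod_eq_dvd_iff)

text \<open>Take for t the product of the primes of N that do not divide a. A prime of N dividing a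
  divides neither m nor t; any other prime of N divides t but not a. Either way it misses the
  sum.\<close>

lemma exists_coprime_shift:
  fixes a m N :: int
  assumes am: "coprime a m" and N: "N \<noteq> 0"
  shows "\<exists>t. coprime (a + m * t) N"
proof -
  define P where "P = {p \<in> prime_factors N. \<not> p dvd a}"
  have fin: "finite P" by (simp add: P_def)
  have "coprime (a + m * \<Prod>P) N"
  proof (rule ccontr)
    assume "\<not> coprime (a + m * \<Prod>P) N"
    then have "\<not> is_unit (gcd (a + m * \<Prod>P) N)" by (metis is_unit_gcd)
    then obtain p where "prime p" "p dvd gcd (a + m * \<Prod>P) N"
      using N prime_divisor_exists[of "gcd (a + m * \<Prod>P) N"] by auto
    then have p: "prime p" "p dvd a + m * \<Prod>P" "p dvd N" by simp_all
    show False
    proof (cases "p dvd a")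
      case True
      then have "p dvd m * \<Prod>P" using p by (simp add: dvd_add_right_iff)
      moreover have "\<not> p dvd m" using True p am by (meson coprime_common_divisor not_prime_unit)
      ultimately have "p dvd \<Prod>P" using p prime_dvd_mult_iff by blast
      then obtain q where "q \<in> P" "p dvd q" using prime_dvd_prod_iff[OF fin p(1), of "\<lambda>x. x"] by auto
      then show False using p True by (auto simp: P_def in_prime_factors_iff dest: primes_dvd_imp_eq)
    next
      case False
      then have "p \<in> P" using p N by (simp add: P_def in_prime_factors_iff)
      then have "p dvd m * \<Prod>P" using dvd_prodI[OF fin, of p "\<lambda>x. x"] by simp
      then show False using p False by (simp add: dvd_add_left_iff)
    qed
  qed
  then show ?thesis ..
qed

lemma exists_inverse_mod:
  fixes x n :: int
  assumes "coprime x n"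
  shows "\<exists>w. n dvd x * w - 1"
proof -
  obtain u v where "u * x + v * n = gcd x n" using bezout_int by blast
  then have "x * u - 1 = n * (- v)" using assms by (simp add: algebra_simps)
  then show ?thesis by (metis dvd_triv_left)
qed

text \<open>Dividing by the common gcd g leaves two units modulo n / g; their quotient is lifted by
  a multiple of n / g to a number coprime to N. The freedom in N is used to get units of a multiple
  of n, in \<open>quotient\<close> and in \<open>idempotent_gcd_cong\<close>.\<close>

lemma gcd_eq_imp_unit_multiple:
  fixes n N :: int
  assumes n: "0 < n" and N: "N \<noteq> 0" and eq: "gcd x n = gcd y n"
  shows "\<exists>u. coprime u N \<and> n dvd y - u * x"
proof -
  define g where "g = gcd x n"
  have g: "g > 0" using n by (simp add: g_def)
  obtain x' n' where x': "x = x' * g" "n = n' * g" "coprime x' n'"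
    unfolding g_def using gcd_coprime_exists[OF less_imp_neq[OF g[unfolded g_def], symmetric]] by blast
  obtain y' n'' where y': "y = y' * g" "n = n'' * g" "coprime y' n''"
    unfolding g_def eq using gcd_coprime_exists[OF less_imp_neq[OF g[unfolded g_def eq], symmetric]] by blast
  have n'': "n'' = n'" using x' y' g by simp
  obtain w where w: "n' dvd x' * w - 1" using exists_inverse_mod x'(3) by blast
  have "coprime w n'"
  proof (rule coprimeI)
    fix c assume "c dvd w" "c dvd n'"
    then have "c dvd x' * w" "c dvd x' * w - 1" using w dvd_trans by auto
    then show "c dvd 1" using dvd_diff[of c "x' * w" "x' * w - 1"] by simp
  qed
  then have "coprime (y' * w) n'" using y' n'' by simp
  then obtain t where t: "coprime (y' * w + n' * t) N" using exists_coprime_shift N by blast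
  have "y' - (y' * w + n' * t) * x' = - y' * (x' * w - 1) - n' * (t * x')" by (simp add: algebra_simps)
  then have "n' dvd y' - (y' * w + n' * t) * x'" using w by (metis dvd_diff dvd_mult dvd_triv_left)
  then have "n' * g dvd (y' - (y' * w + n' * t) * x') * g" by (rule mult_dvd_mono) simp
  then have "n dvd y - (y' * w + n' * t) * x" using x' y' n'' by (simp add: algebra_simps)
  then show ?thesis using t by blast
qed

lemma int_subgroup_eq_multiples:
  fixes n :: int
  assumes n: "0 < n" "n \<in> H" and minus: "\<And>a b. a \<in> H \<Longrightarrow> b \<in> H \<Longrightarrow> a - b \<in> H"
  shows "\<exists>l>0. H = {a. l dvd a}"
proof -
  define k where "k = (LEAST k. 0 < k \<and> int k \<in> H)"
  have ex: "0 < nat n \<and> int (nat n) \<in> H" using n by simp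
  have k: "0 < k" "int k \<in> H" using LeastI[of "\<lambda>k. 0 < k \<and> int k \<in> H", OF ex] by (auto simp: k_def)
  have least: "k \<le> j" if "0 < j" "int j \<in> H" for j using that by (auto simp: k_def intro: Least_le)
  have zero: "0 \<in> H" using minus[OF n(2) n(2)] by simp
  have neg: "- a \<in> H" if "a \<in> H" for a using minus[OF zero that] by simp
  have plus: "a + b \<in> H" if "a \<in> H" "b \<in> H" for a b using minus[OF that(1) neg[OF that(2)]] by simp
  have mult: "int k * int j \<in> H" for j
    by (induction j) (auto simp: zero algebra_simps intro: plus k)
  have multi: "int k * j \<in> H" for j
    using mult[of "nat j"] neg[OF mult[of "nat (- j)"]] by (cases "j \<ge> 0") auto
  have "H = {a. int k dvd a}"
  proof (intro equalityI subsetI)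
    fix a assume a: "a \<in> H"
    have "a - int k * (a div int k) \<in> H" using a multi minus by blast
    then have "a mod int k \<in> H" by (simp add: minus_mult_div_eq_mod)
    moreover have "a mod int k < int k" "0 \<le> a mod int k" using k by simp_all
    ultimately have "a mod int k = 0" using least[of "nat (a mod int k)"] by (cases "a mod int k = 0") auto
    then show "a \<in> {a. int k dvd a}" by auto
  next
    fix a assume "a \<in> {a. int k dvd a}"
    then obtain j where "a = int k * j" by blast
    then show "a \<in> H" using multi by simp
  qed
  then show ?thesis using k(1) by (metis of_nat_0_less_iff)
qed

lemma sum_periodic_multiple:
  fixes h :: "int \<Rightarrow> 'a :: comm_ring_1"
  assumes m: "0 < m" and h: "periodic m h"
  shows "(\<Sum>y\<in>{0..<m * int c}. h y) = of_nat c * (\<Sum>y\<in>{0..<m}. h y)"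
proof (induction c)
  case (Suc c)
  have "{0..<t + m} = {0..<t} \<union> {t..<t + m}" if "0 \<le> t" for t using that m by auto
  from this[of "m * int c"] have "{0..<m * int (Suc c)} = {0..<m * int c} \<union> {m * int c..<m * int c + m}"
    using m by (simp add: algebra_simps)
  then have "(\<Sum>y\<in>{0..<m * int (Suc c)}. h y) = (\<Sum>y\<in>{0..<m * int c}. h y) + (\<Sum>y\<in>{m * int c..<m * int c + m}. h y)"
    by (simp add: sum.union_disjoint)
  also have "(\<Sum>y\<in>{m * int c..<m * int c + m}. h y) = (\<Sum>y\<in>{0..<m}. h y)"
  proof (rule sum_periodic_reindex[OF m h])
    fix a b assume ab: "a \<in> {m * int c..<m * int c + m}" "b \<in> {m * int c..<m * int c + m}" "m dvd a - b"
    then have "a - m * int c = b - m * int c"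
      by (intro eq_if_dvd_diff_atLeastLessThan[of _ m]) auto
    then show "a = b" by simp
  qed auto
  finally show ?case using Suc.IH by (simp add: algebra_simps)
qed simp

lemma gcd_mult_coprime:
  fixes x a b :: int
  assumes "coprime a b"
  shows "gcd x (a * b) = gcd x a * gcd x b"
proof (rule zdvd_antisym_nonneg)
  obtain u v where uv: "gcd x (a * b) = u * v" "u dvd a" "v dvd b"
    using division_decomp[of "gcd x (a * b)" a b] by auto
  then have "u dvd x" "v dvd x" by (metis dvd_mult_left dvd_mult_right gcd_dvd1)+
  then show "gcd x (a * b) dvd gcd x a * gcd x b" using uv by (simp add: mult_dvd_mono)
  have "coprime (gcd x a) (gcd x b)"
    using assms by (meson coprime_divisors gcd_dvd2)
  then show "gcd x a * gcd x b dvd gcd x (a * b)" by (intro divides_mult) (auto simp: dvd_mult dvd_mult2)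
qed auto

section \<open>Prime power parts\<close>

lemma gcd_power_prime_exact:
  fixes q :: int
  assumes q: "prime q" and x: "q ^ e dvd x" "\<not> q ^ Suc e dvd x"
  shows "gcd x (q ^ Suc e) = q ^ e"
proof -
  obtain i where i: "i \<le> Suc e" "gcd x (q ^ Suc e) = q ^ i"
    using divides_primepow[OF q, of "gcd x (q ^ Suc e)" "Suc e"] q
    by (auto simp: prime_ge_0_int)
  have "i \<noteq> Suc e" using i x by (metis gcd_dvd1)
  then have "i \<le> e" using i by simp
  moreover have "q ^ e dvd q ^ i" using x i by (metis gcd_greatest le_imp_power_dvd le_SucI order_refl)
  then have "e \<le> i" using prime_gt_1_int[OF q] by (simp add: dvd_power_iff)
  ultimately show ?thesis using i by simp
qed

lemma gcd_power_prime_not_dvd: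
  fixes q :: int
  assumes q: "prime q" and x: "\<not> q ^ e dvd x"
  shows "gcd x (q ^ Suc e) = gcd x (q ^ e)"
proof -
  obtain i where i: "i \<le> Suc e" "gcd x (q ^ Suc e) = q ^ i"
    using divides_primepow[OF q, of "gcd x (q ^ Suc e)" "Suc e"] q
    by (auto simp: prime_ge_0_int)
  have "q ^ i dvd x" using i by (metis gcd_dvd1)
  then have "i \<le> e" using x by (meson dvd_trans le_imp_power_dvd nat_le_linear)
  then have "gcd x (q ^ Suc e) dvd gcd x (q ^ e)"
    using i \<open>q ^ i dvd x\<close> by (simp add: le_imp_power_dvd)
  moreover have "gcd x (q ^ e) dvd gcd x (q ^ Suc e)" by (simp add: dvd_mult)
  ultimately show ?thesis by (intro zdvd_antisym_nonneg) auto
qed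

text \<open>\<open>q ^ Suc e\<close> is the full power of q in n, and T is a union of gcd classes.
  The locale studies how T meets the cosets of the subgroup of order q modulo n, which
  \<open>M\<close> = n / q generates.\<close>

locale prime_part =
  fixes n q n' :: int and e :: nat and T :: "int set"
  assumes q: "prime q" and n: "n = q ^ Suc e * n'" and n'_pos: "0 < n'" and q_n': "coprime q n'"
    and T: "\<And>x y. gcd x n = gcd y n \<Longrightarrow> x \<in> T \<longleftrightarrow> y \<in> T"
begin

definition M :: int where "M = q ^ e * n'"

lemma q_pos: "0 < q" using q by (simp add: prime_gt_0_int)

lemma n_eq: "n = q * M" by (simp add: n M_def)

lemma n_pos: "0 < n" using q_pos n'_pos by (simp add: n)

lemma gcd_n: "gcd x n = gcd x (q ^ Suc e) * gcd x n'"
  unfolding n by (rule gcd_mult_coprime) (simp add: q_n' del: power_Suc)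

lemma mem_cong: "n dvd x - y \<Longrightarrow> x \<in> T \<longleftrightarrow> y \<in> T"
  by (rule T) (rule gcd_eq_if_dvd_diff)

lemma gcd_n'_shift: "gcd (x + j * M) n' = gcd x n'"
  by (metis M_def gcd.commute gcd_add_mult mult.assoc mult.commute add.commute)

lemma gcd_qe_shift: "gcd (x + j * M) (q ^ e) = gcd x (q ^ e)"
  by (metis M_def gcd.commute gcd_add_mult mult.assoc mult.commute add.commute)

text \<open>M is divisible by \<open>q ^ e\<close> and by \<open>n'\<close>, so shifting by it can
  change the gcd with n only at multiples of \<open>q ^ e\<close>.\<close>

lemma mem_shift_not_dvd:
  assumes "\<not> q ^ e dvd y"
  shows "y + j * M \<in> T \<longleftrightarrow> y \<in> T"
proof (rule T)
  have "\<not> q ^ e dvd y + j * M" using assms by (simp add: M_def dvd_add_left_iff)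
  then show "gcd (y + j * M) n = gcd y n"
    by (simp only: gcd_n gcd_power_prime_not_dvd[OF q assms] gcd_power_prime_not_dvd[OF q \<open>\<not> q ^ e dvd y + j * M\<close>]
        gcd_n'_shift gcd_qe_shift)
qed

lemma gcd_shift_dvd:
  assumes z: "q ^ Suc e dvd z" and j: "\<not> q dvd j"
  shows "gcd (z + j * M) n = q ^ e * gcd z n'"
proof -
  have "q ^ e dvd z" using z by (metis dvd_trans le_imp_power_dvd le_SucI order_refl)
  then have 1: "q ^ e dvd z + j * M" by (simp add: M_def)
  have "\<not> q ^ Suc e dvd j * M"
  proof
    assume "q ^ Suc e dvd j * M"
    then have "q ^ e * q dvd q ^ e * (j * n')" by (simp add: M_def mult_ac)
    then have "q dvd j * n'" using q_pos by simp
    then have "q dvd n'" using j q prime_dvd_mult_iff by blast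
    then show False using q_n' q by (meson coprime_common_divisor dvd_refl not_prime_unit)
  qed
  then have 2: "\<not> q ^ Suc e dvd z + j * M" using z by (simp only: dvd_add_right_iff not_False_eq_True)
  show ?thesis by (simp only: gcd_n gcd_power_prime_exact[OF q 1 2] gcd_n'_shift)
qed

text \<open>A coset of M inside the multiples of \<open>q ^ e\<close> has one point modulo n that is
  divisible by \<open>q ^ Suc e\<close>; the other q - 1 share a single gcd with n. So T is
  described on the coset by two bits.\<close>

lemma mem_shift_dvd:
  assumes z: "q ^ Suc e dvd z"
  shows "z + j * M \<in> T \<longleftrightarrow> (if q dvd j then z \<in> T else z + M \<in> T)"
proof (cases "q dvd j")
  case True
  then have "n dvd (z + j * M) - z" by (simp add: n_eq)
  then show ?thesis using True mem_cong by simp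
next
  case False
  have "\<not> q dvd 1" using q not_prime_unit by blast
  then have "gcd (z + j * M) n = gcd (z + 1 * M) n"
    using gcd_shift_dvd[OF z False] gcd_shift_dvd[OF z, of 1] by simp
  from T[OF this] show ?thesis using False by simp
qed

lemma ex_shift_dvd:
  assumes y: "q ^ e dvd y"
  shows "\<exists>j. q ^ Suc e dvd y + j * M"
proof -
  obtain t where t: "y = q ^ e * t" using y by blast
  obtain w where w: "q dvd n' * w - 1" using exists_inverse_mod q_n' by (metis coprime_commute)
  have "t + (- t * w) * n' = - t * (n' * w - 1)" by (simp add: algebra_simps)
  then have "q dvd t + (- t * w) * n'" using w by simp
  then have "q ^ e * q dvd q ^ e * (t + (- t * w) * n')" by (intro mult_dvd_mono) auto
  also have "q ^ e * (t + (- t * w) * n') = y + (- t * w) * M" by (simp add: t M_def algebra_simps)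
  finally show ?thesis by (metis power_Suc2)
qed

text \<open>The support modulo \<open>q\<close> of the \<open>q\<close>-th convolution power of the indicator function of \<open>T\<close>,
  see \<open>dvd_count_iff\<close>.\<close>

definition jump :: "int set" where
  "jump = {z. q ^ Suc e dvd z \<and> (z \<in> T) \<noteq> (z + M \<in> T)}"

text \<open>A change between y and \<open>y + M\<close> means that one of the two is the special
  point of their coset divisible by \<open>q ^ Suc e\<close>, so the two bits of the coset differ;
  that special point lies in \<open>jump\<close>.\<close>

lemma jump_nonempty:
  assumes "(y \<in> T) \<noteq> (y + M \<in> T)"
  shows "jump \<noteq> {}"
proof -
  have "q ^ e dvd y" using mem_shift_not_dvd[of y 1] assms by auto
  then obtain j where z: "q ^ Suc e dvd y + j * M" using ex_shift_dvd by blast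
  have "y \<in> T \<longleftrightarrow> (y + j * M) + (- j) * M \<in> T" "y + M \<in> T \<longleftrightarrow> (y + j * M) + (1 - j) * M \<in> T"
    by (simp_all add: algebra_simps)
  then have "(y + j * M \<in> T) \<noteq> (y + j * M + M \<in> T)"
    unfolding mem_shift_dvd[OF z] using assms by (auto split: if_splits)
  then show ?thesis using z by (auto simp: jump_def)
qed

text \<open>Multiplication by q does not change the gcd with \<open>n'\<close>, and multiples of
  \<open>q ^ Suc e\<close> already have the full q-part. This lets the bits at y1 be read off at
  \<open>z = q * y1\<close> in \<open>dvd_count_iff\<close>.\<close>

lemma mem_mult_q:
  assumes "q ^ Suc e dvd y"
  shows "q * y \<in> T \<longleftrightarrow> y \<in> T" "q * y + M \<in> T \<longleftrightarrow> y + M \<in> T"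
proof -
  have d: "q ^ Suc e dvd q * y" using assms by (rule dvd_mult)
  have g: "gcd (q * y) n' = gcd y n'" using q_n' by (simp add: coprime_commute gcd_mult_left_left_cancel)
  have "\<not> q dvd 1" using q not_prime_unit by blast
  then have "gcd (q * y + 1 * M) n = gcd (y + 1 * M) n"
    by (simp only: gcd_shift_dvd[OF d] gcd_shift_dvd[OF assms] g not_False_eq_True)
  from T[OF this] show "q * y + M \<in> T \<longleftrightarrow> y + M \<in> T" by simp
  have "gcd (q * y) n = gcd y n"
    using assms d q_pos by (simp only: gcd_n g gcd_proj2_if_dvd_int)
  then show "q * y \<in> T \<longleftrightarrow> y \<in> T" by (rule T)
qed

text \<open>Modulo n, the solutions of \<open>q * y = q * y0\<close> are the q points
  \<open>y0 + j * M\<close>.\<close>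

lemma count_eq:
  "(\<Sum>y\<in>{0..<n}. of_bool (y \<in> T) * delta n (q * y - q * y0)) = (\<Sum>j\<in>{0..<q}. of_bool (y0 + j * M \<in> T) :: int)"
proof -
  have M: "0 < M" using q_pos n'_pos by (simp add: M_def)
  let ?h = "\<lambda>y. of_bool (y \<in> T) * delta n (q * y - q * y0) :: int"
  have per: "periodic n ?h"
  proof (rule periodicI)
    fix x y assume xy: "n dvd x - y"
    have "delta n (q * x - q * y0) = (delta n (q * y - q * y0) :: int)"
      by (rule periodicD[OF periodic_delta]) (use xy in \<open>simp add: right_diff_distrib[symmetric]\<close>)
    then show "?h x = ?h y" using mem_cong[OF xy] by simp
  qed
  have "(\<Sum>y\<in>{0..<n}. ?h y) = (\<Sum>y\<in>{0..<n}. ?h (1 * y + y0))"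
    by (rule sum_periodic_affine[OF n_pos per, symmetric]) simp
  also have "\<dots> = (\<Sum>y\<in>{0..<n}. of_bool (y0 + y \<in> T) * of_bool (M dvd y))"
    using q_pos by (intro sum.cong) (auto simp: delta_def n_eq algebra_simps)
  also have "\<dots> = (\<Sum>y\<in>(\<lambda>j. j * M) ` {0..<q}. of_bool (y0 + y \<in> T) * of_bool (M dvd y))"
  proof (rule sum.mono_neutral_right)
    show "(\<lambda>j. j * M) ` {0..<q} \<subseteq> {0..<n}" using M by (auto simp: n_eq)
    show "\<forall>i\<in>{0..<n} - (\<lambda>j. j * M) ` {0..<q}. of_bool (y0 + i \<in> T) * of_bool (M dvd i) = (0 :: int)"
    proof
      fix i assume i: "i \<in> {0..<n} - (\<lambda>j. j * M) ` {0..<q}"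
      have "\<not> M dvd i"
      proof
        assume "M dvd i"
        then obtain j where j: "i = j * M" by (metis dvdE mult.commute)
        then have "j \<in> {0..<q}" using i M by (auto simp: n_eq zero_le_mult_iff)
        then show False using i j by blast
      qed
      then show "of_bool (y0 + i \<in> T) * of_bool (M dvd i) = (0 :: int)" by simp
    qed
  qed simp
  also have "\<dots> = (\<Sum>j\<in>{0..<q}. of_bool (y0 + j * M \<in> T))"
    using M by (subst sum.reindex) (auto simp: inj_on_def)
  finally show ?thesis .
qed

text \<open>The sum counts the points of T in the fibre of multiplication by q over z, which is
  empty or a coset of M. Where T is constant on the coset the count is 0 or q. Otherwise it is a +
  (q - 1) b, congruent to a - b modulo q, where a and b are the two bits of the coset.\<close>

lemma dvd_count_iff:
  "q dvd (\<Sum>y\<in>{0..<n}. of_bool (y \<in> T) * delta n (q * y - z)) \<longleftrightarrow> z \<notin> jump"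
proof (cases "q dvd z")
  case False
  have "\<not> n dvd q * y - z" for y
  proof
    assume "n dvd q * y - z"
    then have "q dvd q * y - z" using n_eq by (metis dvd_mult_left)
    then have "q dvd q * y - (q * y - z)" by (rule dvd_diff[OF dvd_triv_left])
    then show False using False by simp
  qed
  then have "(\<Sum>y\<in>{0..<n}. of_bool (y \<in> T) * delta n (q * y - z)) = (0 :: int)"
    by (simp add: delta_def)
  moreover have "z \<notin> jump" using False by (auto simp: jump_def dest: dvd_mult_left)
  ultimately show ?thesis by simp
next
  case True
  then obtain y0 where y0: "z = q * y0" by blast
  show ?thesis
  proof (cases "q ^ e dvd y0")
    case False
    have "\<not> q ^ Suc e dvd z" using False q_pos by (simp add: y0)
    then show ?thesis unfolding y0 count_eq mem_shift_not_dvd[OF False] using q_pos by (simp add: jump_def)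
  next
    case True
    then obtain j where j: "q ^ Suc e dvd y0 + j * M" using ex_shift_dvd by blast
    define y1 where "y1 = y0 + j * M"
    have y1: "q ^ Suc e dvd y1" using j by (simp add: y1_def)
    have z: "n dvd (q * y1) - z" "n dvd (q * y1 + M) - (z + M)" by (simp_all add: y1_def y0 n_eq algebra_simps)
    have "delta n (q * y - z) = (delta n (q * y - q * y1) :: int)" for y
      by (rule periodicD[OF periodic_delta]) (use z in simp)
    then have "(\<Sum>y\<in>{0..<n}. of_bool (y \<in> T) * delta n (q * y - z)) = (\<Sum>j\<in>{0..<q}. of_bool (y1 + j * M \<in> T) :: int)"
      by (simp add: count_eq)
    also have "{0..<q} = insert 0 {1..<q}" using q_pos by auto
    also have "(\<Sum>j\<in>insert 0 {1..<q}. of_bool (y1 + j * M \<in> T) :: int)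
        = of_bool (y1 \<in> T) + (\<Sum>j\<in>{1..<q}. of_bool (y1 + j * M \<in> T))" by simp
    also have "(\<Sum>j\<in>{1..<q}. of_bool (y1 + j * M \<in> T)) = (\<Sum>j\<in>{1..<q}. of_bool (y1 + M \<in> T) :: int)"
      by (intro sum.cong) (auto simp: mem_shift_dvd[OF y1] dest: zdvd_imp_le)
    also have "\<dots> = (q - 1) * of_bool (y1 + M \<in> T)" using q_pos by simp
    finally have sum: "(\<Sum>y\<in>{0..<n}. of_bool (y \<in> T) * delta n (q * y - z))
      = (of_bool (y1 \<in> T) + (q - 1) * of_bool (y1 + M \<in> T) :: int)" .
    have q1: "1 < q" using q by (simp add: prime_gt_1_int)
    have nd: "\<not> q dvd 1" using q not_prime_unit by blast
    have "\<not> q dvd q - 1" using nd by (metis dvd_diff_right_iff dvd_refl)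
    then have "q dvd (of_bool (y1 \<in> T) + (q - 1) * of_bool (y1 + M \<in> T) :: int) \<longleftrightarrow> ((y1 \<in> T) = (y1 + M \<in> T))"
      using nd by auto
    also have "\<dots> \<longleftrightarrow> ((z \<in> T) = (z + M \<in> T))"
      using mem_cong[OF z(1)] mem_cong[OF z(2)] mem_mult_q[OF y1] by simp
    also have "\<dots> \<longleftrightarrow> z \<notin> jump" using True by (auto simp: jump_def y0)
    finally show ?thesis unfolding sum .
  qed
qed

end

section \<open>Rational S-rings\<close>

text \<open>The S-ring is given by its functions instead of its basic sets; the latter reappear as
  the classes of \<open>eqv\<close>. Rationality is \<open>gcd_cong\<close>, that is, invariance
  under all units modulo n. Scalar multiples come from \<open>const_mem\<close> and
  \<open>mult_mem\<close>.\<close>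

locale rational_sring =
  fixes n :: int and C :: "(int \<Rightarrow> rat) set"
  assumes n_pos: "0 < n"
    and gcd_cong: "\<And>f x y. f \<in> C \<Longrightarrow> gcd x n = gcd y n \<Longrightarrow> f x = f y"
    and const_mem: "\<And>c. (\<lambda>_. c) \<in> C"
    and delta_mem: "delta n \<in> C"
    and add_mem: "\<And>f g. f \<in> C \<Longrightarrow> g \<in> C \<Longrightarrow> (\<lambda>x. f x + g x) \<in> C"
    and mult_mem: "\<And>f g. f \<in> C \<Longrightarrow> g \<in> C \<Longrightarrow> (\<lambda>x. f x * g x) \<in> C"
    and conv_mem: "\<And>f g. f \<in> C \<Longrightarrow> g \<in> C \<Longrightarrow> conv n f g \<in> C"
begin

text \<open>S-sets, the equivalence whose classes are the basic sets, and generators of S-subgroups.\<close>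

definition cset :: "int set \<Rightarrow> bool" where
  "cset A \<longleftrightarrow> (\<lambda>x. of_bool (x \<in> A)) \<in> C"

definition eqv :: "int \<Rightarrow> int \<Rightarrow> bool" where
  "eqv x y \<longleftrightarrow> (\<forall>f\<in>C. f x = f y)"

definition csub :: "int \<Rightarrow> bool" where
  "csub h \<longleftrightarrow> 0 < h \<and> h dvd n \<and> cset {x. h dvd x}"

lemma periodic_mem: "f \<in> C \<Longrightarrow> periodic n f"
  by (rule periodicI) (rule gcd_cong[OF _ gcd_eq_if_dvd_diff])

lemma sum_mem: "(\<And>a. a \<in> A \<Longrightarrow> F a \<in> C) \<Longrightarrow> (\<lambda>x. \<Sum>a\<in>A. F a x) \<in> C"
  by (induction A rule: infinite_finite_induct) (auto intro: const_mem add_mem)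

lemma prod_mem: "(\<And>a. a \<in> A \<Longrightarrow> F a \<in> C) \<Longrightarrow> (\<lambda>x. \<Prod>a\<in>A. F a x) \<in> C"
  by (induction A rule: infinite_finite_induct) (auto intro: const_mem mult_mem)

text \<open>f takes finitely many values, so Lagrange interpolation writes the indicator of each
  value as a polynomial in f. The predicate Q is arbitrary, which later allows non-divisibility by a
  prime.\<close>

lemma cset_level:
  assumes f: "f \<in> C"
  shows "cset {x. Q (f x)}"
proof -
  have "range f \<subseteq> f ` {0..<n}"
  proof
    fix v assume "v \<in> range f"
    then obtain x where "v = f x" by blast
    then have "v = f (x mod n)" using periodic_mem[OF f] by (simp add: periodic_def)
    then show "v \<in> f ` {0..<n}" using n_pos by simp
  qed
  then have fin: "finite (range f)" by (rule finite_subset) simp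
  define L where "L v x = (\<Prod>w\<in>range f - {v}. (f x + - w) * inverse (v - w))" for v x
  have L: "L v \<in> C" for v
    unfolding L_def[abs_def] by (intro prod_mem mult_mem add_mem f const_mem)
  have Lv: "L v x = of_bool (f x = v)" for v x
  proof (cases "f x = v")
    case True
    then show ?thesis unfolding L_def by (auto intro!: prod.neutral simp: right_inverse)
  next
    case False
    then show ?thesis using fin unfolding L_def by (auto intro!: prod_zero bexI[of _ "f x"])
  qed
  have "(\<lambda>x. \<Sum>v\<in>{v \<in> range f. Q v}. L v x) \<in> C" by (rule sum_mem) (rule L)
  also have "(\<lambda>x. \<Sum>v\<in>{v \<in> range f. Q v}. L v x) = (\<lambda>x. of_bool (x \<in> {x. Q (f x)}))"
  proof
    fix x
    have "(\<Sum>v\<in>{v \<in> range f. Q v}. L v x) = (\<Sum>v\<in>{v \<in> range f. Q v}. if v = f x then 1 else 0)"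
      by (rule sum.cong) (auto simp: Lv)
    also have "\<dots> = of_bool (x \<in> {x. Q (f x)})" using fin by (subst sum.delta) auto
    finally show "(\<Sum>v\<in>{v \<in> range f. Q v}. L v x) = of_bool (x \<in> {x. Q (f x)})" .
  qed
  finally show ?thesis by (simp add: cset_def)
qed

lemma cset_Int: "cset A \<Longrightarrow> cset B \<Longrightarrow> cset (A \<inter> B)"
  unfolding cset_def using mult_mem[of "\<lambda>x. of_bool (x \<in> A)" "\<lambda>x. of_bool (x \<in> B)"]
  by (simp add: of_bool_conj)

lemma cset_Compl: "cset A \<Longrightarrow> cset (- A)"
  using cset_level[of "\<lambda>x. of_bool (x \<in> A)" "\<lambda>v. v = 0"] by (simp add: cset_def Compl_eq)

lemma cset_Un: "cset A \<Longrightarrow> cset B \<Longrightarrow> cset (A \<union> B)"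
  using cset_Compl[OF cset_Int[OF cset_Compl cset_Compl], of A B] by simp

lemma cset_eqv: "cset A \<Longrightarrow> eqv x y \<Longrightarrow> x \<in> A \<longleftrightarrow> y \<in> A"
  unfolding cset_def eqv_def by (metis (mono_tags) of_bool_eq_iff)

lemma cset_gcd_cong: "cset A \<Longrightarrow> gcd x n = gcd y n \<Longrightarrow> x \<in> A \<longleftrightarrow> y \<in> A"
  using gcd_cong cset_eqv eqv_def by blast

lemma cset_cong: "cset A \<Longrightarrow> n dvd x - y \<Longrightarrow> x \<in> A \<longleftrightarrow> y \<in> A"
  by (rule cset_gcd_cong[OF _ gcd_eq_if_dvd_diff])

lemma eqv_refl: "eqv x x" by (simp add: eqv_def)
lemma eqv_sym: "eqv x y \<Longrightarrow> eqv y x" unfolding eqv_def by metis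
lemma eqv_trans: "eqv x y \<Longrightarrow> eqv y z \<Longrightarrow> eqv x z" unfolding eqv_def by metis
lemma eqv_gcd: "gcd x n = gcd y n \<Longrightarrow> eqv x y" using gcd_cong by (auto simp: eqv_def)
lemma eqv_cong: "n dvd x - y \<Longrightarrow> eqv x y"
  by (rule eqv_gcd[OF gcd_eq_if_dvd_diff])

text \<open>Each residue not equivalent to x is separated from x by some function; the product of
  the corresponding level indicators cuts out the class.\<close>

lemma cset_class: "cset {y. eqv x y}"
proof -
  define B where "B = {y \<in> {0..<n}. \<not> eqv x y}"
  have "\<exists>f\<in>C. f x \<noteq> f y" if "y \<in> B" for y using that by (auto simp: B_def eqv_def)
  then obtain F where F: "\<And>y. y \<in> B \<Longrightarrow> F y \<in> C \<and> F y x \<noteq> F y y" by metis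
  have "(\<lambda>z. \<Prod>y\<in>B. of_bool (F y z = F y x)) \<in> C"
  proof (rule prod_mem)
    fix y assume "y \<in> B"
    then show "(\<lambda>z. of_bool (F y z = F y x)) \<in> C"
      using cset_level[of "F y" "\<lambda>v. v = F y x"] F by (simp add: cset_def)
  qed
  also have "(\<lambda>z. \<Prod>y\<in>B. of_bool (F y z = F y x)) = (\<lambda>z. of_bool (z \<in> {y. eqv x y}) :: rat)"
  proof
    fix z
    show "(\<Prod>y\<in>B. of_bool (F y z = F y x)) = (of_bool (z \<in> {y. eqv x y}) :: rat)"
    proof (cases "eqv x z")
      case True
      then have "F y z = F y x" if "y \<in> B" for y using F[OF that] by (metis eqv_def)
      then show ?thesis using True by simp
    next
      case False
      have zz: "eqv z (z mod n)" by (rule eqv_cong) (simp add: minus_mod_eq_mult_div)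
      have "\<not> eqv x (z mod n)" using False zz eqv_trans eqv_sym by blast
      then have "z mod n \<in> B" using n_pos by (simp add: B_def)
      moreover have "F (z mod n) z \<noteq> F (z mod n) x"
        using F[OF \<open>z mod n \<in> B\<close>] zz by (metis eqv_def)
      moreover have "finite B" unfolding B_def by (rule finite_subset[of _ "{0..<n}"]) auto
      ultimately show ?thesis using False by (auto intro!: prod_zero bexI[of _ "z mod n"])
    qed
  qed
  finally show ?thesis by (simp add: cset_def)
qed

text \<open>The sumset is the support of the convolution of the two indicators: the summands are
  nonnegative, so nothing cancels.\<close>

lemma cset_plus:
  assumes A: "cset A" and B: "cset B"
  shows "cset {a + b | a b. a \<in> A \<and> b \<in> B}"
proof -
  let ?f = "conv n (\<lambda>x. of_bool (x \<in> A)) (\<lambda>x. of_bool (x \<in> B)) :: int \<Rightarrow> rat"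
  have "cset {x. ?f x \<noteq> 0}" using A B by (intro cset_level conv_mem) (simp_all add: cset_def)
  also have "{x. ?f x \<noteq> 0} = {a + b | a b. a \<in> A \<and> b \<in> B}"
  proof (intro equalityI subsetI; clarsimp)
    fix x assume "?f x \<noteq> 0"
    then obtain y where "of_bool (y \<in> A) * of_bool (x - y \<in> B) \<noteq> (0 :: rat)"
      unfolding conv_def by (meson sum.neutral)
    then show "\<exists>a b. x = a + b \<and> a \<in> A \<and> b \<in> B" by (intro exI[of _ y] exI[of _ "x - y"]) (auto split: if_splits)
  next
    fix a b assume ab: "a \<in> A" "b \<in> B" "?f (a + b) = 0"
    then have z: "of_bool (y \<in> A) * of_bool (a + b - y \<in> B) = (0 :: rat)" if "y \<in> {0..<n}" for y
      using that unfolding conv_def by (subst (asm) sum_nonneg_eq_0_iff) auto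
    have "a mod n \<in> A" using ab cset_cong[OF A, of a "a mod n"] by (simp add: minus_mod_eq_mult_div)
    moreover have "a + b - a mod n \<in> B"
      using ab cset_cong[OF B, of "a + b - a mod n" b] by (simp add: minus_mod_eq_mult_div)
    ultimately show False using z[of "a mod n"] n_pos by simp
  qed
  finally show ?thesis .
qed

lemma csub_lcm:
  assumes "csub g" "csub h" shows "csub (lcm g h)"
proof -
  have "{x. lcm g h dvd x} = {x. g dvd x} \<inter> {x. h dvd x}" by auto
  then show ?thesis using assms cset_Int by (auto simp: csub_def lcm_pos_int)
qed

lemma csub_gcd: 
  assumes "csub g" "csub h" shows "csub (gcd g h)"
proof -
  have "{a + b | a b. a \<in> {x. g dvd x} \<and> b \<in> {x. h dvd x}} = {x. gcd g h dvd x}"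
  proof (intro equalityI subsetI; clarsimp)
    fix a b assume "g dvd a" "h dvd b"
    then show "gcd g h dvd a + b" by (meson dvd_add dvd_trans gcd_dvd1 gcd_dvd2)
  next
    fix x assume "gcd g h dvd x"
    then obtain k where k: "x = gcd g h * k" by blast
    obtain u v where uv: "u * g + v * h = gcd g h" using bezout_int by blast
    have "x = g * (u * k) + h * (v * k)" unfolding k uv[symmetric] by (simp add: algebra_simps)
    then show "\<exists>a b. x = a + b \<and> g dvd a \<and> h dvd b" by (metis dvd_triv_left)
  qed
  moreover have "gcd g h dvd n" using assms by (meson csub_def dvd_trans gcd_dvd1)
  ultimately show ?thesis using assms cset_plus[of "{x. g dvd x}" "{x. h dvd x}"] by (simp add: csub_def)
qed

lemma csub_n: "csub n"
  using delta_mem n_pos by (simp add: csub_def cset_def delta_def[abs_def])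

text \<open>X is symmetric by \<open>gcd_cong\<close>, so the convolution of its indicator with
  itself counts, at a, the residues y in X with \<open>y - a \<in> X\<close>. The stabilizer is the
  level set where this count reaches the size of X.\<close>

lemma stabilizer_csub:
  assumes X: "cset X"
  shows "\<exists>l. csub l \<and> (\<forall>a. l dvd a \<longleftrightarrow> (\<forall>x\<in>X. x - a \<in> X))"
proof -
  define H where "H = {a. \<forall>x\<in>X. x - a \<in> X}"
  let ?i = "\<lambda>x. of_bool (x \<in> X) :: rat"
  have "cset {a. conv n ?i ?i a = (\<Sum>y\<in>{0..<n}. ?i y)}"
    using X by (intro cset_level conv_mem) (simp_all add: cset_def)
  also have "{a. conv n ?i ?i a = (\<Sum>y\<in>{0..<n}. ?i y)} = H"
  proof (intro equalityI subsetI)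
    fix a assume "a \<in> {a. conv n ?i ?i a = (\<Sum>y\<in>{0..<n}. ?i y)}"
    then have "(\<Sum>y\<in>{0..<n}. ?i y - ?i y * ?i (a - y)) = 0" by (simp add: conv_def sum_subtractf)
    then have z: "?i y - ?i y * ?i (a - y) = 0" if "y \<in> {0..<n}" for y
      using that by (subst (asm) sum_nonneg_eq_0_iff) auto
    show "a \<in> H" unfolding H_def
    proof (intro CollectI ballI)
      fix x assume x: "x \<in> X"
      then have "x mod n \<in> X" using cset_cong[OF X, of x "x mod n"] by (simp add: minus_mod_eq_mult_div)
      then have "a - x mod n \<in> X" using z[of "x mod n"] n_pos by (auto split: if_splits)
      moreover have "n dvd (a - x mod n) - (a - x)" by (simp add: minus_mod_eq_mult_div)
      ultimately have "a - x \<in> X" using cset_cong[OF X] by blast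
      then show "x - a \<in> X" using cset_gcd_cong[OF X, of "a - x" "x - a"] by (metis gcd_neg1_int minus_diff_eq)
    qed
  next
    fix a assume a: "a \<in> H"
    have "?i y * ?i (a - y) = ?i y" for y
    proof (cases "y \<in> X")
      case True
      then have "y - a \<in> X" using a by (simp add: H_def)
      then have "a - y \<in> X" using cset_gcd_cong[OF X, of "a - y" "y - a"] by (metis gcd_neg1_int minus_diff_eq)
      then show ?thesis by simp
    qed simp
    then show "a \<in> {a. conv n ?i ?i a = (\<Sum>y\<in>{0..<n}. ?i y)}" unfolding conv_def by (simp only: mem_Collect_eq)
  qed
  finally have H: "cset H" .
  have neg: "- a \<in> H" if "a \<in> H" for a using that cset_gcd_cong[OF H, of a "- a"] by simp
  have "a - b \<in> H" if "a \<in> H" "b \<in> H" for a b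
    using that(1) neg[OF that(2)] by (auto simp: H_def) (metis add_diff_eq diff_minus_eq_add diff_diff_eq2 add.commute diff_add_eq)
  moreover have n: "n \<in> H" unfolding H_def using cset_cong[OF X, of "x - n" x for x] by auto
  ultimately obtain l where l: "0 < l" "H = {a. l dvd a}" using int_subgroup_eq_multiples[OF n_pos] by blast
  then have "csub l" using H n by (simp add: csub_def)
  then show ?thesis using l by (auto simp: H_def)
qed

text \<open>Only m dividing n is assumed; m need not generate an S-subgroup. Among the S-sets that
  contain 0 and consist of multiples of m, one that is as large as possible absorbs translation by
  A, so A lies in its stabilizer. The generator l of the stabilizer is a multiple of m because
  \<open>0 - l\<close> stays in the set.\<close>

lemma ex_csub_containing:
  assumes A: "cset A" and m: "A \<subseteq> {x. m dvd x}" "m dvd n"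
  shows "\<exists>l. csub l \<and> m dvd l \<and> A \<subseteq> {x. l dvd x}"
proof -
  define P where "P X \<longleftrightarrow> cset X \<and> 0 \<in> X \<and> X \<subseteq> {x. m dvd x}" for X
  have "P {x. n dvd x}" using csub_n m by (auto simp: P_def csub_def)
  moreover have "card (X \<inter> {0..<n}) < Suc (nat n)" for X :: "int set"
    using card_mono[of "{0..<n}" "X \<inter> {0..<n}"] by simp
  ultimately obtain X where X: "P X" and max: "\<And>Y. P Y \<Longrightarrow> card (Y \<inter> {0..<n}) \<le> card (X \<inter> {0..<n})"
    using ex_has_greatest_nat[of P "{x. n dvd x}" "\<lambda>X. card (X \<inter> {0..<n})" "Suc (nat n)"] by (auto simp: less_imp_le)
  have cX: "cset X" using X by (simp add: P_def)
  let ?Y = "X \<union> {a + b | a b. a \<in> X \<and> b \<in> A}"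
  have PY: "P ?Y" using X A m by (auto simp: P_def intro!: cset_Un cset_plus dvd_add)
  have "X \<inter> {0..<n} = ?Y \<inter> {0..<n}"
    by (rule card_seteq) (use max[OF PY] in auto)
  then have sub: "y \<in> X" if "y \<in> ?Y" "y \<in> {0..<n}" for y using that by blast
  have add: "x + a \<in> X" if "x \<in> X" "a \<in> A" for x a
  proof -
    have Y: "x + a \<in> ?Y" using that by blast
    have d: "n dvd (x + a) - (x + a) mod n" by (simp add: minus_mod_eq_mult_div)
    have "(x + a) mod n \<in> ?Y" using cset_cong[OF _ d, of ?Y] PY Y by (simp add: P_def)
    then have "(x + a) mod n \<in> X" using n_pos by (intro sub) auto
    then show ?thesis using cset_cong[OF cX d] by blast
  qed
  obtain l where l: "csub l" "\<And>a. l dvd a \<longleftrightarrow> (\<forall>x\<in>X. x - a \<in> X)" using stabilizer_csub[OF cX] by blast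
  have "l dvd a" if "a \<in> A" for a
  proof -
    have "- a \<in> A" using that cset_gcd_cong[OF A, of a "- a"] by simp
    then show ?thesis using add[of _ "- a"] by (simp add: l)
  qed
  moreover have "m dvd l"
  proof -
    have "0 - l \<in> X" using l(2)[of l] X by (auto simp: P_def)
    then show ?thesis using X by (auto simp: P_def)
  qed
  ultimately show ?thesis using l by blast
qed

text \<open>Numbers with equal gcd with m differ modulo m by a factor that can be chosen coprime to
  n, and C is invariant under such factors. For m-periodic functions, convolution modulo n is n / m
  times convolution modulo m.\<close>

lemma quotient:
  assumes m: "csub m"
  shows "rational_sring m {f \<in> C. periodic m f}"
proof -
  have m0: "0 < m" "m dvd n" using m by (auto simp: csub_def)
  show ?thesis
  proof
    fix f x y assume f: "f \<in> {f \<in> C. periodic m f}" and eq: "gcd x m = gcd y m"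
    obtain u where u: "coprime u n" "m dvd y - u * x"
      using gcd_eq_imp_unit_multiple[OF m0(1) _ eq, of n] n_pos by auto
    have "f y = f (u * x)" using f u by (auto elim: periodicD)
    also have "\<dots> = f x" using f u by (intro gcd_cong[of f]) (auto simp: gcd_mult_left_left_cancel coprime_commute)
    finally show "f x = f y" ..
  next
    fix f g assume fg: "f \<in> {f \<in> C. periodic m f}" "g \<in> {f \<in> C. periodic m f}"
    obtain c where c: "n = m * int c" using m0 n_pos by (metis dvdE nat_0_le zero_less_mult_pos less_imp_le)
    have c0: "c \<noteq> 0" using c n_pos by (intro notI) simp
    have "conv m f g x = inverse (rat_of_nat c) * conv n f g x" for x
    proof -
      have "periodic m (\<lambda>y. f y * g (x - y))"
      proof (rule periodicI)
        fix a b assume ab: "m dvd a - b"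
        have "f a = f b" using fg ab by (auto elim: periodicD)
        moreover have "m dvd (x - a) - (x - b)" using ab by (simp add: dvd_diff_commute)
        then have "g (x - a) = g (x - b)" using fg by (auto elim: periodicD)
        ultimately show "f a * g (x - a) = f b * g (x - b)" by simp
      qed
      from sum_periodic_multiple[OF m0(1) this, of c] show ?thesis using c0 by (simp add: conv_def c)
    qed
    then have "conv m f g = (\<lambda>x. inverse (rat_of_nat c) * conv n f g x)" by auto
    moreover have "(\<lambda>x. inverse (rat_of_nat c) * conv n f g x) \<in> C" using fg by (intro mult_mem const_mem conv_mem) auto
    ultimately show "conv m f g \<in> {f \<in> C. periodic m f}" using fg periodic_conv[of m g f] by simp
  qed (use m m0 in \<open>auto simp: periodic_def csub_def cset_def delta_def[abs_def] dvd_mod_iff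
      intro: const_mem add_mem mult_mem\<close>)
qed

lemma convpow_mem: "f \<in> C \<Longrightarrow> convpow n f k \<in> C"
  by (induction k) (auto intro: delta_mem conv_mem)

end

lemma convpow_of_int: "convpow n (\<lambda>x. of_int (f x)) k x = of_int (convpow n f k x)"
  by (induction k arbitrary: x) (simp_all add: delta_def conv_def)

text \<open>The q-th convolution power of the indicator of T is integer-valued and lies in C, so the
  points where q does not divide it form an S-set. Modulo q, Frobenius turns this power into the
  fibre count of \<open>dvd_count_iff\<close>, because the bits satisfy
  \<open>i ^ q = i\<close>.\<close>

lemma (in rational_sring) cset_jump:
  assumes cT: "cset T" and P: "prime_part n q n' e T"
  shows "cset (prime_part.jump q n' e T)"
proof -
  interpret prime_part n q n' e T by (rule P)
  define p where "p = nat q"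
  have p: "prime p" "int p = q" using q q_pos by (simp_all add: p_def)
  let ?i = "\<lambda>x. of_bool (x \<in> T) :: int"
  have per: "periodic n ?i" by (rule periodicI) (simp add: cset_cong[OF cT])
  have "(\<lambda>x. of_int (?i x)) \<in> C" using cT by (simp add: cset_def)
  then have F: "convpow n (\<lambda>x. of_int (?i x)) p \<in> C" by (rule convpow_mem)
  have "cset {x. \<exists>i. convpow n (\<lambda>x. of_int (?i x)) p x = rat_of_int i \<and> \<not> q dvd i}"
    by (rule cset_level[OF F])
  also have "{x. \<exists>i. convpow n (\<lambda>x. of_int (?i x)) p x = rat_of_int i \<and> \<not> q dvd i} = {x. \<not> q dvd convpow n ?i p x}"
    unfolding convpow_of_int by auto
  also have "\<dots> = jump"
  proof (intro Collect_eqI[of _ "\<lambda>x. x \<in> jump", simplified])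
    fix z
    have "?i y ^ p = ?i y" for y using p prime_gt_0_nat[OF p(1)] by simp
    then have "q dvd convpow n ?i p z - (\<Sum>y\<in>{0..<n}. ?i y * delta n (q * y - z))"
      using convpow_prime_cong[OF n_pos per p(1), of z] p by simp
    then have "q dvd convpow n ?i p z \<longleftrightarrow> q dvd (\<Sum>y\<in>{0..<n}. ?i y * delta n (q * y - z))"
      by (metis diff_add_cancel dvd_add_right_iff)
    then show "(\<not> q dvd convpow n ?i p z) = (z \<in> jump)" using dvd_count_iff by simp
  qed
  finally show ?thesis .
qed

section \<open>Muzychuk's theorem\<close>

context rational_sring
begin

lemma csub_1: "csub 1"
  using const_mem[of 1] by (simp add: csub_def cset_def)

lemma csub_le: "csub m \<Longrightarrow> m \<le> n"
  using n_pos by (auto simp: csub_def intro: zdvd_imp_le)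

lemma ex_largest_csub:
  assumes "Q 1"
  shows "\<exists>h. csub h \<and> Q h \<and> (\<forall>g. csub g \<longrightarrow> Q g \<longrightarrow> g \<le> h)"
proof -
  have "{g. csub g \<and> Q g} \<subseteq> {0..n}" using csub_le by (auto simp: csub_def)
  then have fin: "finite {g. csub g \<and> Q g}" by (rule finite_subset) simp
  have ne: "{g. csub g \<and> Q g} \<noteq> {}" using assms csub_1 by blast
  show ?thesis using Max_in[OF fin ne] Max_ge[OF fin] by blast
qed

lemma coset_union_cset:
  assumes "csub k"
  shows "cset {a + b | a b. eqv z a \<and> k dvd b}"
  using cset_plus[OF cset_class[of z], of "{b. k dvd b}"] assms by (simp add: csub_def)

lemma coset_union_periodic:
  "periodic k (\<lambda>y. of_bool (y \<in> {a + b | a b. P a \<and> k dvd b}) :: rat)"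
proof (rule periodicI)
  have *: "y \<in> {a + b | a b. P a \<and> k dvd b}" if x: "x \<in> {a + b | a b. P a \<and> k dvd b}" "k dvd x - y" for x y :: int
  proof -
    obtain a b where ab: "x = a + b" "P a" "k dvd b" using x by blast
    have "k dvd b - (x - y)" using ab(3) x(2) by (rule dvd_diff)
    moreover have "y = a + (b - (x - y))" using ab by simp
    ultimately show ?thesis using ab(2) by blast
  qed
  fix x y :: int assume xy: "k dvd x - y"
  then have "k dvd y - x" by (simp add: dvd_diff_commute)
  then have "x \<in> {a + b | a b. P a \<and> k dvd b} \<longleftrightarrow> y \<in> {a + b | a b. P a \<and> k dvd b}"
    using xy *[of x y] *[of y x] by (intro iffI)
  then show "of_bool (x \<in> {a + b | a b. P a \<and> k dvd b}) = (of_bool (y \<in> {a + b | a b. P a \<and> k dvd b}) :: rat)"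
    by (simp only:)
qed

text \<open>Induction step of Muzychuk's theorem on rational S-rings; \<open>IH\<close> is the statement
  for all proper quotients. Let \<open>h\<close> generate the smallest S-subgroup containing \<open>x\<close>. The
  quotients do not separate \<open>x\<close> from \<open>h\<close>, so if their classes \<open>T\<close> and \<open>T'\<close> differ then
  neither is invariant under a nontrivial translation, and Schur's theorem yields nonempty
  S-sets \<open>jump\<close> for both. Comparing these modulo a minimal S-subgroup \<open>k\<int>\<close> produces a
  common element of \<open>T\<close> and \<open>T'\<close>.\<close>

lemma class_generator_step:
  assumes IH: "\<And>m. csub m \<Longrightarrow> m < n \<Longrightarrow>
      \<exists>h. 0 < h \<and> h dvd m \<and> cset {y. h dvd y} \<and> (\<forall>f\<in>C. periodic m f \<longrightarrow> f x = f h)"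
  shows "\<exists>h. csub h \<and> eqv x h"
proof (cases "n = 1")
  case True
  then have "eqv x 1" by (intro eqv_gcd) simp
  then show ?thesis using csub_1 by blast
next
  case False
  then have n1: "1 < n" using n_pos by simp
  obtain h where h: "csub h" "h dvd x" "\<And>g. csub g \<Longrightarrow> g dvd x \<Longrightarrow> g \<le> h"
    using ex_largest_csub[of "\<lambda>g. g dvd x"] by auto
  have h0: "0 < h" "h dvd n" and ch: "cset {y. h dvd y}" using h by (auto simp: csub_def)
  have h_max: "g dvd h" if "csub g" "g dvd x" for g
  proof -
    have "lcm g h \<le> h" using that h by (intro h(3) csub_lcm) auto
    moreover have "h \<le> lcm g h" using csub_lcm[OF that(1) h(1)] by (intro zdvd_imp_le) (auto simp: csub_def)
    ultimately have "lcm g h = h" by simp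
    then show ?thesis by (metis dvd_lcm1)
  qed
  \<comment> \<open>The class of x in the quotient by m has a generator \<open>h'\<close>. Comparing
    which S-subgroups contain x forces \<open>h' = gcd h m\<close>, which has the same gcd with m as
    h.\<close>
  have quot: "f x = f h" if m: "csub m" "m < n" and f: "f \<in> C" "periodic m f" for m f
  proof -
    obtain h' where h': "0 < h'" "h' dvd m" "cset {y. h' dvd y}" "\<And>f. f \<in> C \<Longrightarrow> periodic m f \<Longrightarrow> f x = f h'"
      using IH[OF m] by blast
    have ind: "g dvd x \<longleftrightarrow> g dvd h'" if "csub g" "g dvd m" for g
    proof -
      have "(\<lambda>y. of_bool (y \<in> {y. g dvd y})) \<in> C" using that by (simp add: csub_def cset_def)
      moreover have "periodic m (\<lambda>y. of_bool (y \<in> {y. g dvd y}) :: rat)"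
        using that by (simp add: periodic_def dvd_mod_iff)
      ultimately show ?thesis using h'(4) by (metis (mono_tags) mem_Collect_eq of_bool_eq_iff)
    qed
    have m0: "m dvd n" using m by (simp add: csub_def)
    have "csub h'" using h' m0 by (auto simp: csub_def intro: dvd_trans)
    then have "h' dvd h" using ind h' by (intro h_max) auto
    moreover have "gcd h m dvd h'" using ind[OF csub_gcd[OF h(1) m(1)]] h(2) by (meson dvd_trans gcd_dvd1 gcd_dvd2)
    ultimately have "h' = gcd h m" using h' by (intro zdvd_antisym_nonneg) auto
    then have "gcd h m = gcd h' m" by simp
    moreover have "f \<in> {f \<in> C. periodic m f}" using f by simp
    ultimately have "f h = f h'" using rational_sring.gcd_cong[OF quotient[OF m(1)]] by blast
    then show ?thesis using h'(4)[OF f] by simp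
  qed
  have "eqv x h"
  proof (rule ccontr)
    assume neq: "\<not> eqv x h"
    \<comment> \<open>An S-set stable under M descends to the quotient by its stabilizer, and there
      \<open>quot\<close> cannot separate x from h.\<close>
    have moved: "\<exists>y. (y \<in> X) \<noteq> (y + M \<in> X)" if X: "cset X" "(x \<in> X) \<noteq> (h \<in> X)" and M: "0 < M" "M < n" for X M
    proof (rule ccontr)
      assume "\<not> ?thesis"
      then have inv: "y + M \<in> X \<longleftrightarrow> y \<in> X" for y by blast
      obtain l where l: "csub l" "\<And>a. l dvd a \<longleftrightarrow> (\<forall>x\<in>X. x - a \<in> X)" using stabilizer_csub[OF X(1)] by blast
      have "l dvd M" using inv[of "_ - M"] by (simp add: l)
      then have "l < n" using M zdvd_imp_le by fastforce
      have "periodic l (\<lambda>y. of_bool (y \<in> X) :: rat)"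
      proof (rule periodicI)
        fix a b assume "l dvd a - b"
        then have "l dvd a - b" "l dvd b - a" by (simp_all add: dvd_diff_commute)
        then have "\<forall>x\<in>X. x - (a - b) \<in> X" "\<forall>x\<in>X. x - (b - a) \<in> X" using l(2) by blast+
        then have "a \<in> X \<longleftrightarrow> b \<in> X" by (metis diff_diff_eq2 add_diff_cancel_left')
        then show "of_bool (a \<in> X) = (of_bool (b \<in> X) :: rat)" by simp
      qed
      then have "of_bool (x \<in> X) = (of_bool (h \<in> X) :: rat)"
        using quot[OF l(1) \<open>l < n\<close>, of "\<lambda>y. of_bool (y \<in> X)"] X by (simp add: cset_def)
      then show False using X(2) by (metis of_bool_eq_iff)
    qed
    \<comment> \<open>The largest proper generator gives a minimal nonzero S-subgroup modulo
      n.\<close>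
    obtain k where k: "csub k" "k < n" and k_max: "\<And>g. csub g \<Longrightarrow> g < n \<Longrightarrow> g \<le> k"
      using ex_largest_csub[of "\<lambda>g. g < n"] n1 by blast
    have coset: "x \<in> {a + b | a b. eqv z a \<and> k dvd b} \<longleftrightarrow> h \<in> {a + b | a b. eqv z a \<and> k dvd b}" for z
    proof -
      have "(\<lambda>y. of_bool (y \<in> {a + b | a b. eqv z a \<and> k dvd b})) \<in> C"
        using coset_union_cset[OF k(1)] unfolding cset_def .
      from quot[OF k this coset_union_periodic] show ?thesis by (simp only: of_bool_eq_iff)
    qed
    have "x \<in> {a + b | a b. eqv x a \<and> k dvd b}" using eqv_refl by (intro CollectI exI[of _ x] exI[of _ 0]) simp
    \<comment> \<open>The quotient by k does not separate x from h, so the class of x has a member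
      congruent to h modulo k. Since that member is not equivalent to h, its gcd with n exceeds h by
      some prime q.\<close>
    then obtain y b where y: "h = y + b" "eqv x y" "k dvd b" using coset[of x] by blast
    have hy: "h dvd y" using cset_eqv[OF ch y(2)] h by simp
    have "gcd y n \<noteq> h"
    proof
      assume "gcd y n = h"
      then have "gcd y n = gcd h n" using h0 by (simp add: gcd_proj1_if_dvd_int)
      then show False using neq y eqv_gcd eqv_trans by blast
    qed
    moreover have "h dvd gcd y n" using hy h0 by simp
    ultimately obtain s where s: "gcd y n = h * s" "s \<noteq> 1" by (metis dvdE mult.right_neutral)
    have "0 < gcd y n" using n_pos by simp
    then have "0 < s" using s h0 by (simp add: zero_less_mult_iff)
    then have "\<not> is_unit s" using s by simp
    then obtain q where q: "prime q" "q dvd s" using prime_divisor_exists[of s] \<open>0 < s\<close> by auto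
    have "h * q dvd gcd y n" using s q by (simp add: mult_dvd_mono)
    then have hq: "h * q dvd y" "h * q dvd n" by simp_all
    have qu: "\<not> is_unit q" using q not_prime_unit by blast
    obtain n' where n': "n = q ^ multiplicity q n * n'" "\<not> q dvd n'"
      using multiplicity_decompose'[of n q] n_pos qu by auto
    have "q dvd n" using hq by (meson dvd_mult_right)
    then have "multiplicity q n \<noteq> 0" using n_pos qu by (simp add: multiplicity_eq_zero_iff)
    then obtain e where e: "multiplicity q n = Suc e" using not0_implies_Suc by blast
    have q0: "1 < q" using q by (simp add: prime_gt_1_int)
    have n_eq: "n = q ^ Suc e * n'" using n' e by simp
    have "0 < q ^ Suc e" using q0 by (intro zero_less_power) simp
    then have n'0: "0 < n'" using n_pos zero_less_mult_pos unfolding n_eq by blast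
    have cop: "coprime q n'" using n'(2) q by (simp add: prime_imp_coprime)
    have nh: "\<not> q ^ Suc e dvd h"
    proof
      assume "q ^ Suc e dvd h"
      then have "q ^ Suc e * q dvd q ^ Suc e * n'" using hq(2) unfolding n_eq by (meson dvd_trans mult_dvd_mono dvd_refl)
      then have "q dvd n'" using q0 by simp
      then show False using n' by blast
    qed
    \<comment> \<open>y and h are congruent modulo k, yet y contains a higher power of q than h
      does. So k cannot contain the full q-part of n, whence k divides \<open>M\<close>.\<close>
    have nk: "\<not> q ^ Suc e dvd k"
    proof
      assume kq: "q ^ Suc e dvd k"
      define i where "i = multiplicity q h"
      have i: "q ^ i dvd h" "\<not> q ^ Suc i dvd h"
        using h0 qu by (auto simp: i_def multiplicity_dvd power_dvd_iff_le_multiplicity simp del: power_Suc)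
      have "i \<le> e" using i nh by (meson dvd_trans le_imp_power_dvd not_less_eq_eq)
      then have "q ^ Suc i dvd b" using kq y(3) by (meson Suc_le_mono dvd_trans le_imp_power_dvd)
      moreover have "q ^ Suc i dvd y" using i(1) hq(1) by (metis dvd_refl dvd_trans mult_dvd_mono power_Suc2)
      ultimately show False using i y(1) by simp
    qed
    define M where "M = q ^ e * n'"
    have nM: "n = q * M" by (simp add: n_eq M_def)
    have M: "0 < M" "M < n" using q0 n'0 by (simp_all add: M_def nM)
    have kM: "k dvd M"
    proof -
      obtain c where c: "n = k * c" using k by (auto simp: csub_def)
      have "q dvd c"
      proof (rule ccontr)
        assume "\<not> q dvd c"
        then have "coprime (q ^ Suc e) c" using q by (simp add: prime_imp_coprime del: power_Suc)
        moreover have "q ^ Suc e dvd k * c" using c n_eq by (metis dvd_triv_left)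
        ultimately show False using nk by (simp add: coprime_dvd_mult_left_iff del: power_Suc)
      qed
      then obtain c' where "c = q * c'" by blast
      then have "q * M = q * (k * c')" using c nM by simp
      then show ?thesis using q0 by simp
    qed
    define T where "T = {y. eqv x y}"
    define T' where "T' = {y. eqv h y}"
    have cT: "cset T" "cset T'" by (simp_all add: T_def T'_def cset_class)
    have P: "prime_part n q n' e X" if "cset X" for X
      by (rule prime_part.intro) (rule q(1) n_eq n'0 cop cset_gcd_cong[OF that], assumption?)+
    interpret P: prime_part n q n' e T by (rule P[OF cT(1)])
    interpret P': prime_part n q n' e T' by (rule P[OF cT(2)])
    have PM: "P.M = M" "P'.M = M" by (simp_all add: P.M_def P'.M_def M_def)
    have "(x \<in> T) \<noteq> (h \<in> T)" "(x \<in> T') \<noteq> (h \<in> T')" using neq eqv_refl eqv_sym by (auto simp: T_def T'_def)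
    then obtain z z' where z: "z \<in> P.jump" and z': "z' \<in> P'.jump"
      using moved[OF cT(1) _ M] moved[OF cT(2) _ M] P.jump_nonempty P'.jump_nonempty unfolding PM by blast
    have cS: "cset P.jump" "cset P'.jump" using cset_jump cT P by blast+
    have "P.jump \<union> P'.jump \<subseteq> {z. q ^ Suc e dvd z}" by (auto simp: P.jump_def P'.jump_def)
    then obtain l where l: "csub l" "q ^ Suc e dvd l" "P.jump \<union> P'.jump \<subseteq> {x. l dvd x}"
      using ex_csub_containing[OF cset_Un[OF cS]] n_eq by (metis dvd_triv_left)
    have cl: "cset {y. l dvd y}" using l by (simp add: csub_def)
    have nlh: "\<not> l dvd h" using l nh dvd_trans by blast
    \<comment> \<open>l contains the full q-part of n and k does not, so \<open>lcm k l\<close> is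
      properly larger than k; maximality of k leaves only n. The two S-subgroups thus meet trivially
      modulo n.\<close>
    have lcm: "lcm k l = n"
    proof (rule ccontr)
      assume "lcm k l \<noteq> n"
      then have "lcm k l < n" using csub_le[OF csub_lcm[OF k(1) l(1)]] by simp
      then have "lcm k l \<le> k" using k_max csub_lcm[OF k(1) l(1)] by blast
      moreover have "k \<le> lcm k l" using csub_lcm[OF k(1) l(1)] by (intro zdvd_imp_le) (auto simp: csub_def)
      ultimately have "l dvd k" by (metis antisym dvd_lcm2)
      then show False using nk l dvd_trans by blast
    qed
    \<comment> \<open>A point of the jump set is a multiple of l. If it lay in T then l would divide
      x and hence h, so T must contain the other end of the jump.\<close>
    have inT: "w + M \<in> T" if "w \<in> P.jump" for w
    proof -
      have "w \<notin> T"
      proof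
        assume "w \<in> T"
        then have "l dvd x" using cset_eqv[OF cl, of x w] that l(3) by (auto simp: T_def)
        then show False using h_max[OF l(1)] nlh by blast
      qed
      then show ?thesis using that by (simp add: P.jump_def PM)
    qed
    have "z' \<notin> T'" using cset_eqv[OF cl, of h z'] z' l(3) nlh by (auto simp: T'_def)
    then have "z' + M \<in> T'" using z' by (simp add: P'.jump_def PM)
    then have z'T': "eqv h (z' + M)" by (simp add: T'_def)
    \<comment> \<open>Shifting by M stays inside cosets of k, so this S-set contains
      \<open>z + M\<close>, which is equivalent to x. As \<open>coset\<close> does not separate x
      from h, it also contains \<open>z' + M\<close>, which ties \<open>z'\<close> modulo k to a
      member of the first jump set.\<close>
    let ?X = "{a + b | a b. eqv z a \<and> k dvd b}"
    have cX: "cset ?X" by (rule coset_union_cset[OF k(1)])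
    have "z + M \<in> ?X" using eqv_refl kM by blast
    then have "x \<in> ?X" using cset_eqv[OF cX, of x "z + M"] inT[OF z] by (simp add: T_def)
    then have "z' + M \<in> ?X" using coset[of z] cset_eqv[OF cX z'T'] by blast
    then obtain a c where a: "z' + M = a + c" "eqv z a" "k dvd c" by blast
    have aS: "a \<in> P.jump" using cset_eqv[OF cS(1) a(2)] z by simp
    have "z' - a = c - M" using a(1) by simp
    then have "k dvd z' - a" using a(3) kM by simp
    moreover have "l dvd z' - a" using l(3) aS z' by (intro dvd_diff) auto
    ultimately have "n dvd z' - a" unfolding lcm[symmetric] by simp
    then have "z' \<in> P.jump" using cset_cong[OF cS(1)] aS by blast
    then have "eqv x (z' + M)" using inT by (simp add: T_def)
    then show False using z'T' neq eqv_sym eqv_trans by blast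
  qed
  then show ?thesis using h by blast
qed

end

text \<open>Form of Muzychuk's theorem used later: a function in C is determined by its values at
  the generators of S-subgroups, as exploited in \<open>CG_combination\<close>.\<close>

theorem rational_sring_class_generator:
  assumes "rational_sring n C"
  shows "\<exists>h. rational_sring.csub n C h \<and> rational_sring.eqv C x h"
  using assms
proof (induction "nat n" arbitrary: n C rule: less_induct)
  case less
  interpret rational_sring n C by (rule less.prems)
  show ?case
  proof (rule class_generator_step)
    fix m assume m: "csub m" "m < n"
    interpret Q: rational_sring m "{f \<in> C. periodic m f}" by (rule quotient[OF m(1)])
    have "nat m < nat n" using m Q.n_pos by simp
    then obtain h where "Q.csub h" "Q.eqv x h" using less.hyps Q.rational_sring_axioms by blast
    then show "\<exists>h. 0 < h \<and> h dvd m \<and> cset {y. h dvd y} \<and> (\<forall>f\<in>C. periodic m f \<longrightarrow> f x = f h)"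
      by (auto simp: Q.csub_def Q.cset_def cset_def Q.eqv_def)
  qed
qed

section \<open>Rational idempotents\<close>

lemma fermat_int:
  assumes p: "prime p"
  shows "int p dvd a ^ p - a"
proof -
  have nat: "int p dvd int k ^ p - int k" for k
    using prime_dvd_sum_power[OF p, of "\<lambda>_. 1 :: int" "{..<k}"] by simp
  have p0: "0 < int p" using p by (simp add: prime_gt_0_nat)
  have "int p dvd (a mod int p) ^ p - a mod int p" using nat[of "nat (a mod int p)"] p0 by simp
  then have "(a mod int p) ^ p mod int p = a mod int p" by (simp flip: mod_eq_dvd_iff)
  then show ?thesis by (simp add: power_mod flip: mod_eq_dvd_iff)
qed

lemma ex_common_denominator:
  fixes f :: "'a \<Rightarrow> rat"
  assumes "finite A"
  shows "\<exists>N::int. 0 < N \<and> (\<forall>a\<in>A. of_int N * f a \<in> \<int>)"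
  using assms
proof (induction A)
  case empty
  show ?case by (rule exI[of _ 1]) simp
next
  case (insert a A)
  then obtain N where N: "0 < N" "\<forall>a\<in>A. of_int N * f a \<in> \<int>" by blast
  obtain c d where cd: "quotient_of (f a) = (c, d)" by force
  then have d: "0 < d" "f a = of_int c / of_int d" using quotient_of_denom_pos quotient_of_div by auto
  have "of_int (N * d) * f a = of_int (N * c)" using d by simp
  then have "of_int (N * d) * f a \<in> \<int>" by (metis Ints_of_int)
  moreover have "of_int (N * d) * f b \<in> \<int>" if "b \<in> A" for b
  proof -
    have "of_int (N * d) * f b = of_int d * (of_int N * f b)" by simp
    then show ?thesis using N that by (metis Ints_mult Ints_of_int)
  qed
  ultimately show ?case using N d by (intro exI[of _ "N * d"]) auto
qed

lemma convpow_scale: "convpow n (\<lambda>x. c * f x) k x = c ^ k * convpow n f k x"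
proof (induction k arbitrary: x)
  case (Suc k)
  show ?case by (simp add: Suc conv_def sum_distrib_left mult_ac)
qed simp

lemma convpow_idempotent:
  assumes n: "0 < n" and e: "periodic n e" and idem: "conv n e e = e"
  shows "convpow n e (Suc k) = e"
proof (induction k)
  case 0
  have "conv n e (delta n) x = e x" for x
  proof -
    have "delta n (x - y) = (delta n (y - x) :: 'a)" for y by (simp add: delta_def dvd_diff_commute)
    then show ?thesis using sum_delta_periodic[OF n e] by (simp add: conv_def)
  qed
  then show ?case by auto
next
  case (Suc k)
  then show ?case by (metis convpow.simps(2) idem)
qed

text \<open>b stands for N times an idempotent, hence the formula for its powers. As p is a unit
  modulo n, Frobenius at \<open>p * x\<close> gives \<open>N ^ (p - 1) * b (p * x)\<close> congruent
  to \<open>b x ^ p\<close> modulo p, and Fermat removes both exponents.\<close>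

lemma idempotent_prime_invariant:
  fixes b :: "int \<Rightarrow> int"
  assumes n: "0 < n" and b: "periodic n b" and pw: "\<And>k x. convpow n b (Suc k) x = N ^ k * b x"
    and p: "prime p" "coprime (int p) n" "\<not> int p dvd N"
  shows "int p dvd b (int p * x) - b x"
proof -
  have p0: "p = Suc (p - 1)" using prime_gt_0_nat[OF p(1)] by simp
  have "delta n (int p * y - int p * x) = (delta n (y - x) :: int)" for y
    using p(2) by (simp add: delta_def coprime_commute coprime_dvd_mult_right_iff flip: right_diff_distrib)
  moreover have "periodic n (\<lambda>y. b y ^ p)" using b by (simp add: periodic_def)
  ultimately have "(\<Sum>y\<in>{0..<n}. b y ^ p * delta n (int p * y - int p * x)) = b x ^ p"
    using sum_delta_periodic[OF n, of "\<lambda>y. b y ^ p"] by simp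
  moreover have "convpow n b p (int p * x) = N ^ (p - 1) * b (int p * x)" using pw[of "p - 1"] p0 by simp
  ultimately have 1: "int p dvd N ^ (p - 1) * b (int p * x) - b x ^ p"
    using convpow_prime_cong[OF n b p(1), of "int p * x"] by simp
  have "N ^ p = N * N ^ (p - 1)" by (subst p0) simp
  then have "int p dvd N * (N ^ (p - 1) - 1)" using fermat_int[OF p(1), of N] by (simp add: algebra_simps)
  moreover have "prime (int p)" using p by simp
  ultimately have 2: "int p dvd N ^ (p - 1) - 1" using p(3) prime_dvd_mult_iff by blast
  have "b (int p * x) - b x = (N ^ (p - 1) * b (int p * x) - b x ^ p) + (b x ^ p - b x)
     - (N ^ (p - 1) - 1) * b (int p * x)" by (simp add: algebra_simps)
  then show ?thesis using 1 2 fermat_int[OF p(1), of "b x"] by (metis dvd_add dvd_diff dvd_mult2)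
qed

theorem idempotent_gcd_cong:
  fixes e :: "int \<Rightarrow> rat"
  assumes n: "0 < n" and e: "periodic n e" and idem: "conv n e e = e" and eq: "gcd x n = gcd y n"
  shows "e x = e y"
proof -
  obtain N where N: "0 < N" "\<forall>a\<in>{0..<n}. of_int N * e a \<in> \<int>" using ex_common_denominator[of "{0..<n}" e] by auto
  define b where "b z = \<lfloor>of_int N * e z\<rfloor>" for z
  have eb: "of_int (b z) = of_int N * e z" for z
  proof -
    have "of_int N * e (z mod n) \<in> \<int>" using N n by simp
    then have "of_int N * e z \<in> \<int>" using e by (simp add: periodic_def)
    then show ?thesis by (simp add: b_def)
  qed
  have b: "periodic n b" using e by (simp add: periodic_def b_def)
  have pw: "convpow n b (Suc k) z = N ^ k * b z" for k z
  proof -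
    have "rat_of_int (convpow n b (Suc k) z) = convpow n (\<lambda>z. of_int N * e z) (Suc k) z"
      by (simp only: convpow_of_int[symmetric] eb)
    also have "\<dots> = of_int N ^ Suc k * e z" by (simp only: convpow_scale convpow_idempotent[OF n e idem])
    also have "\<dots> = rat_of_int (N ^ k * b z)" by (simp add: eb)
    finally show ?thesis by (simp only: of_int_eq_iff)
  qed
  define B where "B = (\<Sum>z\<in>{0..<n}. \<bar>b z\<bar>)"
  have B: "\<bar>b z\<bar> \<le> B" for z
  proof -
    have "\<bar>b (z mod n)\<bar> \<le> B" unfolding B_def using n by (intro member_le_sum) auto
    then show ?thesis using b by (simp add: periodic_def)
  qed
  \<comment> \<open>A number coprime to L has only prime factors above K. For such p the bound 2 B
    turns a congruence of two values of b modulo p into an equality, and N < p keeps p from dividing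
    N.\<close>
  define K where "K = nat (2 * B + N)"
  define L where "L = n * fact K"
  have L: "0 < L" using n by (simp add: L_def)
  have big: "b (int p * z) = b z" if p: "prime p" "coprime (int p) L" for p z
  proof -
    have "\<not> p dvd fact K"
    proof
      assume "p dvd fact K"
      then have "int p dvd fact K" by (metis of_nat_dvd_iff of_nat_fact)
      then have "is_unit (int p)" using p(2) by (intro coprime_common_divisor[of "int p" L]) (simp_all add: L_def)
      then show False using p(1) by simp
    qed
    then have "K < p" using p prime_dvd_fact_iff by (metis not_le)
    then have pK: "2 * B + N < int p" unfolding K_def by linarith
    have "0 \<le> B" by (simp add: B_def sum_nonneg)
    then have "\<not> int p dvd N" using N pK zdvd_imp_le by fastforce
    moreover have "coprime (int p) n" using p by (simp add: L_def)
    ultimately have "int p dvd b (int p * z) - b z" using idempotent_prime_invariant[OF n b pw p(1)] by blast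
    moreover have "\<bar>b (int p * z) - b z\<bar> < int p" using B[of z] B[of "int p * z"] pK N by linarith
    ultimately have "b (int p * z) - b z = 0" by (metis abs_of_nat dvd_imp_le_int not_le)
    then show ?thesis by simp
  qed
  have unit: "b (int u * z) = b z" if "0 < u" "coprime (int u) L" for u z
    using that
  proof (induction u arbitrary: z rule: less_induct)
    case (less u)
    show ?case
    proof (cases "u = 1")
      case False
      then obtain p where p: "prime p" "p dvd u" by (metis prime_factor_nat)
      then obtain v where v: "u = p * v" by blast
      have "v < u" "0 < v" using v p less.prems prime_gt_1_nat[OF p(1)] by auto
      moreover have "coprime (int p) L" "coprime (int v) L" using less.prems by (simp_all add: v)
      ultimately show ?thesis using less.IH[of v z] big[OF p(1), of "int v * z"] by (simp add: v mult.assoc)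
    qed simp
  qed
  obtain u where u: "coprime u L" "n dvd y - u * x"
    using gcd_eq_imp_unit_multiple[OF n _ eq, of L] L by auto
  \<comment> \<open>Adding L makes the representative positive, even when L = 1, so that it can be
    factored into primes.\<close>
  define u' where "u' = nat (u mod L + L)"
  have u': "int u' = u mod L + L" "0 < u'" using L by (simp_all add: u'_def add_nonneg_pos)
  have "coprime (int u') L" unfolding u' using u by (simp add: coprime_iff_gcd_eq_1) (metis gcd.commute gcd_red_int)
  then have "b (int u' * x) = b x" using unit u' by blast
  moreover have "b y = b (int u' * x)"
  proof (rule periodicD[OF b])
    have "n dvd L" by (simp add: L_def)
    moreover have "L dvd u - int u'" unfolding u' by (metis dvd_refl dvd_diff_right_iff dvd_minus_mod diff_diff_add)
    ultimately have "n dvd (u - int u') * x" by (meson dvd_mult2 dvd_trans)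
    then have "n dvd (y - u * x) + (u - int u') * x" using u by (intro dvd_add)
    then show "n dvd y - int u' * x" by (simp add: algebra_simps)
  qed
  ultimately have "rat_of_int (b x) = rat_of_int (b y)" by simp
  then show ?thesis unfolding eb using N by simp
qed

section \<open>The S-ring of a permutation group containing the full cycle\<close>

locale cyclic_perm_group =
  fixes n :: nat and G :: "(nat \<Rightarrow> nat) set"
  assumes n_pos: "0 < n" and sub: "subgroup G (sym_group n)" and cyc: "ncycle n \<in> G"
begin

lemma G_permutes: "\<sigma> \<in> G \<Longrightarrow> \<sigma> permutes {1..n}"
  using subgroup.mem_carrier[OF sub] by (simp add: sym_group_carrier)

lemma G_comp: "\<sigma> \<in> G \<Longrightarrow> \<tau> \<in> G \<Longrightarrow> \<sigma> \<circ> \<tau> \<in> G"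
  using subgroup.m_closed[OF sub] by (simp add: sym_group_mult)

lemma G_id: "id \<in> G"
  using subgroup.one_closed[OF sub] by (simp add: sym_group_one)

lemma G_inv: assumes "\<sigma> \<in> G" shows "inv' \<sigma> \<in> G"
proof -
  have c: "\<sigma> \<in> carrier (sym_group n)" using subgroup.mem_carrier[OF sub assms] .
  have "m_inv (sym_group n) \<sigma> = inv' \<sigma>"
    by (rule group.inv_equality[OF sym_group_is_group])
      (use c sym_group_inv_closed[OF c] permutes_inv_o[of \<sigma> "{1..n}"] in \<open>auto simp: sym_group_carrier sym_group_mult sym_group_one\<close>)
  then show ?thesis using subgroup.m_inv_closed[OF sub assms] by simp
qed

lemma G_mem: "\<sigma> \<in> G \<Longrightarrow> \<sigma> i \<in> {1..n} \<longleftrightarrow> i \<in> {1..n}"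
  by (rule permutes_in_image[OF G_permutes])

lemma G_inv_simps: assumes "\<sigma> \<in> G" shows "inv' \<sigma> (\<sigma> i) = i" "\<sigma> (inv' \<sigma> i) = i"
  using permutes_inverses[OF G_permutes[OF assms]] by simp_all

lemma G_inv_inv: "\<sigma> \<in> G \<Longrightarrow> inv' (inv' \<sigma>) = \<sigma>"
  by (rule permutes_inv_inv[OF G_permutes])

lemma finite_G: "finite G"
  by (rule finite_subset[of _ "{p. p permutes {1..n}}"]) (use G_permutes finite_permutations in auto)

lemma eq_if_cong:
  assumes "i \<in> {1..n}" "j \<in> {1..n}" "int n dvd int i - int j"
  shows "i = j"
proof -
  have "int i - 1 = int j - 1"
    by (rule eq_if_dvd_diff_atLeastLessThan[of _ "int n"]) (use assms in \<open>simp_all\<close>)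
  then show ?thesis by simp
qed

lemma cong_iff_eq: "i \<in> {1..n} \<Longrightarrow> j \<in> {1..n} \<Longrightarrow> int n dvd int i - int j \<longleftrightarrow> i = j"
  using eq_if_cong[of i j] by (metis diff_self dvd_0_right)

lemma sum_positions:
  assumes h: "periodic (int n) h" and \<phi>: "\<And>i j. i \<in> {1..n} \<Longrightarrow> j \<in> {1..n} \<Longrightarrow> int n dvd \<phi> i - \<phi> j \<Longrightarrow> i = j"
  shows "(\<Sum>i=1..n. h (\<phi> i)) = (\<Sum>y\<in>{0..<int n}. h y)"
  by (rule sum_periodic_reindex[OF _ h _ _ \<phi>]) (use n_pos in simp_all)

text \<open>The second condition says that the circulant matrix with entries
  \<open>f (i - j)\<close> commutes with G, i.e. is constant on orbits of pairs. The first is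
  rationality, and it also supplies periodicity.\<close>

definition CG :: "(int \<Rightarrow> rat) set" where
  "CG = {f. (\<forall>x y. gcd x (int n) = gcd y (int n) \<longrightarrow> f x = f y) \<and>
     (\<forall>\<sigma>\<in>G. \<forall>i\<in>{1..n}. \<forall>j\<in>{1..n}. f (int (\<sigma> i) - int (\<sigma> j)) = f (int i - int j))}"

lemma CG_periodic: "f \<in> CG \<Longrightarrow> periodic (int n) f"
  unfolding CG_def by (rule periodicI) (blast dest: gcd_eq_if_dvd_diff)

text \<open>Convolution is the product of the matrices of f and g. Letting the summation index run
  through the values \<open>\<sigma> k\<close> makes the invariance of this product under G
  visible.\<close>

lemma conv_positions:
  assumes f: "periodic (int n) f" and g: "periodic (int n) g"
    and inj: "\<And>k l. k \<in> {1..n} \<Longrightarrow> l \<in> {1..n} \<Longrightarrow> int n dvd int (\<sigma> k) - int (\<sigma> l) \<Longrightarrow> k = l"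
  shows "conv (int n) f g (a - b) = (\<Sum>k=1..n. f (a - int (\<sigma> k)) * g (int (\<sigma> k) - b))"
proof -
  let ?h = "\<lambda>y. f y * g (a - b - y)"
  have h: "periodic (int n) ?h"
  proof (rule periodicI)
    fix x y assume xy: "int n dvd x - y"
    have "f x = f y" using periodicD[OF f xy] .
    moreover have "int n dvd (a - b - x) - (a - b - y)" using xy by (simp add: dvd_diff_commute)
    then have "g (a - b - x) = g (a - b - y)" using periodicD[OF g] by blast
    ultimately show "?h x = ?h y" by simp
  qed
  have "(\<Sum>k=1..n. ?h (a - int (\<sigma> k))) = (\<Sum>y\<in>{0..<int n}. ?h y)"
  proof (rule sum_positions[OF h])
    fix k l assume kl: "k \<in> {1..n}" "l \<in> {1..n}" "int n dvd (a - int (\<sigma> k)) - (a - int (\<sigma> l))"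
    then have "int n dvd int (\<sigma> k) - int (\<sigma> l)" by (simp add: dvd_diff_commute)
    then show "k = l" using inj kl by blast
  qed
  then show ?thesis by (simp add: conv_def algebra_simps)
qed

lemma conv_positions_id:
  assumes f: "periodic (int n) f" and g: "periodic (int n) g"
  shows "conv (int n) f g (a - b) = (\<Sum>k=1..n. f (a - int k) * g (int k - b))"
  by (rule conv_positions[OF f g]) (auto intro: eq_if_cong)

sublocale rational_sring "int n" CG
proof
  show "0 < int n" using n_pos by simp
next
  fix f g assume f: "f \<in> CG" and g: "g \<in> CG"
  note pf = CG_periodic[OF f] and pg = CG_periodic[OF g]
  have "conv (int n) f g x = conv (int n) f g y" if eq: "gcd x (int n) = gcd y (int n)" for x y
  proof -
    obtain u where u: "coprime u (int n)" "int n dvd y - u * x"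
      using gcd_eq_imp_unit_multiple[OF _ _ eq, of "int n"] n_pos by auto
    have per: "periodic (int n) (\<lambda>t. f t * g (u * x - t))"
    proof (rule periodicI)
      fix a b assume ab: "int n dvd a - b"
      have "f a = f b" using periodicD[OF pf ab] .
      moreover have "int n dvd (u * x - a) - (u * x - b)" using ab by (simp add: dvd_diff_commute)
      then have "g (u * x - a) = g (u * x - b)" using periodicD[OF pg] by blast
      ultimately show "f a * g (u * x - a) = f b * g (u * x - b)" by simp
    qed
    have uf: "h (u * t) = h t" if "h \<in> CG" for h t
    proof -
      have "gcd (u * t) (int n) = gcd t (int n)" using u by (simp add: gcd_mult_left_left_cancel coprime_commute)
      then show ?thesis using that unfolding CG_def by blast
    qed
    have "conv (int n) f g y = conv (int n) f g (u * x)" using periodicD[OF periodic_conv[OF pg] u(2)] .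
    also have "\<dots> = (\<Sum>t\<in>{0..<int n}. f (u * t + 0) * g (u * x - (u * t + 0)))"
      unfolding conv_def by (rule sum_periodic_affine[OF _ per u(1), symmetric]) (use n_pos in simp)
    also have "\<dots> = (\<Sum>t\<in>{0..<int n}. f (u * t) * g (u * (x - t)))" by (simp add: right_diff_distrib)
    also have "\<dots> = conv (int n) f g x" by (simp add: conv_def uf f g)
    finally show ?thesis ..
  qed
  moreover have "conv (int n) f g (int (\<sigma> i) - int (\<sigma> j)) = conv (int n) f g (int i - int j)"
    if s: "\<sigma> \<in> G" and ij: "i \<in> {1..n}" "j \<in> {1..n}" for \<sigma> i j
  proof -
    have "conv (int n) f g (int (\<sigma> i) - int (\<sigma> j)) = (\<Sum>k=1..n. f (int (\<sigma> i) - int (\<sigma> k)) * g (int (\<sigma> k) - int (\<sigma> j)))"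
    proof (rule conv_positions[OF pf pg])
      fix k l assume "k \<in> {1..n}" "l \<in> {1..n}" "int n dvd int (\<sigma> k) - int (\<sigma> l)"
      then have "\<sigma> k = \<sigma> l" using eq_if_cong G_mem[OF s] by blast
      then show "k = l" by (metis G_inv_simps(1)[OF s])
    qed
    also have "\<dots> = (\<Sum>k=1..n. f (int i - int k) * g (int k - int j))"
      using f g s ij unfolding CG_def
      by (intro sum.cong refl arg_cong2[where f = times]; blast)
    also have "\<dots> = conv (int n) f g (int i - int j)" by (rule conv_positions_id[OF pf pg, symmetric])
    finally show ?thesis .
  qed
  ultimately show "conv (int n) f g \<in> CG" unfolding CG_def by blast
next
  have "(x :: int) dvd a \<longleftrightarrow> x dvd gcd a x" for x a by simp
  then have "int n dvd x \<longleftrightarrow> int n dvd y" if "gcd x (int n) = gcd y (int n)" for x y using that by metis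
  moreover have "int n dvd int (\<sigma> i) - int (\<sigma> j) \<longleftrightarrow> int n dvd int i - int j"
    if s: "\<sigma> \<in> G" and ij: "i \<in> {1..n}" "j \<in> {1..n}" for \<sigma> i j
  proof -
    have "int n dvd int (\<sigma> i) - int (\<sigma> j) \<longleftrightarrow> \<sigma> i = \<sigma> j"
      using ij G_mem[OF s] by (intro cong_iff_eq) blast+
    moreover have "\<sigma> i = \<sigma> j \<longleftrightarrow> i = j" by (metis G_inv_simps(1)[OF s])
    ultimately show ?thesis using cong_iff_eq[OF ij] by simp
  qed
  ultimately show "delta (int n) \<in> CG" unfolding CG_def delta_def
    by (intro CollectI conjI allI impI ballI arg_cong[where f = of_bool]; blast)
next
  fix f x y assume "f \<in> CG" "gcd x (int n) = gcd y (int n)"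
  then show "f x = f y" unfolding CG_def by blast
next
  fix c show "(\<lambda>_. c) \<in> CG" by (simp add: CG_def)
next
  fix f g assume f: "f \<in> CG" and g: "g \<in> CG"
  show "(\<lambda>x. f x + g x) \<in> CG" using f g unfolding CG_def
    by (intro CollectI conjI allI impI ballI arg_cong2[where f = plus]; blast)
  show "(\<lambda>x. f x * g x) \<in> CG" using f g unfolding CG_def
    by (intro CollectI conjI allI impI ballI arg_cong2[where f = times]; blast)
qed

lemma Vper_iff:
  assumes d: "d dvd n"
  shows "v \<in> Vper n d \<longleftrightarrow> v \<in> Qvec n \<and> (\<forall>i\<in>{1..n}. \<forall>j\<in>{1..n}. int d dvd int i - int j \<longrightarrow> v i = v j)"
proof -
  have d0: "0 < d" "d \<le> n" using d n_pos by (auto intro: dvd_imp_le gr0I)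
  let ?r = "\<lambda>i. (i - 1) mod d + 1"
  have r: "?r i \<in> {1..n}" for i
  proof -
    have "(i - 1) mod d < d" using d0 by simp
    then have "?r i \<le> n" using d0 by linarith
    then show ?thesis by simp
  qed
  have cong: "int d dvd int i - int j \<longleftrightarrow> ?r i = ?r j" if "i \<in> {1..n}" "j \<in> {1..n}" for i j
  proof -
    have "int i - int j = int (i - 1) - int (j - 1)" using that by auto
    then have "int d dvd int i - int j \<longleftrightarrow> int (i - 1) mod int d = int (j - 1) mod int d" by (simp add: mod_eq_dvd_iff)
    then show ?thesis by (simp flip: zmod_int)
  qed
  have rr: "?r (?r i) = ?r i" for i by simp
  show ?thesis
  proof (cases "v \<in> Qvec n")
    case True
    have "(\<forall>i\<in>{1..n}. v i = v (?r i)) \<longleftrightarrow> (\<forall>i\<in>{1..n}. \<forall>j\<in>{1..n}. int d dvd int i - int j \<longrightarrow> v i = v j)"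
    proof (intro iffI ballI impI)
      fix i j assume "\<forall>i\<in>{1..n}. v i = v (?r i)" "i \<in> {1..n}" "j \<in> {1..n}" "int d dvd int i - int j"
      then show "v i = v j" using cong[of i j] by metis
    next
      fix i assume *: "\<forall>i\<in>{1..n}. \<forall>j\<in>{1..n}. int d dvd int i - int j \<longrightarrow> v i = v j" and i: "i \<in> {1..n}"
      have "int d dvd int i - int (?r i)" using cong[OF i r] rr by simp
      then show "v i = v (?r i)" using * i r by blast
    qed
    then show ?thesis using True by (simp add: Vper_def)
  qed (simp add: Vper_def)
qed

lemma perm_act_Qvec: "\<sigma> \<in> G \<Longrightarrow> v \<in> Qvec n \<Longrightarrow> perm_act \<sigma> v \<in> Qvec n"
  using G_mem[OF G_inv] by (auto simp: Qvec_def perm_act_def)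

text \<open>Both sides say that G preserves congruence modulo d, i.e. that the residue classes are
  blocks.\<close>

lemma csub_iff_DG: "csub (int d) \<longleftrightarrow> d \<in> DG n G"
proof (cases "d dvd n")
  case False
  then show ?thesis by (auto simp: csub_def DG_def)
next
  case d: True
  have d0: "0 < d" using d n_pos by (auto intro: gr0I)
  have "(\<forall>\<sigma>\<in>G. \<forall>i\<in>{1..n}. \<forall>j\<in>{1..n}. int d dvd int (\<sigma> i) - int (\<sigma> j) \<longleftrightarrow> int d dvd int i - int j)
     \<longleftrightarrow> G_invariant G (Vper n d)" (is "?L \<longleftrightarrow> ?R")
  proof
    assume L: ?L
    show ?R unfolding G_invariant_def
    proof (intro ballI)
      fix \<sigma> v assume s: "\<sigma> \<in> G" and v: "v \<in> Vper n d"
      then have "perm_act \<sigma> v \<in> Qvec n" by (intro perm_act_Qvec) (auto simp: Vper_def)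
      moreover have "perm_act \<sigma> v i = perm_act \<sigma> v j"
        if "i \<in> {1..n}" "j \<in> {1..n}" "int d dvd int i - int j" for i j
      proof -
        have "int d dvd int (inv' \<sigma> i) - int (inv' \<sigma> j)" using L G_inv[OF s] that by blast
        then show ?thesis using v that G_mem[OF G_inv[OF s]] unfolding Vper_iff[OF d] perm_act_def by blast
      qed
      ultimately show "perm_act \<sigma> v \<in> Vper n d" unfolding Vper_iff[OF d] by blast
    qed
  next
    assume R: ?R
    have one: "int d dvd int (\<sigma> i) - int (\<sigma> j)"
      if s: "\<sigma> \<in> G" and ij: "i \<in> {1..n}" "j \<in> {1..n}" "int d dvd int i - int j" for \<sigma> i j
    proof -
      \<comment> \<open>The indicator of the residue class of \<open>\<sigma> j\<close> serves as
        test vector: pulled back along \<open>\<sigma>\<close>, it must still be d-periodic, so its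
        values at i and j agree.\<close>
      define v where "v k = (of_bool (k \<in> {1..n} \<and> int d dvd int k - int (\<sigma> j)) :: rat)" for k
      have "v k = v l" if "k \<in> {1..n}" "l \<in> {1..n}" "int d dvd int k - int l" for k l
      proof -
        have "int k - int (\<sigma> j) = (int k - int l) + (int l - int (\<sigma> j))" by simp
        then have "int d dvd int k - int (\<sigma> j) \<longleftrightarrow> int d dvd int l - int (\<sigma> j)" using dvd_add_right_iff[OF that(3), of "int l - int (\<sigma> j)"] by simp
        then show ?thesis using that by (simp add: v_def)
      qed
      moreover have "v \<in> Qvec n" by (auto simp: Qvec_def v_def)
      ultimately have "v \<in> Vper n d" unfolding Vper_iff[OF d] by blast
      then have "perm_act (inv' \<sigma>) v \<in> Vper n d" using R G_inv[OF s] by (simp add: G_invariant_def)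
      then have "perm_act (inv' \<sigma>) v i = perm_act (inv' \<sigma>) v j" using ij unfolding Vper_iff[OF d] by blast
      then have "v (\<sigma> i) = v (\<sigma> j)" by (simp add: perm_act_def G_inv_inv[OF s])
      moreover have "v (\<sigma> j) = 1" using ij G_mem[OF s] by (simp add: v_def)
      ultimately show ?thesis by (simp add: v_def split: if_splits)
    qed
    show ?L
    proof (intro ballI iffI)
      fix \<sigma> i j assume *: "\<sigma> \<in> G" "i \<in> {1..n}" "j \<in> {1..n}" "int d dvd int (\<sigma> i) - int (\<sigma> j)"
      then show "int d dvd int i - int j"
        using one[OF G_inv[OF *(1)], of "\<sigma> i" "\<sigma> j"] G_mem[OF *(1)] by (simp add: G_inv_simps)
    qed (use one in blast)
  qed
  moreover have "int d dvd x \<longleftrightarrow> int d dvd y" if "gcd x (int n) = gcd y (int n)" for x y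
  proof -
    have "int d dvd z \<longleftrightarrow> int d dvd gcd z (int n)" for z using d by simp
    then show ?thesis using that by metis
  qed
  then have "(\<lambda>x. of_bool (x \<in> {x. int d dvd x})) \<in> CG \<longleftrightarrow>
      (\<forall>\<sigma>\<in>G. \<forall>i\<in>{1..n}. \<forall>j\<in>{1..n}. int d dvd int (\<sigma> i) - int (\<sigma> j) \<longleftrightarrow> int d dvd int i - int j)"
    unfolding CG_def mem_Collect_eq of_bool_eq_iff by blast
  ultimately have "cset {x. int d dvd x} \<longleftrightarrow> G_invariant G (Vper n d)" unfolding cset_def by (simp only:)
  then show ?thesis using d d0 by (simp add: csub_def DG_def)
qed

lemma rotation: "\<exists>\<sigma>\<in>G. \<forall>i\<in>{1..n}. int n dvd int (\<sigma> i) - (int i + int k)"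
proof (induction k)
  case 0
  then show ?case by (intro bexI[of _ id]) (auto intro: G_id)
next
  case (Suc k)
  then obtain \<sigma> where s: "\<sigma> \<in> G" "\<forall>i\<in>{1..n}. int n dvd int (\<sigma> i) - (int i + int k)" by blast
  have c: "int n dvd int (ncycle n j) - (int j + 1)" if "j \<in> {1..n}" for j
    using that by (auto simp: ncycle_def)
  show ?case
  proof (intro bexI[of _ "ncycle n \<circ> \<sigma>"] ballI)
    fix i assume i: "i \<in> {1..n}"
    have "int n dvd (int (ncycle n (\<sigma> i)) - (int (\<sigma> i) + 1)) + (int (\<sigma> i) - (int i + int k))"
      using i s c[of "\<sigma> i"] G_mem[OF s(1)] by (intro dvd_add) auto
    then show "int n dvd int ((ncycle n \<circ> \<sigma>) i) - (int i + int (Suc k))" by (simp add: algebra_simps)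
  qed (use s cyc G_comp in blast)
qed

text \<open>The position in \<open>{1..n}\<close> congruent to \<open>x\<close> modulo \<open>n\<close>.\<close>

definition rep :: "int \<Rightarrow> nat" where
  "rep x = nat ((x - 1) mod int n) + 1"

lemma rep_mem: "rep x \<in> {1..n}"
proof -
  have "0 \<le> (x - 1) mod int n" "(x - 1) mod int n < int n" using n_pos by simp_all
  then show ?thesis by (auto simp: rep_def)
qed

lemma rep_cong: "int n dvd int (rep x) - x"
proof -
  have "int (rep x) - x = (x - 1) mod int n - (x - 1)" using n_pos by (simp add: rep_def)
  then show ?thesis by (metis dvd_diff_commute dvd_minus_mod)
qed

lemma rep_of_nat: "i \<in> {1..n} \<Longrightarrow> rep (int i) = i"
  by (rule eq_if_cong[OF rep_mem _ rep_cong])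

lemma periodic_rep: "periodic (int n) (\<lambda>x. f (rep x))"
  by (simp add: periodic_def rep_def mod_diff_left_eq)

text \<open>Position n stands for the residue 0. Rotating by j moves it to j, so an invariant matrix
  is determined by its column n.\<close>

lemma circulant:
  fixes P :: "nat \<Rightarrow> nat \<Rightarrow> rat"
  assumes P: "\<And>\<sigma> i j. \<sigma> \<in> G \<Longrightarrow> i \<in> {1..n} \<Longrightarrow> j \<in> {1..n} \<Longrightarrow> P (\<sigma> i) (\<sigma> j) = P i j"
    and ij: "i \<in> {1..n}" "j \<in> {1..n}"
  shows "P i j = P (rep (int i - int j)) n"
proof -
  obtain \<sigma> where s: "\<sigma> \<in> G" "\<forall>i\<in>{1..n}. int n dvd int (\<sigma> i) - (int i + int j)" using rotation by blast
  let ?k = "rep (int i - int j)"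
  have "int n dvd (int (\<sigma> ?k) - (int ?k + int j)) + (int ?k - (int i - int j))"
    using s rep_mem rep_cong by (intro dvd_add) auto
  then have "int n dvd int (\<sigma> ?k) - int i" by (simp add: algebra_simps)
  then have 1: "\<sigma> ?k = i" using ij rep_mem G_mem[OF s(1)] eq_if_cong by blast
  have "int n dvd int (\<sigma> n) - (int n + int j)" using s n_pos by simp
  then have "int n dvd (int (\<sigma> n) - (int n + int j)) + int n" by (intro dvd_add) auto
  then have "int n dvd int (\<sigma> n) - int j" by (simp add: algebra_simps)
  then have 2: "\<sigma> n = j" using ij n_pos G_mem[OF s(1)] by (intro eq_if_cong) auto
  show ?thesis using P[OF s(1) rep_mem, of n "int i - int j"] n_pos by (simp add: 1 2)
qed

end

section \<open>Fourier analysis\<close>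

text \<open>The 0-1 matrix of R is unitriangular for the ranking m. It is applied to divisibility in
  both directions, playing the role of Moebius inversion on D(G).\<close>

lemma triangular_solvable:
  fixes f :: "'a \<Rightarrow> rat" and m :: "'a \<Rightarrow> nat"
  assumes "finite D" and R: "\<And>h k. h \<in> D \<Longrightarrow> k \<in> D \<Longrightarrow> R h k \<Longrightarrow> h \<noteq> k \<Longrightarrow> m h < m k"
    and refl: "\<And>h. h \<in> D \<Longrightarrow> R h h"
  shows "\<exists>c. \<forall>k\<in>D. (\<Sum>h\<in>D. c h * of_bool (R h k)) = f k"
  using assms
proof (induction D rule: finite_ranking_induct[where f = m])
  case (insert b A)
  show ?case
  proof (cases "b \<in> A")
    case True
    then have "insert b A = A" by blast
    then show ?thesis using insert by simp
  next
    case False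
    obtain c where c: "\<forall>k\<in>A. (\<Sum>h\<in>A. c h * of_bool (R h k)) = f k" using insert by auto
    define c' where "c' = c(b := f b - (\<Sum>h\<in>A. c h * of_bool (R h b)))"
    have eq: "(\<Sum>h\<in>insert b A. c' h * of_bool (R h k)) = c' b * of_bool (R b k) + (\<Sum>h\<in>A. c h * of_bool (R h k))" for k
    proof -
      have "(\<Sum>h\<in>A. c' h * of_bool (R h k)) = (\<Sum>h\<in>A. c h * of_bool (R h k))"
        by (rule sum.cong) (use False in \<open>auto simp: c'_def\<close>)
      then show ?thesis using insert.hyps False by simp
    qed
    have "\<not> R b k" if "k \<in> A" for k
      using insert.prems(1)[of b k] insert.hyps(2)[OF that] that False by auto
    then have "(\<Sum>h\<in>insert b A. c' h * of_bool (R h k)) = f k" if "k \<in> A" for k using that c by (simp add: eq)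
    moreover have "(\<Sum>h\<in>insert b A. c' h * of_bool (R h b)) = f b"
      using insert.prems(2)[of b] by (simp add: eq) (simp add: c'_def)
    ultimately show ?thesis by blast
  qed
qed simp

lemma cnj_of_rat: "cnj (of_rat q) = of_rat q"
  by (cases q) (simp add: of_rat_rat)

lemma of_rat_of_bool: "of_rat (of_bool b) = of_bool b"
  by (cases b) simp_all

context cyclic_perm_group
begin

section \<open>The divisors in D(G) and the partition of the frequencies by Psi\<close>

lemma DG_dvd: "d \<in> DG n G \<Longrightarrow> d dvd n" by (simp add: DG_def)

lemma DG_pos: "d \<in> DG n G \<Longrightarrow> 0 < d" using dvd_pos_nat[OF n_pos DG_dvd] .

lemma finite_DG: "finite (DG n G)"
  by (rule finite_subset[of _ "{d. d dvd n}"]) (use DG_dvd n_pos in auto)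

lemma DG_gcd: "d \<in> DG n G \<Longrightarrow> h \<in> DG n G \<Longrightarrow> gcd d h \<in> DG n G"
  using csub_gcd[of "int d" "int h"] by (simp only: csub_iff_DG gcd_int_int_eq)

lemma n_in_DG: "n \<in> DG n G"
  using csub_n by (simp only: csub_iff_DG)

text \<open>Prescribing the values on \<open>DG n G\<close> is a triangular system. Both sides lie
  in \<open>CG\<close> and every x is equivalent to an element of \<open>DG n G\<close>, so
  agreement there is agreement everywhere.\<close>

lemma CG_combination:
  assumes f: "f \<in> CG"
  shows "\<exists>c. \<forall>x. f x = (\<Sum>h\<in>DG n G. c h * of_bool (int h dvd x))"
proof -
  have "\<exists>c. \<forall>k\<in>DG n G. (\<Sum>h\<in>DG n G. c h * of_bool (h dvd k)) = f (int k)"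
  proof (rule triangular_solvable[OF finite_DG, where m = id])
    fix h k assume "h \<in> DG n G" "k \<in> DG n G" "h dvd k" "h \<noteq> k"
    then show "id h < id k" using dvd_imp_le[of h k] DG_pos[of k] by simp
  qed simp
  then obtain c where c: "\<And>k. k \<in> DG n G \<Longrightarrow> (\<Sum>h\<in>DG n G. c h * of_bool (h dvd k)) = f (int k)" by blast
  have g: "(\<lambda>x. \<Sum>h\<in>DG n G. c h * of_bool (int h dvd x)) \<in> CG"
  proof (rule sum_mem)
    fix h assume "h \<in> DG n G"
    then have "csub (int h)" by (simp only: csub_iff_DG)
    then have "(\<lambda>x. of_bool (x \<in> {x. int h dvd x})) \<in> CG" unfolding csub_def cset_def by blast
    then show "(\<lambda>x. c h * of_bool (int h dvd x)) \<in> CG" using mult_mem[OF const_mem] by simp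
  qed
  have "f x = (\<Sum>h\<in>DG n G. c h * of_bool (int h dvd x))" for x
  proof -
    obtain h where h: "csub h" "eqv x h" using rational_sring_class_generator[OF rational_sring_axioms] by blast
    define k where "k = nat h"
    have hk: "h = int k" using h by (simp add: csub_def k_def)
    then have k: "k \<in> DG n G" using h by (simp only: csub_iff_DG)
    have "f x = f (int k)" using h f unfolding hk eqv_def by blast
    also have "\<dots> = (\<Sum>h\<in>DG n G. c h * of_bool (int h dvd int k))" using c[OF k] by simp
    also have "\<dots> = (\<Sum>h\<in>DG n G. c h * of_bool (int h dvd x))"
      using bspec[OF h(2)[unfolded eqv_def] g] unfolding hk by simp
    finally show ?thesis .
  qed
  then show ?thesis by blast
qed

lemma div_dvd_iff: "d \<in> DG n G \<Longrightarrow> n div d dvd r \<longleftrightarrow> n dvd r * d"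
  using DG_pos DG_dvd by (metis dvd_mult_div_cancel dvd_times_right_cancel_iff mult.commute not_gr_zero)

lemma Psi_iff: "d \<in> DG n G \<Longrightarrow> r \<in> Psi n G d \<longleftrightarrow>
    r \<in> {1..n} \<and> n dvd r * d \<and> (\<forall>d'\<in>DG n G. covers n G d d' \<longrightarrow> \<not> n dvd r * d')"
  unfolding Psi_def using div_dvd_iff by auto

text \<open>Since D(G) is closed under gcd, \<open>n dvd r * h\<close> passes to
  \<open>gcd d h\<close>. If that were a proper divisor of d, some divisor covered by d would be a
  multiple of it and contradict \<open>r \<in> Psi n G d\<close>.\<close>

lemma Psi_dvd_iff:
  assumes d: "d \<in> DG n G" and r: "r \<in> Psi n G d" and h: "h \<in> DG n G"
  shows "n dvd r * h \<longleftrightarrow> d dvd h"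
proof
  assume "d dvd h"
  then have "r * d dvd r * h" by simp
  then show "n dvd r * h" using r Psi_iff[OF d] dvd_trans by blast
next
  assume nh: "n dvd r * h"
  define g where "g = gcd d h"
  have g: "g \<in> DG n G" "g dvd d" using DG_gcd[OF d h] by (simp_all add: g_def)
  have "n dvd gcd (r * d) (r * h)" using nh r Psi_iff[OF d] by simp
  then have ng: "n dvd r * g" by (simp add: g_def gcd_mult_distrib_nat)
  have "g = d"
  proof (rule ccontr)
    assume "g \<noteq> d"
    then have "g < d" using g DG_pos[OF d] by (simp add: dvd_imp_le le_neq_implies_less)
    let ?A = "{l \<in> DG n G. g dvd l \<and> l dvd d \<and> l < d}"
    have fin: "finite ?A" using finite_DG by simp
    have "g \<in> ?A" using g \<open>g < d\<close> by simp
    \<comment> \<open>The largest element of \<open>?A\<close> is covered by d.\<close>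
    then have m: "Max ?A \<in> ?A" using Max_in[OF fin] by blast
    have "covers n G d (Max ?A)" unfolding covers_def
    proof (intro conjI notI)
      assume "\<exists>l\<in>DG n G. Max ?A < l \<and> l < d \<and> Max ?A dvd l \<and> l dvd d"
      then obtain l where l: "l \<in> DG n G" "Max ?A < l" "l < d" "Max ?A dvd l" "l dvd d" by blast
      then have "l \<in> ?A" using m dvd_trans by blast
      then show False using Max_ge[OF fin] l by fastforce
    qed (use m in blast)+
    moreover have "g dvd Max ?A" using m by blast
    then have "r * g dvd r * Max ?A" by (intro mult_dvd_mono dvd_refl)
    then have "n dvd r * Max ?A" using ng dvd_trans by blast
    ultimately show False using r m Psi_iff[OF d] by blast
  qed
  then show "d dvd h" by (metis g_def gcd_dvd2)
qed

lemma Psi_unique: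
  assumes d: "d \<in> DG n G" "d' \<in> DG n G" and r: "r \<in> Psi n G d" "r \<in> Psi n G d'"
  shows "d = d'"
proof (rule dvd_antisym)
  show "d dvd d'" using Psi_dvd_iff[OF d(1) r(1) d(2)] Psi_iff[OF d(2)] r(2) by blast
  show "d' dvd d" using Psi_dvd_iff[OF d(2) r(2) d(1)] Psi_iff[OF d(1)] r(1) by blast
qed

text \<open>The least d in D(G) with \<open>n dvd r * d\<close> works. With
  \<open>Psi_unique\<close> this makes the sets \<open>Psi n G d\<close> a partition of
  \<open>{1..n}\<close>.\<close>

lemma Psi_exists:
  assumes "r \<in> {1..n}"
  shows "\<exists>d\<in>DG n G. r \<in> Psi n G d"
proof -
  define d where "d = (LEAST d. d \<in> DG n G \<and> n dvd r * d)"
  have d: "d \<in> DG n G" "n dvd r * d"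
    using LeastI[of "\<lambda>d. d \<in> DG n G \<and> n dvd r * d" n] n_in_DG by (auto simp: d_def)
  have "\<not> n dvd r * d'" if "d' \<in> DG n G" "d' < d" for d'
    using not_less_Least[of d' "\<lambda>d. d \<in> DG n G \<and> n dvd r * d"] that by (auto simp: d_def)
  then have "r \<in> Psi n G d" using d assms by (auto simp: Psi_iff covers_def)
  then show ?thesis using d by blast
qed

section \<open>Characters, Fourier inversion and the spectral description of V_d and U_d\<close>

definition \<chi> :: "int \<Rightarrow> int \<Rightarrow> complex" where
  "\<chi> r x = cis (2 * pi * (real_of_int r * real_of_int x / real n))"

lemma chi_add: "\<chi> r (x + y) = \<chi> r x * \<chi> r y"
  by (simp add: \<chi>_def cis_mult ring_distribs add_divide_distrib)

lemma cnj_chi: "cnj (\<chi> r x) = \<chi> r (- x)"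
  by (simp add: \<chi>_def cis_cnj)

lemma chi_eq_1_iff: "\<chi> r x = 1 \<longleftrightarrow> int n dvd r * x"
proof
  assume "\<chi> r x = 1"
  then have "cos (2 * pi * (real_of_int r * real_of_int x / real n)) = 1" by (metis \<chi>_def cis.sel(1) one_complex.sel(1))
  then obtain k :: int where "2 * pi * (real_of_int r * real_of_int x / real n) = k * 2 * pi"
    by (auto simp: cos_one_2pi_int)
  then have "(2 * pi) * (real_of_int r * real_of_int x / real n) = (2 * pi) * real_of_int k" by simp
  then have "real_of_int r * real_of_int x / real n = k" by (metis mult_cancel_left pi_neq_zero zero_neq_numeral mult_eq_0_iff)
  then have "real_of_int (r * x) = real_of_int (k * int n)" using n_pos by (simp add: field_simps)
  then have "r * x = k * int n" by (simp only: of_int_eq_iff)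
  then show "int n dvd r * x" by simp
next
  assume "int n dvd r * x"
  then obtain k where "r * x = int n * k" by blast
  then have "real_of_int r * real_of_int x = real n * real_of_int k" by (metis of_int_mult of_int_of_nat_eq)
  then have "real_of_int r * real_of_int x / real n = real_of_int k" using n_pos by (simp add: field_simps)
  then show "\<chi> r x = 1" unfolding \<chi>_def using cis_multiple_2pi[of "real_of_int k"] by simp
qed

lemma chi_cong:
  assumes "int n dvd r * (x - y)" shows "\<chi> r x = \<chi> r y"
  using assms chi_add[of r "x - y" y] by (simp add: chi_eq_1_iff[symmetric])

lemma periodic_chi: "periodic (int n) (\<lambda>x. \<chi> r (c - x))"
  by (rule periodicI, rule chi_cong) (simp add: dvd_mult dvd_diff_commute)

text \<open>Substituting \<open>y + d\<close> for y multiplies the sum by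
  \<open>\<chi> r (- d)\<close>, which differs from 1.\<close>

lemma sum_chi_zero:
  assumes F: "periodic (int n) F" "\<And>y. F (y + d) = F y" and rd: "\<not> int n dvd r * d"
  shows "(\<Sum>y\<in>{0..<int n}. F y * \<chi> r (c - y)) = 0"
proof -
  have per: "periodic (int n) (\<lambda>y. F y * \<chi> r (c - y))"
    using F(1) periodic_chi[of r c] by (simp add: periodic_def)
  let ?s = "\<Sum>y\<in>{0..<int n}. F y * \<chi> r (c - y)"
  have "?s = (\<Sum>y\<in>{0..<int n}. F (1 * y + d) * \<chi> r (c - (1 * y + d)))"
    by (rule sum_periodic_affine[OF _ per, symmetric]) (use n_pos in simp_all)
  also have "\<dots> = (\<Sum>y\<in>{0..<int n}. F y * \<chi> r (c - y) * \<chi> r (- d))"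
  proof (rule sum.cong)
    fix y
    have "\<chi> r (c - (1 * y + d)) = \<chi> r (c - y) * \<chi> r (- d)"
      unfolding chi_add[symmetric] by (simp add: algebra_simps)
    then show "F (1 * y + d) * \<chi> r (c - (1 * y + d)) = F y * \<chi> r (c - y) * \<chi> r (- d)"
      using F(2) by simp
  qed simp
  also have "\<dots> = ?s * \<chi> r (- d)" by (rule sum_distrib_right[symmetric])
  finally have "?s * (1 - \<chi> r (- d)) = 0" by (simp add: algebra_simps)
  moreover have "\<chi> r (- d) \<noteq> 1" using rd by (simp add: chi_eq_1_iff)
  ultimately show ?thesis by simp
qed

lemma wvec_chi: "i \<in> {1..n} \<Longrightarrow> cnj (wvec n r i) = \<chi> (int r) (1 - int i)"
proof -
  assume i: "i \<in> {1..n}"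
  have "wvec n r i = \<chi> (int r) (int i - 1)"
    using i by (simp add: wvec_def eps_def \<chi>_def DeMoivre of_nat_diff field_simps)
  then show ?thesis by (simp add: cnj_chi)
qed

lemma herm_chi: "herm n v (wvec n r) = (\<Sum>i=1..n. of_rat (v i) * \<chi> (int r) (1 - int i))"
  unfolding herm_def by (rule sum.cong) (simp_all add: wvec_chi)

lemma sum_chi_all:
  "(\<Sum>r=1..n. \<chi> (int r) x) = (if int n dvd x then of_nat n else 0)"
proof (cases "int n dvd x")
  case True
  then have "\<chi> (int r) x = 1" for r by (simp add: chi_eq_1_iff)
  then show ?thesis using True by simp
next
  case False
  have "(\<Sum>r=1..n. \<chi> (int r) x) = (\<Sum>r=1..n. \<chi> (- x) (0 - int r))"
    by (rule sum.cong) (simp_all add: \<chi>_def mult.commute)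
  also have "\<dots> = (\<Sum>y\<in>{0..<int n}. \<chi> (- x) (0 - y))"
    by (rule sum_positions[OF periodic_chi]) (rule eq_if_cong)
  also have "\<dots> = (\<Sum>y\<in>{0..<int n}. 1 * \<chi> (- x) (0 - y))" by simp
  also have "\<dots> = 0" by (rule sum_chi_zero[where d = 1]) (use False in \<open>simp_all add: periodic_def\<close>)
  finally show ?thesis using False by simp
qed

lemma fourier_inversion:
  assumes j: "j \<in> {1..n}"
  shows "(\<Sum>r=1..n. herm n v (wvec n r) * \<chi> (int r) (int j - 1)) = of_nat n * of_rat (v j)"
proof -
  have "(\<Sum>r=1..n. herm n v (wvec n r) * \<chi> (int r) (int j - 1))
     = (\<Sum>r=1..n. \<Sum>i=1..n. of_rat (v i) * \<chi> (int r) (int j - int i))"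
    unfolding herm_chi sum_distrib_right mult.assoc chi_add[symmetric] by (simp add: algebra_simps)
  also have "\<dots> = (\<Sum>i=1..n. of_rat (v i) * (\<Sum>r=1..n. \<chi> (int r) (int j - int i)))"
    by (subst sum.swap) (simp add: sum_distrib_left)
  also have "\<dots> = (\<Sum>i=1..n. if i = j then of_nat n * of_rat (v j) else 0)"
    unfolding sum_chi_all using cong_iff_eq[OF j] by (intro sum.cong) auto
  also have "\<dots> = of_nat n * of_rat (v j)" using j by simp
  finally show ?thesis .
qed

lemma eq_if_herm_eq:
  assumes "v \<in> Qvec n" "w \<in> Qvec n" and eq: "\<And>r. r \<in> {1..n} \<Longrightarrow> herm n v (wvec n r) = herm n w (wvec n r)"
  shows "v = w"
proof
  fix j
  show "v j = w j"
  proof (cases "j \<in> {1..n}")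
    case True
    have "of_nat n * of_rat (v j) = (of_nat n * of_rat (w j) :: complex)"
      unfolding fourier_inversion[OF True, symmetric] by (rule sum.cong) (simp_all add: eq)
    then show ?thesis using n_pos by simp
  next
    case False
    then show ?thesis using assms(1,2) by (simp add: Qvec_def)
  qed
qed

lemma Vper_herm_zero:
  assumes d: "d dvd n" and v: "v \<in> Vper n d" and r: "\<not> n dvd r * d"
  shows "herm n v (wvec n r) = 0"
proof -
  let ?F = "\<lambda>x. of_rat (v (rep x)) :: complex"
  have "herm n v (wvec n r) = (\<Sum>i=1..n. ?F (int i) * \<chi> (int r) (1 - int i))"
    unfolding herm_chi by (rule sum.cong) (simp_all add: rep_of_nat)
  also have "\<dots> = (\<Sum>y\<in>{0..<int n}. ?F y * \<chi> (int r) (1 - y))"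
  proof (rule sum_positions[where \<phi> = int and h = "\<lambda>y. ?F y * \<chi> (int r) (1 - y)"])
    show "periodic (int n) (\<lambda>y. ?F y * \<chi> (int r) (1 - y))"
      using periodic_rep[of v] periodic_chi[of "int r" 1] by (simp add: periodic_def)
  qed (rule eq_if_cong)
  also have "\<dots> = 0"
  proof (rule sum_chi_zero)
    show "periodic (int n) ?F" by (rule periodic_rep)
    show "\<not> int n dvd int r * int d" using r by (metis of_nat_dvd_iff of_nat_mult)
    fix y
    have "int d dvd int n" using d by simp
    then have "int d dvd (int (rep (y + int d)) - (y + int d)) - (int (rep y) - y) + int d"
      using rep_cong by (meson dvd_add dvd_diff dvd_refl dvd_trans)
    then have "int d dvd int (rep (y + int d)) - int (rep y)" by (simp add: algebra_simps)
    then show "?F (y + int d) = ?F y" using v rep_mem unfolding Vper_iff[OF d] by metis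
  qed
  finally show ?thesis .
qed

text \<open>By Fourier inversion v is a combination of characters with \<open>n dvd r * d\<close>,
  which all have period d. Together with \<open>Vper_herm_zero\<close> this describes V_d by its
  frequencies.\<close>

lemma Vper_if_herm_zero:
  assumes d: "d dvd n" and v: "v \<in> Qvec n"
    and z: "\<And>r. r \<in> {1..n} \<Longrightarrow> \<not> n dvd r * d \<Longrightarrow> herm n v (wvec n r) = 0"
  shows "v \<in> Vper n d"
proof -
  have "v i = v j" if ij: "i \<in> {1..n}" "j \<in> {1..n}" "int d dvd int i - int j" for i j
  proof -
    have "of_nat n * of_rat (v i) = (of_nat n * of_rat (v j) :: complex)"
      unfolding fourier_inversion[OF ij(1), symmetric] fourier_inversion[OF ij(2), symmetric]
    proof (rule sum.cong)
      fix r assume r: "r \<in> {1..n}"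
      show "herm n v (wvec n r) * \<chi> (int r) (int i - 1) = herm n v (wvec n r) * \<chi> (int r) (int j - 1)"
      proof (cases "n dvd r * d")
        case True
        then have "int n dvd int r * int d" by (metis of_nat_dvd_iff of_nat_mult)
        then have "int n dvd int r * (int i - int j)" using ij(3) by (meson dvd_refl dvd_trans mult_dvd_mono)
        then have "\<chi> (int r) (int i - 1) = \<chi> (int r) (int j - 1)" by (intro chi_cong) simp
        then show ?thesis by simp
      qed (use z r in simp)
    qed simp
    then show ?thesis using n_pos by simp
  qed
  then show ?thesis using v unfolding Vper_iff[OF d] by blast
qed

text \<open>The Fourier vector is complex while V_d is rational. But \<open>n dvd r * d\<close>
  makes it d-periodic, hence a complex combination of the rational indicators \<open>u c\<close> of
  the residue classes modulo d.\<close>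

lemma herm_zero_if_orthogonal:
  assumes d: "d dvd n" and v: "\<And>w. w \<in> Vper n d \<Longrightarrow> qinner n v w = 0" and r: "n dvd r * d"
  shows "herm n v (wvec n r) = 0"
proof -
  have d0: "0 < d" using d n_pos by (auto intro: gr0I)
  define u where "u c i = (of_bool (i \<in> {1..n} \<and> int d dvd int i - c) :: rat)" for c :: int and i :: nat
  have u: "u c \<in> Vper n d" for c
  proof -
    have "u c i = u c j" if ij: "i \<in> {1..n}" "j \<in> {1..n}" "int d dvd int i - int j" for i j
    proof -
      have "int d dvd int i - c \<longleftrightarrow> int d dvd int j - c"
        using dvd_add_right_iff[OF ij(3), of "int j - c"] by simp
      then show ?thesis using ij by (simp add: u_def)
    qed
    moreover have "u c \<in> Qvec n" by (auto simp: Qvec_def u_def)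
    ultimately show ?thesis unfolding Vper_iff[OF d] by blast
  qed
  have chi: "\<chi> (int r) (1 - int i) = (\<Sum>c\<in>{0..<int d}. \<chi> (int r) (1 - c) * of_rat (u c i))" if i: "i \<in> {1..n}" for i
  proof -
    have "(\<Sum>c\<in>{0..<int d}. \<chi> (int r) (1 - c) * of_rat (u c i)) = (\<Sum>c\<in>{0..<int d}. if c = int i mod int d then \<chi> (int r) (1 - int i) else 0)"
    proof (rule sum.cong)
      fix c assume c: "c \<in> {0..<int d}"
      have iff: "c = int i mod int d \<longleftrightarrow> int d dvd int i - c" using c by (metis atLeastLessThan_iff mod_eq_dvd_iff mod_pos_pos_trivial)
      show "\<chi> (int r) (1 - c) * of_rat (u c i) = (if c = int i mod int d then \<chi> (int r) (1 - int i) else 0)"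
      proof (cases "int d dvd int i - c")
        case True
        have "int n dvd int r * int d" using r by (metis of_nat_dvd_iff of_nat_mult)
        then have "int n dvd int r * (int i - c)" using True by (meson dvd_refl dvd_trans mult_dvd_mono)
        then have "\<chi> (int r) (1 - c) = \<chi> (int r) (1 - int i)" by (intro chi_cong) simp
        then show ?thesis using True iff i by (simp add: u_def)
      next
        case False
        then show ?thesis using iff by (simp add: u_def)
      qed
    qed simp
    also have "\<dots> = \<chi> (int r) (1 - int i)" using d0 by simp
    finally show ?thesis ..
  qed
  have "herm n v (wvec n r) = (\<Sum>i=1..n. \<Sum>c\<in>{0..<int d}. \<chi> (int r) (1 - c) * of_rat (v i * u c i))"
    unfolding herm_chi by (rule sum.cong) (simp_all add: chi sum_distrib_left of_rat_mult mult_ac)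
  also have "\<dots> = (\<Sum>c\<in>{0..<int d}. \<chi> (int r) (1 - c) * of_rat (qinner n v (u c)))"
    by (subst sum.swap) (simp add: qinner_def of_rat_sum sum_distrib_left)
  also have "\<dots> = 0" using v[OF u] by simp
  finally show ?thesis .
qed

text \<open>Parseval: w only has frequencies with \<open>n dvd r * d\<close>, and there the
  coefficients of v vanish.\<close>

lemma orthogonal_if_herm_zero:
  assumes d: "d dvd n" and z: "\<And>r. r \<in> {1..n} \<Longrightarrow> n dvd r * d \<Longrightarrow> herm n v (wvec n r) = 0"
    and w: "w \<in> Vper n d"
  shows "qinner n v w = 0"
proof -
  have "of_nat n * of_rat (qinner n v w) = (\<Sum>j=1..n. of_rat (v j) * (of_nat n * of_rat (w j)) :: complex)"
    by (simp add: qinner_def of_rat_sum of_rat_mult sum_distrib_left mult_ac)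
  also have "\<dots> = (\<Sum>j=1..n. \<Sum>r=1..n. herm n w (wvec n r) * (of_rat (v j) * \<chi> (int r) (int j - 1)))"
    by (rule sum.cong) (simp_all add: fourier_inversion[symmetric] sum_distrib_left mult_ac)
  also have "\<dots> = (\<Sum>r=1..n. herm n w (wvec n r) * (\<Sum>j=1..n. of_rat (v j) * \<chi> (int r) (int j - 1)))"
    by (subst sum.swap) (simp add: sum_distrib_left)
  also have "\<dots> = (\<Sum>r=1..n. herm n w (wvec n r) * cnj (herm n v (wvec n r)))"
    by (simp add: herm_chi cnj_sum cnj_chi cnj_of_rat)
  also have "\<dots> = 0"
  proof (rule sum.neutral, rule ballI)
    fix r assume r: "r \<in> {1..n}"
    show "herm n w (wvec n r) * cnj (herm n v (wvec n r)) = 0"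
      using z[OF r] Vper_herm_zero[OF d w, of r] by (cases "n dvd r * d") simp_all
  qed
  finally show ?thesis using n_pos by simp
qed

text \<open>Period d excludes the frequencies with \<open>\<not> n dvd r * d\<close>, and
  orthogonality to a covered V_d' excludes those with \<open>n dvd r * d'\<close>; what remains is
  Psi.\<close>

lemma Ud_iff:
  assumes d: "d \<in> DG n G"
  shows "v \<in> Ud n G d \<longleftrightarrow> v \<in> Qvec n \<and> (\<forall>r\<in>{1..n} - Psi n G d. herm n v (wvec n r) = 0)"
proof
  assume v: "v \<in> Ud n G d"
  show "v \<in> Qvec n \<and> (\<forall>r\<in>{1..n} - Psi n G d. herm n v (wvec n r) = 0)"
  proof (intro conjI ballI)
    show "v \<in> Qvec n" using v by (simp add: Ud_def Vper_def)
    fix r assume r: "r \<in> {1..n} - Psi n G d"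
    show "herm n v (wvec n r) = 0"
    proof (cases "n dvd r * d")
      case False
      then show ?thesis using v DG_dvd[OF d] by (intro Vper_herm_zero) (auto simp: Ud_def)
    next
      case True
      then obtain d' where d': "d' \<in> DG n G" "covers n G d d'" "n dvd r * d'" using r Psi_iff[OF d] by blast
      then show ?thesis using v by (intro herm_zero_if_orthogonal[OF DG_dvd]) (auto simp: Ud_def)
    qed
  qed
next
  assume v: "v \<in> Qvec n \<and> (\<forall>r\<in>{1..n} - Psi n G d. herm n v (wvec n r) = 0)"
  have "v \<in> Vper n d"
    by (rule Vper_if_herm_zero[OF DG_dvd[OF d]]) (use v Psi_iff[OF d] in auto)
  moreover have "qinner n v w = 0" if "d' \<in> DG n G" "covers n G d d'" "w \<in> Vper n d'" for d' w
    by (rule orthogonal_if_herm_zero[OF DG_dvd[OF that(1)] _ that(3)]) (use v that Psi_iff[OF d] in auto)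
  ultimately show "v \<in> Ud n G d" by (simp add: Ud_def)
qed

section \<open>Convolution operators and their multipliers\<close>

definition star :: "(int \<Rightarrow> rat) \<Rightarrow> (nat \<Rightarrow> rat) \<Rightarrow> nat \<Rightarrow> rat" where
  "star f v i = (if i \<in> {1..n} then \<Sum>j=1..n. f (int i - int j) * v j else 0)"

definition hat :: "(int \<Rightarrow> rat) \<Rightarrow> nat \<Rightarrow> complex" where
  "hat f r = (\<Sum>y\<in>{0..<int n}. of_rat (f y) * \<chi> (int r) (0 - y))"

lemma herm_star:
  assumes f: "periodic (int n) f"
  shows "herm n (star f v) (wvec n r) = hat f r * herm n v (wvec n r)"
proof -
  have inner: "(\<Sum>i=1..n. of_rat (f (int i - int j)) * \<chi> (int r) (0 - (int i - int j))) = hat f r" for j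
    unfolding hat_def
  proof (rule sum_positions[where \<phi> = "\<lambda>i. int i - int j" and h = "\<lambda>y. of_rat (f y) * \<chi> (int r) (0 - y)"])
    show "periodic (int n) (\<lambda>y. of_rat (f y) * \<chi> (int r) (0 - y))"
      using f periodic_chi[of "int r" 0] by (simp add: periodic_def)
  next
    fix k l assume kl: "k \<in> {1..n}" "l \<in> {1..n}" "int n dvd (int k - int j) - (int l - int j)"
    then have "int n dvd int k - int l" by simp
    then show "k = l" using kl by (intro eq_if_cong)
  qed
  have "herm n (star f v) (wvec n r) = (\<Sum>i=1..n. \<Sum>j=1..n.
      of_rat (f (int i - int j)) * of_rat (v j) * (\<chi> (int r) (0 - (int i - int j)) * \<chi> (int r) (1 - int j)))"
    unfolding herm_chi chi_add[symmetric]
    by (rule sum.cong) (simp_all add: star_def of_rat_sum of_rat_mult sum_distrib_right)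
  also have "\<dots> = (\<Sum>j=1..n. (\<Sum>i=1..n. of_rat (f (int i - int j)) * \<chi> (int r) (0 - (int i - int j)))
      * (of_rat (v j) * \<chi> (int r) (1 - int j)))"
    by (subst sum.swap) (simp add: sum_distrib_left sum_distrib_right mult_ac)
  also have "\<dots> = hat f r * herm n v (wvec n r)"
    unfolding inner herm_chi by (simp add: sum_distrib_left)
  finally show ?thesis .
qed

text \<open>The Fourier sum of the subgroup of multiples of h is its order modulo n if
  \<open>n dvd r * h\<close>, and 0 otherwise. By \<open>Psi_dvd_iff\<close> the condition is
  \<open>d dvd h\<close>, so r disappears from the value.\<close>

lemma hat_combination:
  assumes d: "d \<in> DG n G" and r: "r \<in> Psi n G d"
    and f: "\<And>x. f x = (\<Sum>h\<in>DG n G. c h * of_bool (int h dvd x))"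
  shows "hat f r = (\<Sum>h\<in>DG n G. of_rat (c h * of_nat (card {y\<in>{0..<int n}. int h dvd y}) * of_bool (d dvd h)))"
proof -
  have ind: "(\<Sum>y\<in>{0..<int n}. of_bool (int h dvd y) * \<chi> (int r) (0 - y)) = of_nat (card {y\<in>{0..<int n}. int h dvd y}) * of_bool (d dvd h)"
    if h: "h \<in> DG n G" for h
  proof (cases "d dvd h")
    case True
    then have "n dvd r * h" using Psi_dvd_iff[OF d r h] by simp
    then have "int n dvd int r * int h" by (metis of_nat_dvd_iff of_nat_mult)
    then have "\<chi> (int r) (0 - y) = 1" if "int h dvd y" for y
      using that unfolding chi_eq_1_iff by (meson dvd_0_right dvd_diff dvd_refl dvd_trans mult_dvd_mono)
    then have "(\<Sum>y\<in>{0..<int n}. of_bool (int h dvd y) * \<chi> (int r) (0 - y)) = (\<Sum>y\<in>{0..<int n}. of_bool (int h dvd y))"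
      by (intro sum.cong) auto
    then show ?thesis using True by (simp add: Int_def)
  next
    case False
    then have "\<not> n dvd r * h" using Psi_dvd_iff[OF d r h] by simp
    then have nd: "\<not> int n dvd int r * int h" by (metis of_nat_dvd_iff of_nat_mult)
    have "int h dvd int n" using DG_dvd[OF h] by simp
    then have "periodic (int n) (\<lambda>y. of_bool (int h dvd y) :: complex)" by (simp add: periodic_def dvd_mod_iff)
    then have "(\<Sum>y\<in>{0..<int n}. of_bool (int h dvd y) * \<chi> (int r) (0 - y)) = 0"
      by (rule sum_chi_zero[OF _ _ nd]) simp
    then show ?thesis using False by simp
  qed
  have "hat f r = (\<Sum>h\<in>DG n G. of_rat (c h) * (\<Sum>y\<in>{0..<int n}. of_bool (int h dvd y) * \<chi> (int r) (0 - y)))"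
    unfolding hat_def f of_rat_sum sum_distrib_right sum_distrib_left
    by (subst sum.swap) (simp only: of_rat_mult of_rat_of_bool mult.assoc)
  also have "\<dots> = (\<Sum>h\<in>DG n G. of_rat (c h * of_nat (card {y\<in>{0..<int n}. int h dvd y}) * of_bool (d dvd h)))"
    by (rule sum.cong) (simp_all only: ind of_rat_mult of_rat_of_bool of_rat_of_nat_eq mult.assoc)
  finally show ?thesis .
qed

text \<open>Kernel of the projection onto U_d. Dividing by \<open>\<kappa> h\<close> cancels the
  subgroup orders in \<open>hat_combination\<close>; the remaining system is triangular for reversed
  divisibility, hence the ranking by \<open>n - h\<close>.\<close>

lemma ex_component_kernel:
  assumes d: "d \<in> DG n G"
  shows "\<exists>f. periodic (int n) f \<and> (\<forall>r\<in>{1..n}. hat f r = of_bool (r \<in> Psi n G d))"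
proof -
  define \<kappa> where "\<kappa> h = (of_nat (card {y\<in>{0..<int n}. int h dvd y}) :: rat)" for h
  have k: "\<kappa> h \<noteq> 0" for h
  proof -
    have "finite {y\<in>{0..<int n}. int h dvd y}" by (rule finite_subset[of _ "{0..<int n}"]) auto
    moreover have "0 \<in> {y\<in>{0..<int n}. int h dvd y}" using n_pos by simp
    ultimately have "card {y\<in>{0..<int n}. int h dvd y} \<noteq> 0" by (metis card_0_eq empty_iff)
    then show ?thesis by (simp add: \<kappa>_def)
  qed
  have "\<exists>c :: nat \<Rightarrow> rat. \<forall>k\<in>DG n G. (\<Sum>h\<in>DG n G. c h * of_bool (k dvd h)) = of_bool (k = d)"
  proof (rule triangular_solvable[OF finite_DG, where m = "\<lambda>h. n - h"])
    fix h k assume hk: "h \<in> DG n G" "k \<in> DG n G" "k dvd h" "h \<noteq> k"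
    have "k < h" using hk dvd_imp_le[of k h] DG_pos[of h] by simp
    moreover have "h \<le> n" using dvd_imp_le[OF DG_dvd[OF hk(1)] n_pos] .
    ultimately show "n - h < n - k" by simp
  qed simp
  then obtain c :: "nat \<Rightarrow> rat" where c: "\<And>k. k \<in> DG n G \<Longrightarrow> (\<Sum>h\<in>DG n G. c h * of_bool (k dvd h)) = of_bool (k = d)" by blast
  define f where "f x = (\<Sum>h\<in>DG n G. (c h / \<kappa> h) * of_bool (int h dvd x))" for x
  have "periodic (int n) f"
    unfolding periodic_def f_def using DG_dvd by (auto intro!: sum.cong simp: dvd_mod_iff)
  moreover have "hat f r = of_bool (r \<in> Psi n G d)" if r: "r \<in> {1..n}" for r
  proof -
    obtain d' where d': "d' \<in> DG n G" "r \<in> Psi n G d'" using Psi_exists[OF r] by blast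
    have "hat f r = (\<Sum>h\<in>DG n G. of_rat (c h / \<kappa> h * \<kappa> h * of_bool (d' dvd h)))"
      unfolding \<kappa>_def by (rule hat_combination[OF d']) (simp add: f_def \<kappa>_def)
    also have "\<dots> = of_rat (\<Sum>h\<in>DG n G. c h * of_bool (d' dvd h))" using k by (simp add: of_rat_sum)
    also have "\<dots> = of_bool (d' = d)" using c[OF d'(1)] by simp
    also have "d' = d \<longleftrightarrow> r \<in> Psi n G d" using d' d Psi_unique by blast
    finally show ?thesis .
  qed
  ultimately show ?thesis by blast
qed

end

section \<open>Orthogonal projection onto the generated subspace\<close>

lemma qinner_add_left: "qinner n (\<lambda>i. v i + w i) x = qinner n v x + qinner n w x"
  by (simp add: qinner_def distrib_right sum.distrib)

lemma qinner_diff_left: "qinner n (\<lambda>i. v i - w i) x = qinner n v x - qinner n w x"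
  by (simp add: qinner_def left_diff_distrib sum_subtractf)

lemma qinner_scale_left: "qinner n (\<lambda>i. c * v i) x = c * qinner n v x"
  by (simp add: qinner_def sum_distrib_left mult.assoc)

lemma qinner_commute: "qinner n v x = qinner n x v"
  by (simp add: qinner_def mult.commute)

lemma qinner_self_eq_0: "qinner n v v = 0 \<Longrightarrow> i \<in> {1..n} \<Longrightarrow> v i = 0"
  unfolding qinner_def by (subst (asm) sum_nonneg_eq_0_iff) auto

lemma qinner_sum_left: "qinner n (\<lambda>i. \<Sum>a\<in>A. f a i) x = (\<Sum>a\<in>A. qinner n (f a) x)"
  unfolding qinner_def sum_distrib_right by (rule sum.swap)

lemma qsubspace_zero: "qsubspace n W \<Longrightarrow> (\<lambda>i. 0) \<in> W"
  and qsubspace_add: "qsubspace n W \<Longrightarrow> v \<in> W \<Longrightarrow> w \<in> W \<Longrightarrow> (\<lambda>i. v i + w i) \<in> W"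
  and qsubspace_scale: "qsubspace n W \<Longrightarrow> v \<in> W \<Longrightarrow> (\<lambda>i. c * v i) \<in> W"
  by (simp_all add: qsubspace_def)

lemma qsubspace_diff:
  assumes "qsubspace n W" "v \<in> W" "w \<in> W"
  shows "(\<lambda>i. v i - w i) \<in> W"
proof -
  have "(\<lambda>i. v i + (- 1 * w i)) \<in> W"
    by (rule qsubspace_add[OF assms(1,2) qsubspace_scale[OF assms(1,3)]])
  then show ?thesis by simp
qed

lemma qsubspace_sum:
  assumes W: "qsubspace n W" and f: "\<And>a. a \<in> A \<Longrightarrow> f a \<in> W"
  shows "(\<lambda>i. \<Sum>a\<in>A. f a i) \<in> W"
  using f
proof (induction A rule: infinite_finite_induct)
  case (insert a A)
  then have "(\<lambda>i. f a i + (\<Sum>a\<in>A. f a i)) \<in> W" by (intro qsubspace_add[OF W]) auto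
  then show ?case using insert by simp
qed (use W in \<open>auto simp: qsubspace_def\<close>)

text \<open>Gram--Schmidt; the second conjunct replaces membership of \<open>w\<close> in the span of \<open>B\<close>.\<close>

lemma ex_orthogonal_projection:
  assumes W: "qsubspace n W" and "finite B" "B \<subseteq> W"
  shows "\<exists>w\<in>W. (\<forall>b\<in>B. qinner n (\<lambda>i. v i - w i) b = 0)
     \<and> (\<forall>x. (\<forall>b\<in>B. qinner n x b = 0) \<longrightarrow> qinner n x w = 0)"
  using assms(2,3)
proof (induction B arbitrary: v)
  case empty
  have "(\<lambda>i. 0) \<in> W" using W by (simp add: qsubspace_def)
  then show ?case by (intro bexI[of _ "\<lambda>i. 0"]) (auto simp: qinner_def)
next
  case (insert b B)
  have bW: "b \<in> W" and BW: "B \<subseteq> W" using insert.prems by auto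
  obtain w where w: "w \<in> W" "\<forall>b\<in>B. qinner n (\<lambda>i. v i - w i) b = 0"
    "\<forall>x. (\<forall>b\<in>B. qinner n x b = 0) \<longrightarrow> qinner n x w = 0" using insert.IH[OF BW] by blast
  obtain u where u: "u \<in> W" "\<forall>c\<in>B. qinner n (\<lambda>i. b i - u i) c = 0"
    "\<forall>x. (\<forall>b\<in>B. qinner n x b = 0) \<longrightarrow> qinner n x u = 0" using insert.IH[OF BW] by blast
  define b' where "b' i = b i - u i" for i
  have b'W: "b' \<in> W" using qsubspace_diff[OF W bW u(1)] by (simp add: b'_def[abs_def])
  have b'B: "qinner n b' c = 0" if "c \<in> B" for c using u(2) that by (simp add: b'_def[abs_def])
  have b'u: "qinner n b' u = 0" using u(3) b'B by blast
  have b'b: "qinner n b' b = qinner n b' b'"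
  proof -
    have "qinner n b' b' = qinner n b b' - qinner n u b'"
      using qinner_diff_left[of n b u b'] by (simp add: b'_def[abs_def])
    then show ?thesis using b'u by (simp add: qinner_commute)
  qed
  \<comment> \<open>If the denominator is 0, then \<open>b'\<close> vanishes on
    \<open>{1..n}\<close>, so b agrees there with u and the residual of v is already orthogonal to
    b.\<close>
  define t where "t = qinner n (\<lambda>i. v i - w i) b / qinner n b' b"
  define w' where "w' i = w i + t * b' i" for i
  have "w' \<in> W"
  proof -
    have "(\<lambda>i. w i + t * b' i) \<in> W"
      by (rule qsubspace_add[OF W w(1) qsubspace_scale[OF W b'W]])
    then show ?thesis by (simp add: w'_def[abs_def])
  qed
  moreover have diff: "qinner n (\<lambda>i. v i - w' i) c = qinner n (\<lambda>i. v i - w i) c - t * qinner n b' c" for c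
  proof -
    have "(\<lambda>i. v i - w' i) = (\<lambda>i. (v i - w i) - t * b' i)" by (simp add: w'_def fun_eq_iff)
    then show ?thesis by (simp only: qinner_diff_left qinner_scale_left)
  qed
  have "qinner n (\<lambda>i. v i - w' i) c = 0" if "c \<in> insert b B" for c
  proof (cases "c \<in> B")
    case True
    then show ?thesis unfolding diff using w(2) b'B by simp
  next
    case False
    then have c: "c = b" using that by simp
    show ?thesis
    proof (cases "qinner n b' b = 0")
      case False
      then show ?thesis unfolding diff c by (simp add: t_def)
    next
      case True
      then have z: "\<And>i. i \<in> {1..n} \<Longrightarrow> b' i = 0" using b'b qinner_self_eq_0 by metis
      then have "qinner n (\<lambda>i. v i - w i) b = qinner n (\<lambda>i. v i - w i) u"
        unfolding qinner_def by (intro sum.cong) (auto simp: b'_def)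
      also have "\<dots> = 0" using u(3) w(2) by blast
      finally show ?thesis unfolding diff c using True by simp
    qed
  qed
  moreover have "qinner n x w' = 0" if x: "\<forall>c\<in>insert b B. qinner n x c = 0" for x
  proof -
    have "qinner n x w = 0" "qinner n x u = 0" "qinner n x b = 0" using w(3) u(3) x by blast+
    then have "qinner n w x = 0" "qinner n u x = 0" "qinner n b x = 0" by (simp_all add: qinner_commute)
    moreover have "qinner n b' x = qinner n b x - qinner n u x"
      using qinner_diff_left[of n b u x] by (simp add: b'_def[abs_def])
    moreover have "qinner n w' x = qinner n w x + t * qinner n b' x"
      by (simp add: w'_def[abs_def] qinner_add_left qinner_scale_left)
    ultimately have "qinner n w' x = 0" by simp
    then show ?thesis by (simp add: qinner_commute)
  qed
  ultimately show ?case by blast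
qed

lemma perm_act_diff: "perm_act \<sigma> (\<lambda>i. v i - w i) = (\<lambda>i. perm_act \<sigma> v i - perm_act \<sigma> w i)"
  and perm_act_sum: "perm_act \<sigma> (\<lambda>i. \<Sum>a\<in>A. f a i) = (\<lambda>i. \<Sum>a\<in>A. perm_act \<sigma> (f a) i)"
  by (simp_all add: perm_act_def)

context cyclic_perm_group
begin

lemma qinner_perm_act:
  assumes s: "\<sigma> \<in> G"
  shows "qinner n (perm_act \<sigma> v) w = qinner n v (perm_act (inv' \<sigma>) w)"
proof -
  have "qinner n (perm_act \<sigma> v) w = (\<Sum>i\<in>{1..n}. v (inv' \<sigma> i) * w (\<sigma> (inv' \<sigma> i)))"
    by (simp add: qinner_def perm_act_def G_inv_simps[OF s])
  also have "\<dots> = (\<Sum>i\<in>{1..n}. v i * w (\<sigma> i))"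
    by (rule sum.permute[OF G_permutes[OF G_inv[OF s]], of "\<lambda>i. v i * w (\<sigma> i)", unfolded comp_def, symmetric])
  also have "\<dots> = qinner n v (perm_act (inv' \<sigma>) w)"
    by (simp add: qinner_def perm_act_def G_inv_inv[OF s])
  finally show ?thesis .
qed

lemma perm_act_comp:
  assumes "\<sigma> \<in> G" "\<tau> \<in> G"
  shows "perm_act \<sigma> (perm_act \<tau> v) = perm_act (\<sigma> \<circ> \<tau>) v"
proof -
  have "inv' (\<sigma> \<circ> \<tau>) = inv' \<tau> \<circ> inv' \<sigma>"
    by (rule o_inv_distrib) (use assms G_permutes permutes_bij in auto)
  then show ?thesis by (simp add: perm_act_def)
qed

lemma perm_act_id: "perm_act id v = v" by (simp add: perm_act_def)

lemma Ud_perm_act: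
  assumes s: "\<sigma> \<in> G" and d: "d \<in> DG n G" and v: "v \<in> Ud n G d"
  shows "perm_act \<sigma> v \<in> Ud n G d"
proof -
  have "perm_act \<sigma> v \<in> Vper n d" using s d v by (auto simp: DG_def G_invariant_def Ud_def)
  moreover have "qinner n (perm_act \<sigma> v) w = 0" if d': "d' \<in> DG n G" "covers n G d d'" "w \<in> Vper n d'" for d' w
  proof -
    have "perm_act (inv' \<sigma>) w \<in> Vper n d'" using d' G_inv[OF s] by (auto simp: DG_def G_invariant_def)
    then show ?thesis unfolding qinner_perm_act[OF s] using v d' by (auto simp: Ud_def)
  qed
  ultimately show ?thesis by (simp add: Ud_def)
qed

lemma Ud_subspace: 
  assumes d: "d \<in> DG n G"
  shows "qsubspace n (Ud n G d)"
proof -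
  have "herm n (\<lambda>i. v i + w i) x = herm n v x + herm n w x" for v w x
    by (simp add: herm_def of_rat_add distrib_right sum.distrib)
  moreover have "herm n (\<lambda>i. c * v i) x = of_rat c * herm n v x" for c v x
    by (simp add: herm_def of_rat_mult mult.assoc sum_distrib_left)
  moreover have "herm n (\<lambda>i. 0) x = 0" for x by (simp add: herm_def)
  moreover have "Ud n G d = {v \<in> Qvec n. \<forall>r\<in>{1..n} - Psi n G d. herm n v (wvec n r) = 0}"
    using Ud_iff[OF d] by blast
  ultimately show ?thesis unfolding qsubspace_def by (auto simp: Qvec_def)
qed

end

locale generated_invariant_subspace = cyclic_perm_group +
  fixes \<delta> :: "nat \<Rightarrow> rat"
  assumes delta_Qvec: "\<delta> \<in> Qvec n"
begin

definition W :: "(nat \<Rightarrow> rat) set" where "W = V_delta n G \<delta>"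

lemma W_least: "qsubspace n X \<Longrightarrow> G_invariant G X \<Longrightarrow> \<delta> \<in> X \<Longrightarrow> W \<subseteq> X"
  by (auto simp: W_def V_delta_def)

lemma Qvec_subspace: "qsubspace n (Qvec n)"
  by (auto simp: qsubspace_def Qvec_def)

lemma Qvec_invariant: "G_invariant G (Qvec n)"
  using perm_act_Qvec by (auto simp: G_invariant_def)

lemma W_Qvec: "W \<subseteq> Qvec n"
  by (rule W_least[OF Qvec_subspace Qvec_invariant delta_Qvec])

lemma W_zero: "v \<in> W \<Longrightarrow> i \<notin> {1..n} \<Longrightarrow> v i = 0"
  using subsetD[OF W_Qvec] by (simp add: Qvec_def)

lemma W_subspace: "qsubspace n W"
proof -
  have "(\<lambda>i. 0) \<in> W" unfolding W_def V_delta_def using qsubspace_zero by blast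
  moreover have "(\<lambda>i. v i + w i) \<in> W" if "v \<in> W" "w \<in> W" for v w
    unfolding W_def V_delta_def
  proof (rule InterI)
    fix X assume X: "X \<in> {W. qsubspace n W \<and> G_invariant G W \<and> \<delta> \<in> W}"
    then have "v \<in> X" "w \<in> X" using that unfolding W_def V_delta_def by blast+
    then show "(\<lambda>i. v i + w i) \<in> X" using X by (intro qsubspace_add[of n]) simp_all
  qed
  moreover have "(\<lambda>i. c * v i) \<in> W" if "v \<in> W" for c v
    unfolding W_def V_delta_def
  proof (rule InterI)
    fix X assume X: "X \<in> {W. qsubspace n W \<and> G_invariant G W \<and> \<delta> \<in> W}"
    then have "v \<in> X" using that unfolding W_def V_delta_def by blast
    then show "(\<lambda>i. c * v i) \<in> X" using X by (intro qsubspace_scale[of n]) simp_all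
  qed
  ultimately show ?thesis using W_Qvec by (simp add: qsubspace_def)
qed

lemma W_invariant: "\<sigma> \<in> G \<Longrightarrow> v \<in> W \<Longrightarrow> perm_act \<sigma> v \<in> W"
  unfolding W_def V_delta_def G_invariant_def by blast

lemma delta_W: "\<delta> \<in> W"
  by (auto simp: W_def V_delta_def)

lemma W_diff: "v \<in> W \<Longrightarrow> w \<in> W \<Longrightarrow> (\<lambda>i. v i - w i) \<in> W"
  by (rule qsubspace_diff[OF W_subspace])

definition is_proj :: "(nat \<Rightarrow> rat) \<Rightarrow> (nat \<Rightarrow> rat) \<Rightarrow> bool" where
  "is_proj v w \<longleftrightarrow> w \<in> W \<and> (\<forall>x\<in>W. qinner n (\<lambda>i. v i - w i) x = 0)"

text \<open>Projecting along the finite orbit B of \<open>\<delta>\<close> suffices: the double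
  orthogonal complement X of B is an invariant subspace containing \<open>\<delta>\<close>, so it
  contains W, and orthogonality to B implies orthogonality to W.\<close>

lemma is_proj_exists: "\<exists>w. is_proj v w"
proof -
  define B where "B = (\<lambda>\<sigma>. perm_act \<sigma> \<delta>) ` G"
  have "B \<subseteq> W" using W_invariant delta_W by (auto simp: B_def)
  moreover have "finite B" using finite_G by (simp add: B_def)
  ultimately obtain w where w: "w \<in> W" "\<forall>b\<in>B. qinner n (\<lambda>i. v i - w i) b = 0"
    using ex_orthogonal_projection[OF W_subspace] by blast
  define X where "X = {v \<in> Qvec n. \<forall>x. (\<forall>b\<in>B. qinner n x b = 0) \<longrightarrow> qinner n x v = 0}"
  have "qsubspace n X"
    unfolding qsubspace_def
  proof (intro conjI ballI allI)
    show "X \<subseteq> Qvec n" by (auto simp: X_def)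
    show "(\<lambda>i. 0) \<in> X" by (simp add: X_def Qvec_def qinner_def)
  next
    fix v w assume "v \<in> X" "w \<in> X"
    then show "(\<lambda>i. v i + w i) \<in> X"
      unfolding X_def by (auto simp: qinner_commute[of n _ "\<lambda>i. v i + w i"] qinner_add_left qinner_commute[of n v] qinner_commute[of n w] Qvec_def)
  next
    fix c v assume "v \<in> X"
    then show "(\<lambda>i. c * v i) \<in> X"
      unfolding X_def by (auto simp: qinner_commute[of n _ "\<lambda>i. c * v i"] qinner_scale_left qinner_commute[of n v] Qvec_def)
  qed
  moreover have "G_invariant G X" unfolding G_invariant_def
  proof (intro ballI)
    fix \<sigma> v assume s: "\<sigma> \<in> G" and v: "v \<in> X"
    have "qinner n x (perm_act \<sigma> v) = 0" if x: "\<forall>b\<in>B. qinner n x b = 0" for x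
    proof -
      have "qinner n (perm_act (inv' \<sigma>) x) b = 0" if "b \<in> B" for b
      proof -
        obtain \<tau> where t: "\<tau> \<in> G" "b = perm_act \<tau> \<delta>" using \<open>b \<in> B\<close> by (auto simp: B_def)
        have "qinner n (perm_act (inv' \<sigma>) x) b = qinner n x (perm_act \<sigma> b)"
          using qinner_perm_act[OF G_inv[OF s]] by (simp add: G_inv_inv[OF s])
        moreover have "perm_act \<sigma> b \<in> B" unfolding t(2) perm_act_comp[OF s t(1)] B_def using G_comp[OF s t(1)] by blast
        ultimately show ?thesis using x by simp
      qed
      then have "qinner n (perm_act (inv' \<sigma>) x) v = 0" using v by (simp add: X_def)
      then show ?thesis using qinner_perm_act[OF G_inv[OF s], of x v] by (simp add: G_inv_inv[OF s])
    qed
    then show "perm_act \<sigma> v \<in> X" using perm_act_Qvec[OF s] v by (simp add: X_def)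
  qed
  moreover have "\<delta> \<in> X"
  proof -
    have "\<delta> \<in> B" unfolding B_def using G_id perm_act_id by (metis image_eqI)
    then show ?thesis using delta_Qvec by (auto simp: X_def)
  qed
  ultimately have "W \<subseteq> X" by (rule W_least)
  then show ?thesis using w unfolding is_proj_def X_def by blast
qed

lemma is_proj_unique:
  assumes "is_proj v w" "is_proj v w'"
  shows "w = w'"
proof
  fix i
  let ?d = "\<lambda>i. w' i - w i"
  have d: "?d \<in> W" using assms by (auto simp: is_proj_def intro: W_diff)
  have "(\<lambda>i. (v i - w i) - (v i - w' i)) = ?d" by auto
  then have "qinner n ?d ?d = qinner n (\<lambda>i. v i - w i) ?d - qinner n (\<lambda>i. v i - w' i) ?d"
    using qinner_diff_left[of n "\<lambda>i. v i - w i" "\<lambda>i. v i - w' i" ?d] by simp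
  also have "\<dots> = 0" using assms d by (simp add: is_proj_def)
  finally have z: "qinner n ?d ?d = 0" .
  show "w i = w' i"
  proof (cases "i \<in> {1..n}")
    case True
    then show ?thesis using qinner_self_eq_0[OF z] by simp
  next
    case False
    then show ?thesis using assms W_zero[of w i] W_zero[of w' i] unfolding is_proj_def by metis
  qed
qed

definition unit :: "nat \<Rightarrow> nat \<Rightarrow> rat" where "unit j i = of_bool (i = j)"

definition proj :: "nat \<Rightarrow> nat \<Rightarrow> rat" where "proj j = (SOME w. is_proj (unit j) w)"

lemma is_proj_proj: "is_proj (unit j) (proj j)"
  unfolding proj_def by (rule someI_ex[OF is_proj_exists])

lemma is_proj_sum:
  assumes v: "v \<in> Qvec n"
  shows "is_proj v (\<lambda>i. \<Sum>j=1..n. v j * proj j i)"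
proof -
  have pW: "proj j \<in> W" for j using is_proj_proj by (simp add: is_proj_def)
  then have "(\<lambda>i. v j * proj j i) \<in> W" for j by (rule qsubspace_scale[OF W_subspace])
  then have "(\<lambda>i. \<Sum>j=1..n. v j * proj j i) \<in> W" by (intro qsubspace_sum[OF W_subspace])
  moreover have "qinner n (\<lambda>i. v i - (\<Sum>j=1..n. v j * proj j i)) x = 0" if x: "x \<in> W" for x
  proof -
    have vs: "v i = (\<Sum>j=1..n. v j * unit j i)" for i
    proof (cases "i \<in> {1..n}")
      case True
      have "(\<Sum>j=1..n. v j * unit j i) = (\<Sum>j=1..n. if j = i then v i else 0)" by (rule sum.cong) (auto simp: unit_def)
      also have "\<dots> = v i" using True by simp
      finally show ?thesis ..
    next
      case False
      then have "v i = 0" using v by (simp add: Qvec_def)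
      moreover have "(\<Sum>j=1..n. v j * unit j i) = 0" using False by (intro sum.neutral) (auto simp: unit_def)
      ultimately show ?thesis by simp
    qed
    have "v i - (\<Sum>j=1..n. v j * proj j i) = (\<Sum>j=1..n. v j * (unit j i - proj j i))" for i
      using vs[of i] by (simp add: right_diff_distrib sum_subtractf)
    then have "(\<lambda>i. v i - (\<Sum>j=1..n. v j * proj j i)) = (\<lambda>i. \<Sum>j=1..n. v j * (unit j i - proj j i))"
      by (rule ext)
    then have "qinner n (\<lambda>i. v i - (\<Sum>j=1..n. v j * proj j i)) x = (\<Sum>j=1..n. v j * qinner n (\<lambda>i. unit j i - proj j i) x)"
      by (simp only: qinner_sum_left qinner_scale_left)
    also have "\<dots> = 0" using is_proj_proj x by (simp add: is_proj_def)
    finally show ?thesis .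
  qed
  ultimately show ?thesis unfolding is_proj_def by blast
qed

text \<open>G preserves W and the scalar product, so it maps the projection of a unit vector to the
  projection of the permuted unit vector.\<close>

lemma proj_equivariant:
  assumes s: "\<sigma> \<in> G"
  shows "proj (\<sigma> j) (\<sigma> i) = proj j i"
proof -
  have "k = \<sigma> j \<longleftrightarrow> inv' \<sigma> k = j" for k using G_inv_simps[OF s] by metis
  then have "unit (\<sigma> j) = perm_act \<sigma> (unit j)" by (simp add: unit_def perm_act_def fun_eq_iff)
  moreover have "is_proj (perm_act \<sigma> (unit j)) (perm_act \<sigma> (proj j))"
    unfolding is_proj_def
  proof (intro conjI ballI)
    show "perm_act \<sigma> (proj j) \<in> W" using is_proj_proj by (auto simp: is_proj_def intro: W_invariant[OF s])
    fix x assume "x \<in> W"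
    then have "perm_act (inv' \<sigma>) x \<in> W" by (rule W_invariant[OF G_inv[OF s]])
    then show "qinner n (\<lambda>i. perm_act \<sigma> (unit j) i - perm_act \<sigma> (proj j) i) x = 0"
      unfolding perm_act_diff[symmetric] qinner_perm_act[OF s] using is_proj_proj by (simp add: is_proj_def)
  qed
  ultimately have "proj (\<sigma> j) = perm_act \<sigma> (proj j)" using is_proj_proj[of "\<sigma> j"] by (metis is_proj_unique)
  then show ?thesis by (simp add: perm_act_def G_inv_simps[OF s])
qed

text \<open>Column n of the projection matrix, read as a function of the residue;
  \<open>e_proj\<close> recovers the other columns from it.\<close>

definition e :: "int \<Rightarrow> rat" where "e x = proj n (rep x)"

lemma e_periodic: "periodic (int n) e"
  unfolding e_def[abs_def] by (rule periodic_rep)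

lemma e_proj: "i \<in> {1..n} \<Longrightarrow> j \<in> {1..n} \<Longrightarrow> e (int i - int j) = proj j i"
  unfolding e_def using circulant[of "\<lambda>i j. proj j i" i j] proj_equivariant by simp

lemma is_proj_star: "v \<in> Qvec n \<Longrightarrow> is_proj v (star e v)"
proof -
  assume v: "v \<in> Qvec n"
  have "(\<lambda>i. \<Sum>j=1..n. v j * proj j i) = star e v"
  proof
    fix i
    show "(\<Sum>j=1..n. v j * proj j i) = star e v i"
    proof (cases "i \<in> {1..n}")
      case True
      then show ?thesis unfolding star_def by (auto intro!: sum.cong simp: e_proj)
    next
      case False
      then have "proj j i = 0" for j
        using is_proj_proj[of j] unfolding is_proj_def by (intro W_zero) blast+
      then show ?thesis using False by (auto simp: star_def)
    qed
  qed
  then show ?thesis using is_proj_sum[OF v] by simp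
qed

lemma star_mem: "v \<in> Qvec n \<Longrightarrow> star e v \<in> W"
  using is_proj_star by (simp add: is_proj_def)

lemma star_W: "v \<in> W \<Longrightarrow> star e v = v"
proof -
  assume v: "v \<in> W"
  then have "is_proj v v" by (simp add: is_proj_def qinner_def)
  then show ?thesis using is_proj_star W_Qvec v is_proj_unique by blast
qed

text \<open>Convolving e with itself applies the projection to the column \<open>proj n\<close>,
  which already lies in W.\<close>

lemma e_idempotent: "conv (int n) e e = e"
proof
  fix x
  let ?i = "rep (x + int n)"
  have i: "?i \<in> {1..n}" by (rule rep_mem)
  have "int n dvd int ?i - (x + int n)" by (rule rep_cong)
  then have c: "int n dvd (int ?i - int n) - x" by (simp add: algebra_simps)
  have "conv (int n) e e (int ?i - int n) = (\<Sum>k=1..n. e (int ?i - int k) * e (int k - int n))"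
    by (rule conv_positions_id[OF e_periodic e_periodic])
  also have "\<dots> = star e (proj n) ?i"
    unfolding star_def using i n_pos by (auto intro!: sum.cong simp: e_proj)
  also have "\<dots> = e (int ?i - int n)" using star_W[of "proj n"] is_proj_proj[of n] i n_pos by (simp add: is_proj_def e_proj)
  finally show "conv (int n) e e x = e x"
    using periodicD[OF e_periodic c] periodicD[OF periodic_conv[OF e_periodic] c] by simp
qed

lemma e_mem: "e \<in> CG"
  unfolding CG_def
proof (intro CollectI conjI allI impI ballI)
  fix x y assume "gcd x (int n) = gcd y (int n)"
  then show "e x = e y" using n_pos by (intro idempotent_gcd_cong[OF _ e_periodic e_idempotent]) simp
next
  fix \<sigma> i j assume s: "\<sigma> \<in> G" and ij: "i \<in> {1..n}" "j \<in> {1..n}"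
  then have "\<sigma> i \<in> {1..n}" "\<sigma> j \<in> {1..n}" using G_mem[OF s] by blast+
  then show "e (int (\<sigma> i) - int (\<sigma> j)) = e (int i - int j)" using ij by (simp only: e_proj proj_equivariant[OF s])
qed

lemma Ud_subset_W:
  assumes d: "d \<in> DG n G" and r: "r \<in> Psi n G d" "herm n \<delta> (wvec n r) \<noteq> 0"
  shows "Ud n G d \<subseteq> W"
proof
  fix v assume v: "v \<in> Ud n G d"
  obtain c where c: "\<And>x. e x = (\<Sum>h\<in>DG n G. c h * of_bool (int h dvd x))" using CG_combination[OF e_mem] by blast
  \<comment> \<open>The projection fixes \<open>\<delta>\<close>, so its multiplier is 1 wherever
    \<open>\<delta>\<close> has a nonzero coefficient.\<close>
  have "hat e r * herm n \<delta> (wvec n r) = herm n \<delta> (wvec n r)"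
    using herm_star[OF e_periodic, of \<delta> r] star_W[OF delta_W] by simp
  then have "hat e r = 1" using r by simp
  then have one: "hat e s = 1" if "s \<in> Psi n G d" for s
    using hat_combination[OF d that c] hat_combination[OF d r(1) c] by simp
  have vQ: "v \<in> Qvec n" using v Ud_iff[OF d] by blast
  have "star e v = v"
  proof (rule eq_if_herm_eq)
    show "star e v \<in> Qvec n" using star_mem[OF vQ] W_Qvec by blast
    fix s assume s: "s \<in> {1..n}"
    show "herm n (star e v) (wvec n s) = herm n v (wvec n s)"
    proof (cases "s \<in> Psi n G d")
      case True
      then show ?thesis by (simp add: herm_star[OF e_periodic] one)
    next
      case False
      then have "herm n v (wvec n s) = 0" using v s Ud_iff[OF d] by blast
      then show ?thesis by (simp add: herm_star[OF e_periodic])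
    qed
  qed (rule vQ)
  then show "v \<in> W" using star_mem[OF vQ] by simp
qed

section \<open>The direct sum decomposition of W\<close>

definition S :: "nat set" where
  "S = {d \<in> DG n G. \<exists>r\<in>Psi n G d. herm n \<delta> (wvec n r) \<noteq> 0}"

lemma S_DG: "d \<in> S \<Longrightarrow> d \<in> DG n G" by (simp add: S_def)

lemma finite_S: "finite S" using finite_DG by (simp add: S_def)

lemma herm_sum: "herm n (\<lambda>i. \<Sum>d\<in>A. u d i) w = (\<Sum>d\<in>A. herm n (u d) w)"
  unfolding herm_def of_rat_sum sum_distrib_right by (rule sum.swap)

lemma herm_component:
  assumes u: "\<forall>d\<in>S. u d \<in> Ud n G d" and d: "d \<in> S" and r: "r \<in> Psi n G d"
  shows "herm n (\<lambda>i. \<Sum>d\<in>S. u d i) (wvec n r) = herm n (u d) (wvec n r)"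
proof -
  have rn: "r \<in> {1..n}" using r by (simp add: Psi_def)
  have "herm n (\<lambda>i. \<Sum>d\<in>S. u d i) (wvec n r) = (\<Sum>d'\<in>S. if d' = d then herm n (u d) (wvec n r) else 0)"
    unfolding herm_sum
  proof (rule sum.cong)
    fix d' assume d': "d' \<in> S"
    show "herm n (u d') (wvec n r) = (if d' = d then herm n (u d) (wvec n r) else 0)"
    proof (cases "d' = d")
      case False
      then have "r \<notin> Psi n G d'" using Psi_unique[OF S_DG[OF d'] S_DG[OF d] _ r] by blast
      then have "herm n (u d') (wvec n r) = 0" using u d' rn Ud_iff[OF S_DG[OF d']] by blast
      then show ?thesis using False by simp
    qed simp
  qed simp
  then show ?thesis using d finite_S by simp
qed

lemma components_independent:
  assumes u: "\<forall>d\<in>S. u d \<in> Ud n G d" and z: "(\<lambda>i. \<Sum>d\<in>S. u d i) = (\<lambda>i. 0)" and d: "d \<in> S"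
  shows "u d = (\<lambda>i. 0)"
proof (rule eq_if_herm_eq)
  have ud: "u d \<in> Ud n G d" using u d by blast
  show "u d \<in> Qvec n" using ud Ud_iff[OF S_DG[OF d]] by blast
  show "(\<lambda>i. 0) \<in> Qvec n" by (simp add: Qvec_def)
  fix r assume r: "r \<in> {1..n}"
  have "herm n (u d) (wvec n r) = 0"
  proof (cases "r \<in> Psi n G d")
    case True
    then show ?thesis using herm_component[OF u d True] unfolding z by (simp add: herm_def)
  next
    case False
    then show ?thesis using ud r Ud_iff[OF S_DG[OF d]] by blast
  qed
  then show "herm n (u d) (wvec n r) = herm n (\<lambda>i. 0) (wvec n r)" by (simp add: herm_def)
qed

text \<open>The kernels of \<open>ex_component_kernel\<close> cut \<open>\<delta>\<close> into its
  parts supported on single sets Psi. By the choice of S, all frequencies of \<open>\<delta>\<close>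
  lie in the sets with index in S.\<close>

lemma delta_decomposition: "\<exists>u. (\<forall>d\<in>S. u d \<in> Ud n G d) \<and> \<delta> = (\<lambda>i. \<Sum>d\<in>S. u d i)"
proof -
  have "\<forall>d\<in>S. \<exists>f. periodic (int n) f \<and> (\<forall>r\<in>{1..n}. hat f r = of_bool (r \<in> Psi n G d))"
    using ex_component_kernel S_DG by blast
  then obtain \<rho> where \<rho>: "\<And>d. d \<in> S \<Longrightarrow> periodic (int n) (\<rho> d)"
    "\<And>d r. d \<in> S \<Longrightarrow> r \<in> {1..n} \<Longrightarrow> hat (\<rho> d) r = of_bool (r \<in> Psi n G d)" by metis
  define u where "u d = star (\<rho> d) \<delta>" for d
  have h: "herm n (u d) (wvec n r) = of_bool (r \<in> Psi n G d) * herm n \<delta> (wvec n r)"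
    if "d \<in> S" "r \<in> {1..n}" for d r
    unfolding u_def using herm_star \<rho> that by simp
  have uQ: "u d \<in> Qvec n" for d by (simp add: u_def star_def Qvec_def)
  have u: "\<forall>d\<in>S. u d \<in> Ud n G d" using Ud_iff[OF S_DG] uQ h by simp
  moreover have "\<delta> = (\<lambda>i. \<Sum>d\<in>S. u d i)"
  proof (rule eq_if_herm_eq[OF delta_Qvec])
    show "(\<lambda>i. \<Sum>d\<in>S. u d i) \<in> Qvec n" using qsubspace_sum[OF Qvec_subspace uQ] .
    fix r assume r: "r \<in> {1..n}"
    obtain d where d: "d \<in> DG n G" "r \<in> Psi n G d" using Psi_exists[OF r] by blast
    show "herm n \<delta> (wvec n r) = herm n (\<lambda>i. \<Sum>d\<in>S. u d i) (wvec n r)"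
    proof (cases "d \<in> S")
      case True
      then show ?thesis using herm_component[OF u True d(2)] h[OF True r] d by simp
    next
      case False
      then have "herm n \<delta> (wvec n r) = 0" using d by (auto simp: S_def)
      then show ?thesis unfolding herm_sum using h r by simp
    qed
  qed
  ultimately show ?thesis by blast
qed

lemma W_eq: "W = {(\<lambda>i. \<Sum>d\<in>S. u d i) | u. \<forall>d\<in>S. u d \<in> Ud n G d}" (is "W = ?X")
proof
  show "?X \<subseteq> W"
  proof
    fix v assume "v \<in> ?X"
    then obtain u where u: "v = (\<lambda>i. \<Sum>d\<in>S. u d i)" "\<forall>d\<in>S. u d \<in> Ud n G d" by blast
    have "u d \<in> W" if "d \<in> S" for d
      using that u(2) Ud_subset_W unfolding S_def by blast
    then show "v \<in> W" unfolding u(1) by (rule qsubspace_sum[OF W_subspace])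
  qed
  have sub: "qsubspace n (Ud n G d)" if "d \<in> S" for d using Ud_subspace[OF S_DG[OF that]] .
  have mem: "(\<lambda>i. \<Sum>d\<in>S. u d i) \<in> ?X" if "\<forall>d\<in>S. u d \<in> Ud n G d" for u using that by blast
  have "qsubspace n ?X"
    unfolding qsubspace_def
  proof (intro conjI ballI allI)
    show "?X \<subseteq> Qvec n" using \<open>?X \<subseteq> W\<close> W_Qvec by blast
    have "\<forall>d\<in>S. (\<lambda>i. 0) \<in> Ud n G d" using sub by (simp add: qsubspace_def)
    from mem[OF this] show "(\<lambda>i. 0) \<in> ?X" by simp
  next
    fix v w assume "v \<in> ?X" "w \<in> ?X"
    then obtain u u' where u: "v = (\<lambda>i. \<Sum>d\<in>S. u d i)" "\<forall>d\<in>S. u d \<in> Ud n G d"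
      "w = (\<lambda>i. \<Sum>d\<in>S. u' d i)" "\<forall>d\<in>S. u' d \<in> Ud n G d" by blast
    have "\<forall>d\<in>S. (\<lambda>i. u d i + u' d i) \<in> Ud n G d" using sub u by (simp add: qsubspace_def)
    from mem[OF this] show "(\<lambda>i. v i + w i) \<in> ?X" unfolding u sum.distrib .
  next
    fix c v assume "v \<in> ?X"
    then obtain u where u: "v = (\<lambda>i. \<Sum>d\<in>S. u d i)" "\<forall>d\<in>S. u d \<in> Ud n G d" by blast
    have "\<forall>d\<in>S. (\<lambda>i. c * u d i) \<in> Ud n G d" using sub u by (simp add: qsubspace_def)
    from mem[OF this] show "(\<lambda>i. c * v i) \<in> ?X" unfolding u sum_distrib_left .
  qed
  moreover have "G_invariant G ?X" unfolding G_invariant_def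
  proof (intro ballI)
    fix \<sigma> v assume s: "\<sigma> \<in> G" and "v \<in> ?X"
    then obtain u where u: "v = (\<lambda>i. \<Sum>d\<in>S. u d i)" "\<forall>d\<in>S. u d \<in> Ud n G d" by blast
    have "\<forall>d\<in>S. perm_act \<sigma> (u d) \<in> Ud n G d" using Ud_perm_act[OF s S_DG] u by blast
    from mem[OF this] show "perm_act \<sigma> v \<in> ?X" unfolding u perm_act_sum .
  qed
  moreover have "\<delta> \<in> ?X" using delta_decomposition by blast
  ultimately show "W \<subseteq> ?X" by (rule W_least)
qed

end

text \<open>Directness of the sum is the second conjunct: the zero vector decomposes only
  trivially.\<close>

theorem theorem4:
  fixes n :: nat and G :: "(nat \<Rightarrow> nat) set" and \<delta> :: "nat \<Rightarrow> rat"
  assumes "0 < n"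
    and "subgroup G (sym_group n)"
    and "ncycle n \<in> G"
    and "\<delta> \<in> Qvec n"
  defines "S \<equiv> {d \<in> DG n G. \<exists>r\<in>Psi n G d. herm n \<delta> (wvec n r) \<noteq> 0}"
  shows "V_delta n G \<delta> = {(\<lambda>i. \<Sum>d\<in>S. u d i) | u. \<forall>d\<in>S. u d \<in> Ud n G d}
    \<and> (\<forall>u. (\<forall>d\<in>S. u d \<in> Ud n G d) \<and> (\<lambda>i. \<Sum>d\<in>S. u d i) = (\<lambda>i. 0)
           \<longrightarrow> (\<forall>d\<in>S. u d = (\<lambda>i. 0)))"
proof -
  interpret I: generated_invariant_subspace n G \<delta> 
    by (intro generated_invariant_subspace.intro cyclic_perm_group.intro
        generated_invariant_subspace_axioms.intro) (fact assms)+
  have S: "S = I.S" by (simp add: S_def I.S_def)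
  show ?thesis unfolding S using I.W_eq[unfolded I.W_def] I.components_independent by blast
qed

end
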